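(* Let $\Gamma$ be a finite undirected simple graph with vertex set $V=\{x_1,\dots,x_n\}$, and let $V_{n-1}$ be the set of vertices of degree $n-1$. Suppose $\Gamma(V\setminus V_{n-1})=\ast_{i=1}^k\Gamma^{(i)}$, where no $\Gamma^{(i)}$ can be written as a simplicial join of two graphs with nonempty vertex sets. Call two components $\Gamma^{(i)},\Gamma^{(j)}$ of the same type if they are isomorphic, and let $s$ be the number of types. Then \[\mathrm{Spec}_R(G_\Gamma)=\mathrm{Spec}_R\big(\mathbb{Z}^{|V_{n-1}|}\big)\cdot\prod_{j=1}^s\mathrm{Spec}_R\Big(\prod_{\substack{i:\ \Gamma^{(i)}\text{ of type }j}}G_{\Gamma^{(i)}}\Big).\]
   Context: For a finite undirected simple graph $\Gamma$ with vertex set $\{x_1,\dots,x_n\}$ and edge set $E$, the group $G_\Gamma$ is defined by the presentation with generators $x_1,\dots,x_n$ and $y_{i,j}$ for each pair $i<j$ with $x_ix_j\notin E$, and relations $[x_j,x_i]=1$ if $x_ix_j\in E$; $[x_j,x_i]=y_{i,j}$ if $x_ix_j\notin E$ and $i<j$; and $[x_l,y_{i,j}]=1$ for all $l$ and all such $y_{i,j}$. $\Gamma(V')$ is the subgraph induced on $V'\subseteq V$. The simplicial join $\ast_{i=1}^k\Gamma_i$ of graphs $\Gamma_i(V_i,E_i)$ has vertex set $\bigsqcup_i V_i$ and edge set $\bigsqcup_i E_i\cup\{vw: v\in V_i, w\in V_j, i<j\}$. For a group $G$ and $\varphi\in\mathrm{Aut}(G)$, $R(\varphi)\in\mathbb{N}_0\cup\{\infty\}$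 is the number of classes of $a\sim b\iff a=cb\varphi(c)^{-1}$ for some $c\in G$, and $\mathrm{Spec}_R(G)=\{R(\varphi):\varphi\in\mathrm{Aut}(G)\}$ ($\mathbb{N}_0$ = positive integers). For $M,M'\subseteq\mathbb{N}_0\cup\{\infty\}$, $M\cdot M'=\{mm':m\in M,m'\in M'\}$ (iterated for $\prod$), with products involving $\infty$ equal to $\infty$. *)

theory Defs
  imports "HOL-Algebra.Algebra" "HOL-Library.Extended_Nat"
begin

text \<open>A letter is a generator together with a flag; (g, True) is g, (g, False) is g inverse.
  Words over the generator set S; pres_rel S R is the congruence on S-words generated
  by free cancellation and by deleting relators r in R (i.e. F(S) modulo the normal
  closure of R).\<close>

inductive pres_rel :: "'g set \<Rightarrow> ('g \<times> bool) list set \<Rightarrow> ('g \<times> bool) list \<Rightarrow> ('g \<times> bool) list \<Rightarrow> bool"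
  for S :: "'g set" and R :: "('g \<times> bool) list set" where
  refl: "w \<in> lists (S \<times> UNIV) \<Longrightarrow> pres_rel S R w w"
| sym: "pres_rel S R u v \<Longrightarrow> pres_rel S R v u"
| trans: "pres_rel S R u v \<Longrightarrow> pres_rel S R v w \<Longrightarrow> pres_rel S R u w"
| cancel: "u \<in> lists (S \<times> UNIV) \<Longrightarrow> v \<in> lists (S \<times> UNIV) \<Longrightarrow> x \<in> S \<Longrightarrow>
     pres_rel S R (u @ [(x, b), (x, \<not> b)] @ v) (u @ v)"
| relator: "u \<in> lists (S \<times> UNIV) \<Longrightarrow> v \<in> lists (S \<times> UNIV) \<Longrightarrow> r \<in> R \<Longrightarrow> r \<in> lists (S \<times> UNIV) \<Longrightarrow>
     pres_rel S R (u @ r @ v) (u @ v)"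

definition pres_equiv :: "'g set \<Rightarrow> ('g \<times> bool) list set \<Rightarrow> (('g \<times> bool) list \<times> ('g \<times> bool) list) set" where
  "pres_equiv S R = {(u, v). pres_rel S R u v}"

definition pres_group :: "'g set \<Rightarrow> ('g \<times> bool) list set \<Rightarrow> ('g \<times> bool) list set monoid" where
  "pres_group S R = \<lparr> carrier = lists (S \<times> UNIV) // pres_equiv S R,
     monoid.mult = (\<lambda>A B. pres_equiv S R `` {(SOME a. a \<in> A) @ (SOME b. b \<in> B)}),
     one = pres_equiv S R `` {[]} \<rparr>"

definition comm_word :: "'g \<Rightarrow> 'g \<Rightarrow> ('g \<times> bool) list" where
  "comm_word a b = [(a, False), (b, False), (a, True), (b, True)]"

text \<open>A finite simple graph: finite vertex set V of a linearly ordered type (the order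
  plays the role of the indexing x_1, ..., x_n) and a symmetric irreflexive adjacency E.\<close>

definition simple_graph :: "'v set \<Rightarrow> ('v \<Rightarrow> 'v \<Rightarrow> bool) \<Rightarrow> bool" where
  "simple_graph V E \<longleftrightarrow> finite V \<and> (\<forall>u v. E u v \<longleftrightarrow> E v u) \<and> (\<forall>v. \<not> E v v)"

datatype 'v gen = GX 'v | GY 'v 'v

definition gg_gens :: "'v::linorder set \<Rightarrow> ('v \<Rightarrow> 'v \<Rightarrow> bool) \<Rightarrow> 'v gen set" where
  "gg_gens V E = GX ` V \<union> {GY i j | i j. i \<in> V \<and> j \<in> V \<and> i < j \<and> \<not> E i j}"

definition gg_rels :: "'v::linorder set \<Rightarrow> ('v \<Rightarrow> 'v \<Rightarrow> bool) \<Rightarrow> ('v gen \<times> bool) list set" where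
  "gg_rels V E =
     {comm_word (GX j) (GX i) | i j. i \<in> V \<and> j \<in> V \<and> i < j \<and> E i j}
   \<union> {comm_word (GX j) (GX i) @ [(GY i j, False)] | i j. i \<in> V \<and> j \<in> V \<and> i < j \<and> \<not> E i j}
   \<union> {comm_word (GX l) (GY i j) | l i j. l \<in> V \<and> i \<in> V \<and> j \<in> V \<and> i < j \<and> \<not> E i j}"

definition graph_group :: "'v::linorder set \<Rightarrow> ('v \<Rightarrow> 'v \<Rightarrow> bool) \<Rightarrow> ('v gen \<times> bool) list set monoid" where
  "graph_group V E = pres_group (gg_gens V E) (gg_rels V E)"

definition twisted_rel :: "('a, 'b) monoid_scheme \<Rightarrow> ('a \<Rightarrow> 'a) \<Rightarrow> ('a \<times> 'a) set" where
  "twisted_rel G \<phi> = {(a, b). a \<in> carrier G \<and> b \<in> carrier G \<and>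
      (\<exists>c \<in> carrier G. a = c \<otimes>\<^bsub>G\<^esub> b \<otimes>\<^bsub>G\<^esub> inv\<^bsub>G\<^esub> (\<phi> c))}"

definition reidemeister :: "('a, 'b) monoid_scheme \<Rightarrow> ('a \<Rightarrow> 'a) \<Rightarrow> enat" where
  "reidemeister G \<phi> = (let C = carrier G // twisted_rel G \<phi> in
      if finite C then enat (card C) else \<infinity>)"

definition spec_R :: "('a, 'b) monoid_scheme \<Rightarrow> enat set" where
  "spec_R G = reidemeister G ` auto G"

text \<open>Product of a finite family of subsets of N u {oo} (products with oo are oo,
  all occurring numbers being positive).\<close>
definition set_prod :: "'i set \<Rightarrow> ('i \<Rightarrow> enat set) \<Rightarrow> enat set" where
  "set_prod I M = {\<Prod>i\<in>I. f i | f. \<forall>i\<in>I. f i \<in> M i}"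

definition set_times :: "enat set \<Rightarrow> enat set \<Rightarrow> enat set" where
  "set_times M M' = {m * m' | m m'. m \<in> M \<and> m' \<in> M'}"

definition Zpow :: "nat \<Rightarrow> (nat \<Rightarrow> int) monoid" where
  "Zpow m = \<lparr> carrier = {f. \<forall>i\<ge>m. f i = 0}, monoid.mult = (\<lambda>f g i. f i + g i), one = (\<lambda>_. 0) \<rparr>"

definition degree :: "'v set \<Rightarrow> ('v \<Rightarrow> 'v \<Rightarrow> bool) \<Rightarrow> 'v \<Rightarrow> nat" where
  "degree V E v = card {w \<in> V. E v w}"

definition graph_iso :: "('v \<Rightarrow> 'v \<Rightarrow> bool) \<Rightarrow> 'v set \<Rightarrow> 'v set \<Rightarrow> bool" where
  "graph_iso E A B \<longleftrightarrow> (\<exists>f. bij_betw f A B \<and> (\<forall>u\<in>A. \<forall>v\<in>A. E u v \<longleftrightarrow> E (f u) (f v)))"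

definition is_join_decomp :: "('v \<Rightarrow> 'v \<Rightarrow> bool) \<Rightarrow> 'v set \<Rightarrow> 'i set \<Rightarrow> ('i \<Rightarrow> 'v set) \<Rightarrow> bool" where
  "is_join_decomp E W I P \<longleftrightarrow> (\<Union>i\<in>I. P i) = W \<and>
     (\<forall>i\<in>I. \<forall>j\<in>I. i \<noteq> j \<longrightarrow> P i \<inter> P j = {}) \<and>
     (\<forall>i\<in>I. \<forall>j\<in>I. i \<noteq> j \<longrightarrow> (\<forall>u\<in>P i. \<forall>w\<in>P j. E u w))"

definition join_decomposable :: "('v \<Rightarrow> 'v \<Rightarrow> bool) \<Rightarrow> 'v set \<Rightarrow> bool" where
  "join_decomposable E W \<longleftrightarrow> (\<exists>A B. A \<noteq> {} \<and> B \<noteq> {} \<and> A \<inter> B = {} \<and> A \<union> B = W \<and>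
      (\<forall>a\<in>A. \<forall>b\<in>B. E a b))"

definition iso_types :: "('v \<Rightarrow> 'v \<Rightarrow> bool) \<Rightarrow> 'i set \<Rightarrow> ('i \<Rightarrow> 'v set) \<Rightarrow> 'i set set" where
  "iso_types E I P = I // {(i, j). i \<in> I \<and> j \<in> I \<and> graph_iso E (P i) (P j)}"

end

theory Submission
  imports Defs
begin

text \<open>
  The group of a graph is modelled by pairs of an integer vector on the vertices and one on the
  non-edges, multiplied by a bilinear cocycle. An automorphism induces matrices \<open>M\<close> on the
  abelianisation \<open>\<int>^V\<close> and \<open>N\<close> on the central subgroup, and the Reidemeister number is the product
  of those of \<open>M\<close> and \<open>N\<close>: a finite number of twisted classes in a free abelian group leaves no
  fixed points, so classes can be counted layer by layer.

  \<open>M\<close> sends commuting vectors to commuting vectors. Pick a permutation \<open>\<pi>\<close> of the vertices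
  along which \<open>M\<close> has no zero entry. Comparing centralisers gives \<open>deg v \<le> deg (\<pi> v)\<close>, hence
  equality, and equality forces every vertex in the support of \<open>M v\<close> to dominate \<open>\<pi> v\<close>. From this
  triangular shape \<open>\<pi>\<close> turns out to be a graph automorphism. It therefore permutes the join
  factors within their isomorphism types, and domination shows that \<open>M\<close> maps the span of each
  type to itself up to vertices of full degree. So \<open>M\<close> is block triangular, \<open>N\<close> is block
  diagonal, and the Reidemeister number is the product of those of the diagonal blocks, which are
  automorphisms of the factors in the statement.
\<close>

text \<open>The permutation \<open>\<pi>\<close> merely selects non-zero entries, one in each row
  and column, so nothing in its construction sees the edges, and the image of \<open>v\<close> may
  also involve vertices other than \<open>\<pi> v\<close> that dominate it. That
  \<open>\<pi>\<close> preserves edges is the obstacle, settled in \<open>pi_edge\<close> by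
  comparing ranks of the parts strictly above a class of mutually dominating vertices. Linear
  algebra stays over the integers: every conclusion concerns vanishing, so solving
  \<open>M x = t y\<close> for some \<open>t \<noteq> 0\<close> replaces inverting \<open>M\<close>,
  and its only source is that more unknowns than equations leave a non-zero solution. Types rather
  than single factors appear because \<open>\<pi>\<close> may exchange isomorphic factors. A vertex
  \<open>b\<close> of another type cannot occur in the image of \<open>v\<close>: domination and the
  join structure would make \<open>b\<close> adjacent to all other vertices, and such vertices have
  been removed. The entries of \<open>N\<close> are 2x2 minors of \<open>M\<close> in the rows of
  non-edges; full vertices lie on no non-edge, so the triangular part of \<open>M\<close> never
  enters \<open>N\<close>.\<close>

section \<open>Integer matrices\<close>

lemma int_kernel_nontrivial:
  fixes m :: "'b \<Rightarrow> 'a \<Rightarrow> int"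
  assumes "finite Y" "finite A" "card Y < card A"
  shows "\<exists>x. (\<exists>v\<in>A. x v \<noteq> 0) \<and> (\<forall>b\<in>Y. (\<Sum>v\<in>A. m b v * x v) = 0)"
  using assms
proof (induction Y arbitrary: A m rule: finite_induct)
  case empty
  then obtain v where "v \<in> A" by fastforce
  then show ?case by (intro exI[of _ "\<lambda>_. 1"]) auto
next
  case (insert b Y)
  show ?case
  proof (cases "\<forall>v\<in>A. m b v = 0")
    case True
    have "card Y < card A" using insert by simp
    from insert.IH[OF insert.prems(1) this] obtain x where
      "(\<exists>v\<in>A. x v \<noteq> 0)" "(\<forall>c\<in>Y. (\<Sum>v\<in>A. m c v * x v) = 0)" by blast
    then show ?thesis using True by (intro exI[of _ x]) auto
  next
    case False
    then obtain v where v: "v \<in> A" "m b v \<noteq> 0" by blast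
    \<comment> \<open>Fraction-free elimination of the unknown \<open>v\<close> with pivot row
      \<open>b\<close>: row \<open>c\<close> is scaled by the pivot \<open>m b v\<close> before the
      multiple \<open>m c v\<close> of row \<open>b\<close> is subtracted.\<close>
    define m' where "m' c u = m b v * m c u - m b u * m c v" for c u
    have "finite (A - {v})" "card Y < card (A - {v})" using insert v by auto
    from insert.IH[OF this, of m'] obtain x where
      x: "\<exists>u\<in>A - {v}. x u \<noteq> 0" "\<forall>c\<in>Y. (\<Sum>u\<in>A - {v}. m' c u * x u) = 0" by blast
    \<comment> \<open>Back substitution; scaling the other coordinates by the pivot keeps the value
      at \<open>v\<close> an integer.\<close>
    define x' where "x' u = (if u = v then - (\<Sum>u\<in>A - {v}. m b u * x u) else m b v * x u)" for u
    have sum: "(\<Sum>u\<in>A. m c u * x' u) = (\<Sum>u\<in>A - {v}. m' c u * x u)" for c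
    proof -
      have "(\<Sum>u\<in>A. m c u * x' u) = m c v * x' v + (\<Sum>u\<in>A - {v}. m c u * x' u)"
        using insert.prems(1) v(1) by (rule sum.remove)
      also have "(\<Sum>u\<in>A - {v}. m c u * x' u) = (\<Sum>u\<in>A - {v}. m b v * m c u * x u)"
        by (rule sum.cong) (auto simp: x'_def)
      also have "m c v * x' v + \<dots> = (\<Sum>u\<in>A - {v}. m' c u * x u)"
        by (simp add: x'_def m'_def algebra_simps sum_subtractf sum_distrib_left)
      finally show ?thesis .
    qed
    have "m' b u = 0" for u by (simp add: m'_def)
    then have "\<forall>c\<in>insert b Y. (\<Sum>u\<in>A. m c u * x' u) = 0" using x(2) by (simp add: sum)
    moreover have "\<exists>u\<in>A. x' u \<noteq> 0" using x(1) v(2) by (auto simp: x'_def)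
    ultimately show ?thesis by blast
  qed
qed

definition int_inj :: "'b set \<Rightarrow> 'a set \<Rightarrow> ('b \<Rightarrow> 'a \<Rightarrow> int) \<Rightarrow> bool" where
  "int_inj Y A m \<longleftrightarrow> (\<forall>x. (\<forall>b\<in>Y. (\<Sum>v\<in>A. m b v * x v) = 0) \<longrightarrow> (\<forall>v\<in>A. x v = 0))"

lemma int_injD: "int_inj Y A m \<Longrightarrow> (\<And>b. b \<in> Y \<Longrightarrow> (\<Sum>v\<in>A. m b v * x v) = 0) \<Longrightarrow> v \<in> A \<Longrightarrow> x v = 0"
  unfolding int_inj_def by blast

lemma int_inj_card_le:
  assumes "finite Y" "finite A" "int_inj Y A m"
  shows "card A \<le> card Y"
  using int_kernel_nontrivial[OF assms(1,2), of m] assms(3) unfolding int_inj_def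
  by (meson leI)

text \<open>A substitute for Cramer's rule: after appending \<open>- y\<close> as a further column
  there are more columns than rows, hence a kernel vector. Its coordinate at the new column is
  \<open>t\<close>, and \<open>t = 0\<close> would contradict injectivity.\<close>

lemma int_inj_solvable:
  fixes m :: "'b \<Rightarrow> 'a \<Rightarrow> int"
  assumes fin: "finite Y" "finite A" and inj: "int_inj Y A m" and card: "card A = card Y"
  obtains t x where "t \<noteq> 0" "\<And>b. b \<in> Y \<Longrightarrow> (\<Sum>v\<in>A. m b v * x v) = t * y b"
proof -
  \<comment> \<open>The index \<open>None\<close> stands for the appended column.\<close>
  define m' where "m' b o' = (case o' of None \<Rightarrow> - y b | Some v \<Rightarrow> m b v)" for b o'
  have sum: "(\<Sum>v\<in>insert None (Some ` A). m' b v * x v) = - y b * x None + (\<Sum>v\<in>A. m b v * x (Some v))" for b x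
    using fin by (simp add: sum.reindex m'_def)
  have "card Y < card (insert None (Some ` A))" using fin card by (simp add: card_image)
  from int_kernel_nontrivial[OF fin(1) _ this, of m'] fin obtain x where
    x: "\<exists>v\<in>insert None (Some ` A). x v \<noteq> 0"
    "\<forall>b\<in>Y. (\<Sum>v\<in>insert None (Some ` A). m' b v * x v) = 0" by blast
  have eq: "b \<in> Y \<Longrightarrow> (\<Sum>v\<in>A. m b v * x (Some v)) = x None * y b" for b
    using x(2) by (auto simp: sum)
  have "x None \<noteq> 0"
  proof
    assume 0: "x None = 0"
    then have "v \<in> A \<Longrightarrow> x (Some v) = 0" for v
      using int_injD[OF inj, of "\<lambda>v. x (Some v)"] eq by simp
    then show False using x(1) 0 by auto
  qed
  from that[OF this, of "\<lambda>v. x (Some v)"] eq show thesis by simp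
qed

text \<open>This is the non-zero term in the Leibniz expansion of a non-zero determinant, obtained
  without determinants by expanding along one column at a time.\<close>

lemma int_inj_transversal:
  fixes m :: "'b \<Rightarrow> 'a \<Rightarrow> int"
  assumes "finite A" "finite Y" "card A = card Y" "int_inj Y A m"
  shows "\<exists>\<pi>. bij_betw \<pi> A Y \<and> (\<forall>v\<in>A. m (\<pi> v) v \<noteq> 0)"
  using assms
proof (induction A arbitrary: Y rule: finite_induct)
  case empty
  then show ?case by (auto simp: bij_betw_def)
next
  case (insert v A)
  have "card A < card Y" using insert by simp
  \<comment> \<open>\<open>z\<close> behaves like the vector of cofactors of column
    \<open>v\<close>: it is a relation among the rows once that column is removed.\<close>
  have "\<exists>z. (\<exists>b\<in>Y. z b \<noteq> 0) \<and> (\<forall>u\<in>A. (\<Sum>b\<in>Y. m b u * z b) = 0)"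
    by (rule int_kernel_nontrivial[OF insert.hyps(1) insert.prems(1)]) fact
  then obtain z where z: "\<exists>b\<in>Y. z b \<noteq> 0" "\<forall>u\<in>A. (\<Sum>b\<in>Y. m b u * z b) = 0" by blast
  have pair: "(\<Sum>b\<in>Y. z b * (\<Sum>u\<in>insert v A. m b u * x u)) = x v * (\<Sum>b\<in>Y. m b v * z b)" for x
  proof -
    have "(\<Sum>b\<in>Y. z b * (\<Sum>u\<in>insert v A. m b u * x u)) = (\<Sum>u\<in>insert v A. x u * (\<Sum>b\<in>Y. m b u * z b))"
      unfolding sum_distrib_left by (subst sum.swap) (simp add: ac_simps)
    then show ?thesis using z(2) insert.hyps by simp
  qed
  \<comment> \<open>If \<open>z\<close> were orthogonal to column \<open>v\<close> as well, it would
    be orthogonal to all images, among them the multiple \<open>t * z\<close> of itself, and its sum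
    of squares would vanish.\<close>
  have nz: "(\<Sum>b\<in>Y. m b v * z b) \<noteq> 0"
  proof
    assume 0: "(\<Sum>b\<in>Y. m b v * z b) = 0"
    obtain t x where t: "t \<noteq> 0" "\<And>b. b \<in> Y \<Longrightarrow> (\<Sum>u\<in>insert v A. m b u * x u) = t * z b"
      using int_inj_solvable[OF insert.prems(1) _ insert.prems(3,2)] insert.hyps(1)
      by (metis finite_insert)
    have "(\<Sum>b\<in>Y. z b * (t * z b)) = 0" using pair[of x] t(2) 0 by simp
    then have "t * (\<Sum>b\<in>Y. z b * z b) = 0" by (simp add: sum_distrib_left ac_simps)
    then have "(\<Sum>b\<in>Y. z b * z b) = 0" using t by simp
    then have "\<forall>b\<in>Y. z b * z b = 0" using insert.prems(1) by (subst (asm) sum_nonneg_eq_0_iff) auto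
    then show False using z(1) by auto
  qed
  \<comment> \<open>\<open>z b \<noteq> 0\<close> matters besides \<open>m b v \<noteq> 0\<close>:
    the relation \<open>z\<close> then expresses row \<open>b\<close> rationally through the other
    rows on the columns \<open>A\<close>, so deleting it keeps injectivity.\<close>
  then obtain b where b: "b \<in> Y" "m b v \<noteq> 0" "z b \<noteq> 0"
    by (metis (no_types, lifting) mult_zero_left mult_zero_right sum.neutral)
  have "int_inj (Y - {b}) A m"
    unfolding int_inj_def
  proof (intro allI impI ballI)
    fix x u assume x: "\<forall>b\<in>Y - {b}. (\<Sum>v\<in>A. m b v * x v) = 0" and u: "u \<in> A"
    define x' where "x' = x(v := 0)"
    have x': "(\<Sum>u\<in>insert v A. m c u * x' u) = (\<Sum>u\<in>A. m c u * x u)" for c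
    proof -
      have "(\<Sum>u\<in>insert v A. m c u * x' u) = (\<Sum>u\<in>A. m c u * x' u)"
        using insert.hyps by (simp add: x'_def)
      also have "\<dots> = (\<Sum>u\<in>A. m c u * x u)"
        using insert.hyps by (intro sum.cong) (auto simp: x'_def)
      finally show ?thesis .
    qed
    have "(\<Sum>c\<in>Y. z c * (\<Sum>u\<in>insert v A. m c u * x' u)) = 0"
      unfolding pair by (simp add: x'_def)
    moreover have "(\<Sum>c\<in>Y. z c * (\<Sum>u\<in>insert v A. m c u * x' u)) = z b * (\<Sum>u\<in>A. m b u * x u)"
      unfolding x' using insert.prems(1) b(1) x by (subst sum.remove[of _ b]) auto
    ultimately have "(\<Sum>u\<in>A. m b u * x u) = 0" using b by simp
    then have "\<And>c. c \<in> Y \<Longrightarrow> (\<Sum>u\<in>insert v A. m c u * x' u) = 0" using x x' by (metis Diff_iff singletonD)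
    from int_injD[OF insert.prems(3) this] have "x' u = 0" using u by simp
    moreover have "u \<noteq> v" using u insert.hyps by blast
    ultimately show "x u = 0" by (simp add: x'_def)
  qed
  moreover have "card A = card (Y - {b})" using insert b by simp
  ultimately obtain \<pi> where pi: "bij_betw \<pi> A (Y - {b})" "\<forall>v\<in>A. m (\<pi> v) v \<noteq> 0"
    using insert.IH[of "Y - {b}"] insert.prems(1) by blast
  have "bij_betw (\<pi>(v := b)) (insert v A) Y"
  proof -
    have "bij_betw (\<pi>(v := b)) A (Y - {b})"
      using pi(1) insert.hyps by (subst bij_betw_cong[of _ _ \<pi>]) auto
    from notIn_Un_bij_betw[OF insert.hyps(2) _ this] b show ?thesis by (simp add: insert_absorb)
  qed
  moreover have "\<forall>u\<in>insert v A. m ((\<pi>(v := b)) u) u \<noteq> 0" using pi b insert.hyps by auto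
  ultimately show ?case by blast
qed

section \<open>Matrices preserving the commutation of vertices\<close>

text \<open>The entry \<open>m b v\<close> is the \<open>b\<close>-coordinate of the image of the vertex \<open>v\<close>; \<open>comm\<close> says that
  images of adjacent vertices commute, i.e. that the minors at non-adjacent rows vanish.\<close>

locale graph_matrix =
  fixes V :: "'v set" and E :: "'v \<Rightarrow> 'v \<Rightarrow> bool" and m :: "'v \<Rightarrow> 'v \<Rightarrow> int" and \<pi> :: "'v \<Rightarrow> 'v"
  assumes fin: "finite V"
    and sym: "E u v \<longleftrightarrow> E v u"
    and irr: "\<not> E v v"
    and inj: "int_inj V V m"
    and comm: "u \<in> V \<Longrightarrow> v \<in> V \<Longrightarrow> E u v \<Longrightarrow> i \<in> V \<Longrightarrow> j \<in> V \<Longrightarrow> \<not> E i j \<Longrightarrow>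
                 m i u * m j v = m j u * m i v"
    and pi: "bij_betw \<pi> V V"
    and nz: "v \<in> V \<Longrightarrow> m (\<pi> v) v \<noteq> 0"
begin

section \<open>Centralisers and the domination preorder\<close>

definition link :: "'v \<Rightarrow> 'v set" where "link v = {u \<in> V. E v u}"
definition star :: "'v \<Rightarrow> 'v set" where "star v = {u \<in> V. u = v \<or> E v u}"

lemma pi_in: "v \<in> V \<Longrightarrow> \<pi> v \<in> V" using pi by (auto simp: bij_betw_def)

lemma fin_star: "finite (star v)" using fin by (simp add: star_def)

text \<open>A combination of vertices of \<open>star v\<close> commutes with \<open>v\<close>, so
  the images commute, and the minor they form in two non-adjacent rows vanishes.\<close>

lemma image_commutes:
  assumes v: "v \<in> V" and c: "a \<in> V" "c \<in> V" "\<not> E a c"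
  shows "m a v * (\<Sum>u\<in>star v. m c u * y u) = m c v * (\<Sum>u\<in>star v. m a u * y u)"
proof -
  have "m a v * m c u = m c v * m a u" if "u \<in> star v" for u
    using that comm[of v u a c] v c by (auto simp: star_def)
  then show ?thesis unfolding sum_distrib_left
    by (intro sum.cong) (auto simp flip: mult.assoc)
qed

text \<open>The entry of column \<open>v\<close> in row \<open>\<pi> v\<close> is non-zero, so the
  vanishing minors make every row outside \<open>star (\<pi> v)\<close> proportional to row
  \<open>\<pi> v\<close> on the columns \<open>star v\<close>.\<close>

lemma image_vanishes:
  assumes v: "v \<in> V" and c: "c \<in> V" "c \<notin> star (\<pi> v)"
    and 0: "(\<Sum>u\<in>star v. m (\<pi> v) u * y u) = 0"
  shows "(\<Sum>u\<in>star v. m c u * y u) = 0"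
proof -
  have "\<not> E (\<pi> v) c" using c by (auto simp: star_def)
  from image_commutes[OF v pi_in[OF v] c(1) this, of y] 0 nz[OF v] show ?thesis by simp
qed

lemma sum_star: "(\<Sum>u\<in>V. m c u * (if u \<in> S then y u else 0)) = (\<Sum>u\<in>S. m c u * y u)" if "S \<subseteq> V"
  using that fin by (intro sum.mono_neutral_cong_right) auto

text \<open>Rows outside \<open>star (\<pi> v)\<close> are controlled by row \<open>\<pi> v\<close>,
  so the rows in \<open>star (\<pi> v)\<close> already detect every vector supported on
  \<open>star v\<close>.\<close>

lemma inj_star:
  assumes v: "v \<in> V" shows "int_inj (star (\<pi> v)) (star v) m"
  unfolding int_inj_def
proof (intro allI impI ballI)
  fix x u assume x: "\<forall>b\<in>star (\<pi> v). (\<Sum>v\<in>star v. m b v * x v) = 0" and u: "u \<in> star v"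
  have "\<pi> v \<in> star (\<pi> v)" using pi_in[OF v] by (simp add: star_def)
  then have "(\<Sum>u\<in>star v. m c u * x u) = 0" if "c \<in> V" for c
    using image_vanishes[OF v that, of x] x by blast
  moreover have "star v \<subseteq> V" by (auto simp: star_def)
  ultimately have "(\<Sum>u\<in>V. m c u * (if u \<in> star v then x u else 0)) = 0" if "c \<in> V" for c
    using that by (simp add: sum_star)
  from int_injD[OF inj this, of u] u show "x u = 0" by (auto simp: star_def)
qed

text \<open>Injectivity gives one inequality per vertex. Since \<open>\<pi>\<close> permutes
  \<open>V\<close>, both sides have the same sum, and no inequality can be strict.\<close>

lemma card_star: assumes v: "v \<in> V" shows "card (star (\<pi> v)) = card (star v)"
proof -
  have le: "card (star v) \<le> card (star (\<pi> v))" if "v \<in> V" for v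
    using int_inj_card_le[OF fin_star fin_star inj_star[OF that]] .
  have "(\<Sum>v\<in>V. card (star v)) = (\<Sum>v\<in>V. card (star (\<pi> v)))"
    using sum.reindex_bij_betw[OF pi, of "\<lambda>v. card (star v)"] by simp
  from sum_mono_inv[OF this le v fin] show ?thesis by simp
qed

text \<open>The block with rows \<open>star (\<pi> v)\<close> and columns \<open>star v\<close> is
  now square, so some non-zero multiple of the unit vector at \<open>d\<close> is the image of a
  vector supported on \<open>star v\<close>. That vector commutes with \<open>v\<close>, hence
  \<open>d\<close> is equal or adjacent to each vertex \<open>b\<close> in the support of the image
  of \<open>v\<close>.\<close>

lemma dominates:
  assumes v: "v \<in> V" and b: "b \<in> V" "m b v \<noteq> 0"
  shows "link (\<pi> v) \<subseteq> star b"
proof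
  fix d assume d: "d \<in> link (\<pi> v)"
  let ?a = "\<pi> v"
  have dV: "d \<in> V" "E ?a d" "d \<noteq> ?a" using d irr by (auto simp: link_def)
  obtain t x where t: "t \<noteq> 0"
    and x: "\<And>c. c \<in> star ?a \<Longrightarrow> (\<Sum>u\<in>star v. m c u * x u) = t * (if c = d then 1 else 0)"
    using int_inj_solvable[OF fin_star fin_star inj_star[OF v] card_star[OF v, symmetric],
        of "\<lambda>c. if c = d then 1 else 0"] by blast
  have a: "(\<Sum>u\<in>star v. m ?a u * x u) = 0" using x[of ?a] dV pi_in[OF v] by (simp add: star_def)
  \<comment> \<open>Row \<open>\<pi> v\<close> of the image is zero because
    \<open>d \<noteq> \<pi> v\<close>, so \<open>image_vanishes\<close> clears the rows outside the
    star and the image is \<open>t\<close> times a unit vector on all of \<open>V\<close>.\<close>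
  have z: "(\<Sum>u\<in>star v. m c u * x u) = t * (if c = d then 1 else 0)" if "c \<in> V" for c
  proof (cases "c \<in> star ?a")
    case False
    then have "c \<noteq> d" using dV by (auto simp: star_def)
    then show ?thesis using image_vanishes[OF v that False a] by simp
  qed (use x in auto)
  show "d \<in> star b"
  proof (rule ccontr)
    assume "d \<notin> star b"
    then have n: "\<not> E b d" "b \<noteq> d" using dV by (auto simp: star_def)
    have "m b v * t = 0"
      using image_commutes[OF v b(1) dV(1) n(1), of x] n(2) unfolding z[OF dV(1)] z[OF b(1)] by simp
    then show False using b(2) t by simp
  qed
qed

text \<open>The relation \<open>link u \<subseteq> star v\<close> is the vicinal preorder. Composing
  the inclusions fails only at \<open>v\<close> itself, which may lie in \<open>link u\<close>
  without lying in \<open>link v\<close>.\<close>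

lemma dominates_trans:
  assumes "u \<in> V" "v \<in> V" "w \<in> V" "link u \<subseteq> star v" "link v \<subseteq> star w"
  shows "link u \<subseteq> star w"
proof
  fix x assume x: "x \<in> link u"
  show "x \<in> star w"
  proof (cases "x = v")
    case False
    then show ?thesis using x assms unfolding link_def star_def by blast
  next
    case True
    then have "E u v" using x by (simp add: link_def)
    then have "u \<in> star w" using assms sym unfolding link_def by blast
    then have "u = w \<or> w \<in> star v" using assms sym unfolding link_def star_def by blast
    then show ?thesis using True \<open>E u v\<close> assms sym unfolding star_def by blast
  qed
qed

text \<open>If the edge \<open>u v\<close> went to a non-edge, \<open>\<pi> u\<close> and
  \<open>\<pi> v\<close> would dominate each other. A combination of \<open>u\<close> and
  \<open>v\<close> would then have its image supported strictly above their class. By injectivity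
  and a count of ranks, every vector with such an image is supported on vertices that
  \<open>\<pi>\<close> sends strictly above the class, and \<open>u\<close> is not among
  them.\<close>

lemma pi_edge:
  assumes uv: "u \<in> V" "v \<in> V" "E u v"
  shows "E (\<pi> u) (\<pi> v)"
proof (rule ccontr)
  assume ne: "\<not> E (\<pi> u) (\<pi> v)"
  define a b where "a = \<pi> v" and "b = \<pi> u"
  have ab: "a \<in> V" "b \<in> V" "\<not> E a b" "\<not> E b a" using ne sym uv pi_in by (auto simp: a_def b_def)
  have "u \<noteq> v" using uv irr by auto
  then have "a \<noteq> b" using pi uv by (auto simp: a_def b_def bij_betw_def inj_on_def)
  \<comment> \<open>The minor of columns \<open>u\<close>, \<open>v\<close> in the non-adjacent rows
    \<open>a\<close>, \<open>b\<close> vanishes. One of its two products is non-zero by the choice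
    of \<open>\<pi>\<close>, hence so is the other.\<close>
  have "m a u * m b v = m b u * m a v" using comm[OF uv ab(1,2,3)] .
  moreover have "m b u \<noteq> 0" "m a v \<noteq> 0" using nz uv by (auto simp: a_def b_def)
  ultimately have nz': "m b v \<noteq> 0" "m a u \<noteq> 0" by auto
  have dab: "link a \<subseteq> star b" "link b \<subseteq> star a"
    using dominates[OF uv(2) ab(2)] dominates[OF uv(1) ab(1)] nz' by (auto simp: a_def b_def)
  \<comment> \<open>\<open>A\<close> is the class of \<open>a\<close> in the preorder, and it
    contains \<open>b\<close>; \<open>U\<close> consists of the vertices strictly above this
    class.\<close>
  define A where "A = {w \<in> V. link a \<subseteq> star w \<and> link w \<subseteq> star a}"
  define U where "U = {w \<in> V. link a \<subseteq> star w \<and> \<not> link w \<subseteq> star a}"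
  \<comment> \<open>Domination would carry an edge from \<open>w\<close> to \<open>a\<close> over to
    \<open>b\<close>, and from there to an edge between \<open>a\<close> and
    \<open>b\<close>.\<close>
  have Aa: "\<not> E w a" if w: "w \<in> A" for w
  proof
    assume E: "E w a"
    then have "w \<in> link a" using w sym by (auto simp: A_def link_def)
    then have "w \<in> star b" using dab by blast
    then have "b \<in> link w" using E ab sym by (auto simp: star_def link_def)
    then have "b \<in> star a" using w by (auto simp: A_def)
    then show False using ab \<open>a \<noteq> b\<close> by (auto simp: star_def)
  qed
  \<comment> \<open>The combination of columns \<open>u\<close> and \<open>v\<close> that vanishes
    in row \<open>a\<close>. Its image in row \<open>c\<close> is the minor in rows
    \<open>c\<close>, \<open>a\<close>, which is zero for \<open>c\<close> in \<open>A\<close>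
    because such \<open>c\<close> is not adjacent to \<open>a\<close>; in rows not above
    \<open>a\<close> both columns vanish by domination.\<close>
  define x where "x w = (if w = u then m a v else if w = v then - m a u else 0)" for w
  have Mx: "(\<Sum>w\<in>V. m c w * x w) = m c u * m a v - m c v * m a u" for c
  proof -
    have "(\<Sum>w\<in>V. m c w * x w) = (\<Sum>w\<in>{u, v}. m c w * x w)"
      using uv fin by (intro sum.mono_neutral_right) (auto simp: x_def)
    then show ?thesis using \<open>u \<noteq> v\<close> by (simp add: x_def)
  qed
  have supp: "(\<Sum>w\<in>V. m c w * x w) = 0" if c: "c \<in> V" "c \<notin> U" for c
  proof (rule ccontr)
    assume n: "(\<Sum>w\<in>V. m c w * x w) \<noteq> 0"
    then have "m c u \<noteq> 0 \<or> m c v \<noteq> 0" by (auto simp: Mx)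
    then have "link b \<subseteq> star c \<or> link a \<subseteq> star c"
      using dominates[OF uv(1) c(1)] dominates[OF uv(2) c(1)] by (auto simp: a_def b_def)
    then have "link a \<subseteq> star c" using dominates_trans[OF ab(1,2) c(1) dab(1)] by blast
    then have "c \<in> A" using c by (auto simp: A_def U_def)
    then have "\<not> E c a" by (rule Aa)
    from comm[OF uv c(1) ab(1) this] n show False by (simp add: Mx)
  qed
  \<comment> \<open>Columns in \<open>Y\<close> have no entries outside \<open>U\<close>, since
    supports only go up from \<open>\<pi> w\<close>. As \<open>Y\<close> and \<open>U\<close> have
    the same size, a non-zero multiple of any vector supported on \<open>U\<close> is the image of
    one supported on \<open>Y\<close>.\<close>
  define Y where "Y = {w \<in> V. \<pi> w \<in> U}"
  have YV: "Y \<subseteq> V" and UV: "U \<subseteq> V" by (auto simp: Y_def U_def)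
  have finYU: "finite Y" "finite U" using YV UV fin by (auto intro: finite_subset)
  have "\<pi> ` Y = U"
  proof
    show "U \<subseteq> \<pi> ` Y"
    proof
      fix c assume c: "c \<in> U"
      then have "c \<in> \<pi> ` V" using pi UV by (auto simp: bij_betw_def)
      then show "c \<in> \<pi> ` Y" using c by (auto simp: Y_def)
    qed
  qed (auto simp: Y_def)
  then have card: "card Y = card U"
    using pi YV by (metis bij_betw_def card_image inj_on_subset)
  have supY: "(\<Sum>w\<in>Y. m c w * y w) = 0" if c: "c \<in> V" "c \<notin> U" for c and y :: "'v \<Rightarrow> int"
  proof (rule sum.neutral, rule ballI)
    fix w assume w: "w \<in> Y"
    have "m c w = 0"
    proof (rule ccontr)
      assume n: "m c w \<noteq> 0"
      have wV: "w \<in> V" "\<pi> w \<in> V" and wU: "link a \<subseteq> star (\<pi> w)" "\<not> link (\<pi> w) \<subseteq> star a"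
        using w by (auto simp: Y_def U_def)
      from dominates[OF wV(1) c(1) n] have d: "link (\<pi> w) \<subseteq> star c" .
      have "link a \<subseteq> star c" using dominates_trans[OF ab(1) wV(2) c(1) wU(1) d] .
      moreover have "\<not> link c \<subseteq> star a" using dominates_trans[OF wV(2) c(1) ab(1) d] wU(2) by blast
      ultimately show False using c by (simp add: U_def)
    qed
    then show "m c w * y w = 0" by simp
  qed
  have injY: "int_inj U Y m"
    unfolding int_inj_def
  proof (intro allI impI ballI)
    fix y w assume y: "\<forall>b\<in>U. (\<Sum>v\<in>Y. m b v * y v) = 0" and w: "w \<in> Y"
    have "(\<Sum>u\<in>V. m c u * (if u \<in> Y then y u else 0)) = 0" if "c \<in> V" for c
      using sum_star[OF YV] supY[OF that] y by (cases "c \<in> U") auto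
    from int_injD[OF inj this, of w] w YV show "y w = 0" by auto
  qed
  obtain t y where t: "t \<noteq> 0" and y: "\<And>c. c \<in> U \<Longrightarrow> (\<Sum>w\<in>Y. m c w * y w) = t * (\<Sum>w\<in>V. m c w * x w)"
    using int_inj_solvable[OF finYU(2,1) injY card, of "\<lambda>c. \<Sum>w\<in>V. m c w * x w"] by blast
  have "(\<Sum>w\<in>V. m c w * ((if w \<in> Y then y w else 0) - t * x w)) = 0" if c: "c \<in> V" for c
  proof -
    have "(\<Sum>w\<in>V. m c w * ((if w \<in> Y then y w else 0) - t * x w)) =
       (\<Sum>w\<in>Y. m c w * y w) - t * (\<Sum>w\<in>V. m c w * x w)"
      using sum_star[OF YV, of c y, symmetric] by (simp add: right_diff_distrib sum_subtractf sum_distrib_left ac_simps)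
    also have "\<dots> = 0" using y[of c] supp[OF c] supY[OF c, of y] by (cases "c \<in> U") auto
    finally show ?thesis .
  qed
  \<comment> \<open>Injectivity identifies \<open>t * x\<close> with the vector supported on
    \<open>Y\<close>; but \<open>x\<close> is non-zero at \<open>u\<close>, while
    \<open>\<pi> u = b\<close> lies in the class of \<open>a\<close> and not in
    \<open>U\<close>.\<close>
  from int_injD[OF inj this uv(1)] have "(if u \<in> Y then y u else 0) = t * m a v"
    by (simp add: x_def)
  moreover have "u \<notin> Y" using dab by (auto simp: Y_def U_def b_def)
  ultimately show False using t \<open>m a v \<noteq> 0\<close> by simp
qed

text \<open>\<open>\<pi>\<close> maps \<open>star u\<close> into \<open>star (\<pi> u)\<close>, and
  by \<open>card_star\<close> these have equal size, so no further edges appear at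
  \<open>\<pi> u\<close>.\<close>

lemma pi_edge_iff:
  assumes uv: "u \<in> V" "v \<in> V"
  shows "E (\<pi> u) (\<pi> v) \<longleftrightarrow> E u v"
proof
  assume E: "E (\<pi> u) (\<pi> v)"
  have inj: "inj_on \<pi> V" using pi by (simp add: bij_betw_def)
  have sub: "\<pi> ` star u \<subseteq> star (\<pi> u)" using pi_edge uv pi_in by (auto simp: star_def)
  moreover have "card (\<pi> ` star u) = card (star (\<pi> u))"
    using inj card_star[OF uv(1)] by (metis (no_types, lifting) card_image inj_on_subset mem_Collect_eq star_def subsetI)
  ultimately have "\<pi> ` star u = star (\<pi> u)" using card_subset_eq[OF fin_star] by blast
  then have "\<pi> v \<in> \<pi> ` star u" using E pi_in uv by (auto simp: star_def)
  then have "v \<in> star u" using inj uv by (auto simp: star_def inj_on_def)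
  moreover have "u \<noteq> v" using E irr by auto
  ultimately show "E u v" by (simp add: star_def)
qed (rule pi_edge[OF uv])

end

section \<open>Reidemeister numbers of extensions and products\<close>

definition ecard :: "'a set \<Rightarrow> enat" where
  "ecard S = (if finite S then enat (card S) else \<infinity>)"

lemma ecard_bij: "bij_betw f A B \<Longrightarrow> ecard A = ecard B"
  unfolding ecard_def using bij_betw_finite bij_betw_same_card by metis

lemma ecard_image_eq:
  assumes "\<And>x y. x \<in> A \<Longrightarrow> y \<in> A \<Longrightarrow> p x = p y \<longleftrightarrow> g x = g y"
  shows "ecard (p ` A) = ecard (g ` A)"
proof (rule ecard_bij)
  let ?h = "\<lambda>z. g (inv_into A p z)"
  have h: "?h (p x) = g x" if "x \<in> A" for x
    using assms[of "inv_into A p (p x)" x] that by (simp add: f_inv_into_f inv_into_into)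
  show "bij_betw ?h (p ` A) (g ` A)"
    unfolding bij_betw_def inj_on_def using h assms by (auto simp: image_image)
qed

lemma ecard_neq_0: "S \<noteq> {} \<Longrightarrow> ecard S \<noteq> 0"
  by (auto simp: ecard_def zero_enat_def)

lemma ecard_Times:
  assumes "A \<noteq> {}" "B \<noteq> {}"
  shows "ecard (A \<times> B) = ecard A * ecard B"
  using assms finite_cartesian_product_iff[of A B]
  by (auto simp: ecard_def card_cartesian_product imult_infinity imult_infinity_right zero_enat_def card_gt_0_iff)

lemma ecard_PiE:
  assumes "finite J" "\<And>t. t \<in> J \<Longrightarrow> F t \<noteq> {}"
  shows "ecard (PiE J F) = (\<Prod>t\<in>J. ecard (F t))"
  using assms
proof (induction J rule: finite_induct)
  case empty
  then show ?case by (simp add: ecard_def one_enat_def)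
next
  case (insert t J)
  have "bij_betw (\<lambda>(y, g). g(t := y)) (F t \<times> PiE J F) (PiE (insert t J) F)"
    using inj_combinator[OF insert.hyps(2)] by (simp add: bij_betw_def PiE_insert_eq)
  from ecard_bij[OF this] have "ecard (PiE (insert t J) F) = ecard (F t \<times> PiE J F)" by simp
  also have "\<dots> = ecard (F t) * ecard (PiE J F)"
    using insert.prems by (intro ecard_Times) (auto simp: PiE_eq_empty_iff)
  finally show ?case using insert by simp
qed

section \<open>Twisted conjugacy classes\<close>

definition tconj :: "('a, 'b) monoid_scheme \<Rightarrow> ('a \<Rightarrow> 'a) \<Rightarrow> 'a \<Rightarrow> 'a \<Rightarrow> bool" where
  "tconj G \<phi> x y \<longleftrightarrow> (\<exists>c\<in>carrier G. x = c \<otimes>\<^bsub>G\<^esub> y \<otimes>\<^bsub>G\<^esub> inv\<^bsub>G\<^esub> (\<phi> c))"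

definition tclass :: "('a, 'b) monoid_scheme \<Rightarrow> ('a \<Rightarrow> 'a) \<Rightarrow> 'a \<Rightarrow> 'a set" where
  "tclass G \<phi> x = twisted_rel G \<phi> `` {x}"

lemma reidemeister_tclass: "reidemeister G \<phi> = ecard (tclass G \<phi> ` carrier G)"
proof -
  have "carrier G // twisted_rel G \<phi> = tclass G \<phi> ` carrier G"
    by (auto simp: quotient_def tclass_def)
  then show ?thesis by (simp add: reidemeister_def ecard_def)
qed

lemma equiv_twisted_rel:
  assumes "group G" "\<phi> \<in> hom G G"
  shows "equiv (carrier G) (twisted_rel G \<phi>)"
proof -
  interpret group G by fact
  interpret group_hom G G \<phi> by unfold_locales fact
  show ?thesis
  proof (rule equivI)
    show "twisted_rel G \<phi> \<subseteq> carrier G \<times> carrier G" by (auto simp: twisted_rel_def)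
    show "refl_on (carrier G) (twisted_rel G \<phi>)"
      by (auto simp: refl_on_def twisted_rel_def intro!: bexI[of _ "\<one>\<^bsub>G\<^esub>"])
    show "sym (twisted_rel G \<phi>)"
    proof (rule symI)
      fix x y assume "(x, y) \<in> twisted_rel G \<phi>"
      then obtain c where c: "x \<in> carrier G" "y \<in> carrier G" "c \<in> carrier G"
        "x = c \<otimes>\<^bsub>G\<^esub> y \<otimes>\<^bsub>G\<^esub> inv\<^bsub>G\<^esub> (\<phi> c)" by (auto simp: twisted_rel_def)
      then have "y = inv\<^bsub>G\<^esub> c \<otimes>\<^bsub>G\<^esub> x \<otimes>\<^bsub>G\<^esub> inv\<^bsub>G\<^esub> (\<phi> (inv\<^bsub>G\<^esub> c))"
        by (simp add: m_assoc) (simp flip: m_assoc)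
      then show "(y, x) \<in> twisted_rel G \<phi>"
        using c inv_closed[OF c(3)] unfolding twisted_rel_def by blast
    qed
    show "trans (twisted_rel G \<phi>)"
    proof (rule transI)
      fix x y z assume "(x, y) \<in> twisted_rel G \<phi>" "(y, z) \<in> twisted_rel G \<phi>"
      then obtain c d where c: "x \<in> carrier G" "y \<in> carrier G" "z \<in> carrier G" "c \<in> carrier G" "d \<in> carrier G"
        "x = c \<otimes>\<^bsub>G\<^esub> y \<otimes>\<^bsub>G\<^esub> inv\<^bsub>G\<^esub> (\<phi> c)" "y = d \<otimes>\<^bsub>G\<^esub> z \<otimes>\<^bsub>G\<^esub> inv\<^bsub>G\<^esub> (\<phi> d)"
        by (auto simp: twisted_rel_def)
      then have "x = (c \<otimes>\<^bsub>G\<^esub> d) \<otimes>\<^bsub>G\<^esub> z \<otimes>\<^bsub>G\<^esub> inv\<^bsub>G\<^esub> (\<phi> (c \<otimes>\<^bsub>G\<^esub> d))"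
        by (simp add: m_assoc inv_mult_group)
      then show "(x, z) \<in> twisted_rel G \<phi>"
        using c(1,3) m_closed[OF c(4,5)] unfolding twisted_rel_def by blast
    qed
  qed
qed

lemma tclass_eq_iff:
  assumes "group G" "\<phi> \<in> hom G G" "x \<in> carrier G" "y \<in> carrier G"
  shows "tclass G \<phi> x = tclass G \<phi> y \<longleftrightarrow> tconj G \<phi> x y"
  using eq_equiv_class_iff[OF equiv_twisted_rel[OF assms(1,2)] assms(3,4)] assms(3,4)
  by (simp add: tclass_def tconj_def twisted_rel_def)

lemma reidemeister_eqI:
  assumes "group G" "\<phi> \<in> hom G G"
    and "\<And>x y. x \<in> carrier G \<Longrightarrow> y \<in> carrier G \<Longrightarrow> p x = p y \<longleftrightarrow> tconj G \<phi> x y"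
  shows "reidemeister G \<phi> = ecard (p ` carrier G)"
  unfolding reidemeister_tclass
  by (rule ecard_image_eq) (use assms tclass_eq_iff[OF assms(1,2)] in blast)

lemma reidemeister_neq_0: "group G \<Longrightarrow> reidemeister G \<phi> \<noteq> 0"
  unfolding reidemeister_tclass by (rule ecard_neq_0) (use group.is_monoid monoid.one_closed in blast)

lemma reidemeister_iso:
  assumes G: "group G" and H: "group H" and f: "f \<in> iso G H"
    and hom: "\<phi> \<in> hom G G" "\<psi> \<in> hom H H"
    and comm: "\<And>x. x \<in> carrier G \<Longrightarrow> f (\<phi> x) = \<psi> (f x)"
  shows "reidemeister G \<phi> = reidemeister H \<psi>"
proof -
  interpret f: group_hom G H f using G H f by (auto simp: group_hom_def group_hom_axioms_def iso_def)
  have bij: "bij_betw f (carrier G) (carrier H)" using f by (simp add: iso_def)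
  then have im: "f ` carrier G = carrier H" and inj: "inj_on f (carrier G)" by (auto simp: bij_betw_def)
  have phi: "\<And>c. c \<in> carrier G \<Longrightarrow> \<phi> c \<in> carrier G" using hom by (auto simp: hom_def)
  have fc: "f (c \<otimes>\<^bsub>G\<^esub> y \<otimes>\<^bsub>G\<^esub> inv\<^bsub>G\<^esub> (\<phi> c)) = f c \<otimes>\<^bsub>H\<^esub> f y \<otimes>\<^bsub>H\<^esub> inv\<^bsub>H\<^esub> (\<psi> (f c))"
    if "c \<in> carrier G" "y \<in> carrier G" for c y
    using that phi comm by simp
  have "reidemeister G \<phi> = ecard ((\<lambda>x. tclass H \<psi> (f x)) ` carrier G)"
  proof (rule reidemeister_eqI[OF G hom(1)])
    fix x y assume xy: "x \<in> carrier G" "y \<in> carrier G"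
    have "tconj H \<psi> (f x) (f y) \<longleftrightarrow> (\<exists>c\<in>carrier G. f x = f (c \<otimes>\<^bsub>G\<^esub> y \<otimes>\<^bsub>G\<^esub> inv\<^bsub>G\<^esub> (\<phi> c)))"
      unfolding tconj_def im[symmetric] using fc xy by simp
    also have "\<dots> \<longleftrightarrow> tconj G \<phi> x y"
      unfolding tconj_def
    proof (intro bex_cong[OF HOL.refl] inj_on_eq_iff[OF inj])
      fix c assume "c \<in> carrier G"
      then show "c \<otimes>\<^bsub>G\<^esub> y \<otimes>\<^bsub>G\<^esub> inv\<^bsub>G\<^esub> (\<phi> c) \<in> carrier G" using phi xy by simp
    qed (use xy in auto)
    finally show "tclass H \<psi> (f x) = tclass H \<psi> (f y) \<longleftrightarrow> tconj G \<phi> x y"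
      using tclass_eq_iff[OF H hom(2)] xy by simp
  qed
  also have "(\<lambda>x. tclass H \<psi> (f x)) ` carrier G = tclass H \<psi> ` carrier H"
    unfolding im[symmetric] by (simp add: image_image)
  finally show ?thesis by (simp add: reidemeister_tclass)
qed

lemma reidemeister_cong:
  assumes "group G" "\<phi> \<in> hom G G" "\<And>x. x \<in> carrier G \<Longrightarrow> \<phi> x = \<psi> x"
  shows "reidemeister G \<phi> = reidemeister G \<psi>"
proof -
  have "twisted_rel G \<phi> = twisted_rel G \<psi>" using assms(3) by (auto simp: twisted_rel_def)
  then show ?thesis by (simp add: reidemeister_def)
qed

text \<open>The coordinates \<open>r t\<close> only have to be jointly bijective, so the lemma
  covers both \<open>product_group\<close> and vectors cut into blocks. Bijectivity assembles
  conjugators found in each coordinate into a single one in \<open>G\<close>.\<close>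

lemma reidemeister_product:
  assumes fin: "finite J" and G: "group G" and H: "\<And>t. t \<in> J \<Longrightarrow> group (H t)"
    and phi: "\<phi> \<in> hom G G" and psi: "\<And>t. t \<in> J \<Longrightarrow> \<psi> t \<in> hom (H t) (H t)"
    and r: "\<And>t. t \<in> J \<Longrightarrow> r t \<in> hom G (H t)"
    and bij: "bij_betw (\<lambda>g. \<lambda>t\<in>J. r t g) (carrier G) (\<Pi>\<^sub>E t\<in>J. carrier (H t))"
    and comm: "\<And>t g. t \<in> J \<Longrightarrow> g \<in> carrier G \<Longrightarrow> r t (\<phi> g) = \<psi> t (r t g)"
  shows "reidemeister G \<phi> = (\<Prod>t\<in>J. reidemeister (H t) (\<psi> t))"
proof -
  let ?R = "\<lambda>g. \<lambda>t\<in>J. r t g"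
  let ?p = "\<lambda>f. \<lambda>t\<in>J. tclass (H t) (\<psi> t) (f t)"
  interpret G: group G by fact
  have phiG: "\<phi> g \<in> carrier G" if "g \<in> carrier G" for g using phi that by (auto simp: hom_def)
  have rG: "r t g \<in> carrier (H t)" if "t \<in> J" "g \<in> carrier G" for t g using r[OF that(1)] that by (auto simp: hom_def)
  have inj: "x = y" if "x \<in> carrier G" "y \<in> carrier G" "\<And>t. t \<in> J \<Longrightarrow> r t x = r t y" for x y
  proof -
    have "?R x = ?R y" using that by (auto simp: restrict_def)
    then show ?thesis using bij that by (auto simp: bij_betw_def inj_on_def)
  qed
  have r_op: "r t (c \<otimes>\<^bsub>G\<^esub> y \<otimes>\<^bsub>G\<^esub> inv\<^bsub>G\<^esub> (\<phi> c)) = r t c \<otimes>\<^bsub>H t\<^esub> r t y \<otimes>\<^bsub>H t\<^esub> inv\<^bsub>H t\<^esub> (\<psi> t (r t c))"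
    if "t \<in> J" "c \<in> carrier G" "y \<in> carrier G" for t c y
  proof -
    interpret group_hom G "H t" "r t" using G H r that by (auto simp: group_hom_def group_hom_axioms_def)
    show ?thesis using that phiG comm by simp
  qed
  have "reidemeister G \<phi> = ecard ((\<lambda>g. ?p (?R g)) ` carrier G)"
  proof (rule reidemeister_eqI[OF G phi])
    fix x y assume xy: "x \<in> carrier G" "y \<in> carrier G"
    have "?p (?R x) = ?p (?R y) \<longleftrightarrow> (\<forall>t\<in>J. tclass (H t) (\<psi> t) (r t x) = tclass (H t) (\<psi> t) (r t y))"
      by (auto simp: restrict_def fun_eq_iff)
    also have "\<dots> \<longleftrightarrow> (\<forall>t\<in>J. tconj (H t) (\<psi> t) (r t x) (r t y))"
      using tclass_eq_iff[OF H psi] rG xy by simp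
    also have "\<dots> \<longleftrightarrow> tconj G \<phi> x y"
    proof
      assume "\<forall>t\<in>J. tconj (H t) (\<psi> t) (r t x) (r t y)"
      then have "\<forall>t\<in>J. \<exists>c\<in>carrier (H t). r t x = c \<otimes>\<^bsub>H t\<^esub> r t y \<otimes>\<^bsub>H t\<^esub> inv\<^bsub>H t\<^esub> (\<psi> t c)"
        by (simp add: tconj_def)
      then obtain c where c: "\<And>t. t \<in> J \<Longrightarrow> c t \<in> carrier (H t) \<and> r t x = c t \<otimes>\<^bsub>H t\<^esub> r t y \<otimes>\<^bsub>H t\<^esub> inv\<^bsub>H t\<^esub> (\<psi> t (c t))"
        by metis
      have "restrict c J \<in> ?R ` carrier G" using bij c by (auto simp: bij_betw_def)
      then obtain d where d: "d \<in> carrier G" "restrict c J = ?R d" by auto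
      then have dc: "r t d = c t" if "t \<in> J" for t using that by (metis restrict_apply')
      have "x = d \<otimes>\<^bsub>G\<^esub> y \<otimes>\<^bsub>G\<^esub> inv\<^bsub>G\<^esub> (\<phi> d)"
        by (rule inj) (use xy d phiG r_op dc c in auto)
      then show "tconj G \<phi> x y" using d by (auto simp: tconj_def)
    next
      assume "tconj G \<phi> x y"
      then obtain c where "c \<in> carrier G" "x = c \<otimes>\<^bsub>G\<^esub> y \<otimes>\<^bsub>G\<^esub> inv\<^bsub>G\<^esub> (\<phi> c)" by (auto simp: tconj_def)
      then show "\<forall>t\<in>J. tconj (H t) (\<psi> t) (r t x) (r t y)"
        unfolding tconj_def using r_op rG xy by blast
    qed
    finally show "?p (?R x) = ?p (?R y) \<longleftrightarrow> tconj G \<phi> x y" .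
  qed
  also have "(\<lambda>g. ?p (?R g)) ` carrier G = ?p ` (\<Pi>\<^sub>E t\<in>J. carrier (H t))"
    using bij by (simp only: bij_betw_def image_image flip: image_image[of ?p ?R])
  also have "\<dots> = (\<Pi>\<^sub>E t\<in>J. tclass (H t) (\<psi> t) ` carrier (H t))"
  proof
    show "?p ` (\<Pi>\<^sub>E t\<in>J. carrier (H t)) \<subseteq> (\<Pi>\<^sub>E t\<in>J. tclass (H t) (\<psi> t) ` carrier (H t))" by auto
    show "(\<Pi>\<^sub>E t\<in>J. tclass (H t) (\<psi> t) ` carrier (H t)) \<subseteq> ?p ` (\<Pi>\<^sub>E t\<in>J. carrier (H t))"
    proof
      fix F assume F: "F \<in> (\<Pi>\<^sub>E t\<in>J. tclass (H t) (\<psi> t) ` carrier (H t))"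
      then have "\<forall>t\<in>J. \<exists>h\<in>carrier (H t). F t = tclass (H t) (\<psi> t) h" by (auto simp: PiE_def Pi_def)
      then obtain h where h: "\<And>t. t \<in> J \<Longrightarrow> h t \<in> carrier (H t) \<and> F t = tclass (H t) (\<psi> t) (h t)" by metis
      then have "F = ?p (restrict h J)" using F by (intro ext) (auto simp: PiE_def extensional_def)
      then show "F \<in> ?p ` (\<Pi>\<^sub>E t\<in>J. carrier (H t))" using h by (intro image_eqI) auto
    qed
  qed
  also have "ecard \<dots> = (\<Prod>t\<in>J. reidemeister (H t) (\<psi> t))"
  proof -
    have "carrier (H t) \<noteq> {}" if "t \<in> J" for t
      using group.is_monoid[OF H[OF that]] monoid.one_closed by blast
    then show ?thesis unfolding reidemeister_tclass by (intro ecard_PiE fin) auto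
  qed
  finally show ?thesis .
qed

text \<open>Projection maps the classes of \<open>G\<close> onto those of \<open>Q\<close>, which
  settles the infinite case. In the finite case a conjugator between two elements of the same fibre
  projects to a fixed point of \<open>\<theta>\<close>, hence comes from \<open>K\<close>; so each
  class of \<open>Q\<close> lifts to exactly as many classes of \<open>G\<close> as \<open>K\<close>
  has.\<close>

lemma reidemeister_central_extension:
  assumes K: "group K" and G: "group G" and Q: "comm_group Q"
    and i: "i \<in> hom K G" "inj_on i (carrier K)" and p: "p \<in> hom G Q" "p ` carrier G = carrier Q"
    and ker: "\<And>g. g \<in> carrier G \<Longrightarrow> p g = \<one>\<^bsub>Q\<^esub> \<longleftrightarrow> g \<in> i ` carrier K"
    and central: "\<And>k g. k \<in> carrier K \<Longrightarrow> g \<in> carrier G \<Longrightarrow> i k \<otimes>\<^bsub>G\<^esub> g = g \<otimes>\<^bsub>G\<^esub> i k"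
    and phi: "\<phi> \<in> hom G G" and chi: "\<chi> \<in> hom K K" and theta: "\<theta> \<in> hom Q Q"
    and comm_i: "\<And>k. k \<in> carrier K \<Longrightarrow> \<phi> (i k) = i (\<chi> k)"
    and comm_p: "\<And>g. g \<in> carrier G \<Longrightarrow> p (\<phi> g) = \<theta> (p g)"
    and fixed: "\<And>q. reidemeister Q \<theta> \<noteq> \<infinity> \<Longrightarrow> q \<in> carrier Q \<Longrightarrow> \<theta> q = q \<Longrightarrow> q = \<one>\<^bsub>Q\<^esub>"
  shows "reidemeister G \<phi> = reidemeister K \<chi> * reidemeister Q \<theta>"
proof -
  interpret K: group K by fact
  interpret G: group G by fact
  interpret Q: comm_group Q by fact
  interpret i: group_hom K G i using i by unfold_locales
  interpret p: group_hom G Q p using p by unfold_locales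
  interpret phi: group_hom G G \<phi> using phi by unfold_locales
  interpret chi: group_hom K K \<chi> using chi by unfold_locales
  interpret theta: group_hom Q Q \<theta> using theta by unfold_locales
  have pi: "p (i k) = \<one>\<^bsub>Q\<^esub>" if "k \<in> carrier K" for k using ker that by auto
  have class_p: "tconj Q \<theta> (p x) (p y)" if "x \<in> carrier G" "y \<in> carrier G" "tconj G \<phi> x y" for x y
    using that comm_p by (auto simp: tconj_def)
  show ?thesis
  proof (cases "reidemeister Q \<theta> = \<infinity>")
    case True
    have "reidemeister G \<phi> = \<infinity>"
    proof (rule ccontr)
      assume "reidemeister G \<phi> \<noteq> \<infinity>"
      then have fin: "finite (tclass G \<phi> ` carrier G)" by (auto simp: reidemeister_tclass ecard_def split: if_splits)
      let ?g = "\<lambda>z. tclass Q \<theta> (p (inv_into (carrier G) (tclass G \<phi>) z))"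
      have "tclass Q \<theta> (p x) = ?g (tclass G \<phi> x)" if x: "x \<in> carrier G" for x
      proof -
        let ?y = "inv_into (carrier G) (tclass G \<phi>) (tclass G \<phi> x)"
        have y: "?y \<in> carrier G" "tclass G \<phi> x = tclass G \<phi> ?y"
          using x by (auto intro: inv_into_into simp: f_inv_into_f)
        then have "tconj G \<phi> x ?y" using tclass_eq_iff[OF G phi x y(1)] by simp
        then show ?thesis using class_p[OF x y(1)] tclass_eq_iff[OF Q.is_group theta] x y(1) by simp
      qed
      then have "(\<lambda>x. tclass Q \<theta> (p x)) ` carrier G \<subseteq> ?g ` tclass G \<phi> ` carrier G" by auto
      then have "finite ((\<lambda>x. tclass Q \<theta> (p x)) ` carrier G)" using fin finite_subset by blast
      moreover have "(\<lambda>x. tclass Q \<theta> (p x)) ` carrier G = tclass Q \<theta> ` carrier Q"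
        using p(2) by (metis image_image)
      ultimately show False using True by (simp add: reidemeister_tclass ecard_def)
    qed
    \<comment> \<open>The other factor must be non-zero, since \<open>0 * \<infinity> = 0\<close> in
      \<open>enat\<close>.\<close>
    then show ?thesis using True reidemeister_neq_0[OF K, of \<chi>] by (simp add: imult_infinity_right zero_less_iff_neq_zero)
  next
    case False
    \<comment> \<open>The choice depends only on the class of \<open>q\<close>, so equal classes get
      the same representative and hence the same lift \<open>l q\<close>.\<close>
    define rp where "rp q = (SOME q'. q' \<in> carrier Q \<and> tclass Q \<theta> q' = tclass Q \<theta> q)" for q
    have rp: "rp q \<in> carrier Q" "tclass Q \<theta> (rp q) = tclass Q \<theta> q" if "q \<in> carrier Q" for q
      using someI[of "\<lambda>q'. q' \<in> carrier Q \<and> tclass Q \<theta> q' = tclass Q \<theta> q" q] that by (auto simp: rp_def)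
    have rp_eq: "rp q = rp q' \<longleftrightarrow> tclass Q \<theta> q = tclass Q \<theta> q'" if "q \<in> carrier Q" "q' \<in> carrier Q" for q q'
      
    proof
      show "tclass Q \<theta> q = tclass Q \<theta> q'" if "rp q = rp q'"
        using rp(2)[OF \<open>q \<in> carrier Q\<close>] rp(2)[OF \<open>q' \<in> carrier Q\<close>] that by simp
    qed (simp add: rp_def)
    define l where "l q = inv_into (carrier G) p (rp q)" for q
    have l: "l q \<in> carrier G" "p (l q) = rp q" if "q \<in> carrier Q" for q
      using rp[OF that] p(2) by (auto simp: l_def intro!: inv_into_into f_inv_into_f)
    \<comment> \<open>The pairs reach only the fibres over chosen representatives;
      \<open>surj\<close> shows that every twisted class of \<open>G\<close> meets one of these
      fibres.\<close>
    define f where "f = (\<lambda>(k, q). i k \<otimes>\<^bsub>G\<^esub> l q)"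
    have fG: "f z \<in> carrier G" if "z \<in> carrier K \<times> carrier Q" for z using that l by (auto simp: f_def)
    have key: "tclass G \<phi> (f (k, q)) = tclass G \<phi> (f (k', q')) \<longleftrightarrow>
        tclass K \<chi> k = tclass K \<chi> k' \<and> tclass Q \<theta> q = tclass Q \<theta> q'"
      if z: "k \<in> carrier K" "q \<in> carrier Q" "k' \<in> carrier K" "q' \<in> carrier Q" for k q k' q'
    proof -
      have conj_i: "i c \<otimes>\<^bsub>G\<^esub> (i k' \<otimes>\<^bsub>G\<^esub> l q') \<otimes>\<^bsub>G\<^esub> inv\<^bsub>G\<^esub> (\<phi> (i c)) = i (c \<otimes>\<^bsub>K\<^esub> k' \<otimes>\<^bsub>K\<^esub> inv\<^bsub>K\<^esub> (\<chi> c)) \<otimes>\<^bsub>G\<^esub> l q'"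
        if c: "c \<in> carrier K" for c
      proof -
        have "i c \<otimes>\<^bsub>G\<^esub> (i k' \<otimes>\<^bsub>G\<^esub> l q') \<otimes>\<^bsub>G\<^esub> inv\<^bsub>G\<^esub> (\<phi> (i c)) = i c \<otimes>\<^bsub>G\<^esub> i k' \<otimes>\<^bsub>G\<^esub> (l q' \<otimes>\<^bsub>G\<^esub> i (inv\<^bsub>K\<^esub> (\<chi> c)))"
          using c z l by (simp add: comm_i G.m_assoc)
        also have "l q' \<otimes>\<^bsub>G\<^esub> i (inv\<^bsub>K\<^esub> (\<chi> c)) = i (inv\<^bsub>K\<^esub> (\<chi> c)) \<otimes>\<^bsub>G\<^esub> l q'"
          using central[of "inv\<^bsub>K\<^esub> (\<chi> c)" "l q'"] c z l by simp
        finally show ?thesis using c z l by (simp add: G.m_assoc)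
      qed
      have "tconj G \<phi> (f (k, q)) (f (k', q')) \<longleftrightarrow> tconj K \<chi> k k' \<and> tconj Q \<theta> q q'"
      proof
        assume t: "tconj G \<phi> (f (k, q)) (f (k', q'))"
        then obtain c where c: "c \<in> carrier G"
          "i k \<otimes>\<^bsub>G\<^esub> l q = c \<otimes>\<^bsub>G\<^esub> (i k' \<otimes>\<^bsub>G\<^esub> l q') \<otimes>\<^bsub>G\<^esub> inv\<^bsub>G\<^esub> (\<phi> c)" by (auto simp: tconj_def f_def)
        have "tconj Q \<theta> (p (f (k, q))) (p (f (k', q')))" using class_p[OF _ _ t] fG z by auto
        then have "tconj Q \<theta> (rp q) (rp q')" using z l rp pi by (simp add: f_def)
        then have "tclass Q \<theta> (rp q) = tclass Q \<theta> (rp q')" using tclass_eq_iff[OF Q.is_group theta] rp z by simp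
        then have qq: "tclass Q \<theta> q = tclass Q \<theta> q'" using rp z by simp
        then have rpqq: "rp q = rp q'" and lqq: "l q = l q'" using rp_eq[OF z(2,4)] by (simp_all add: l_def)
        have "p (i k \<otimes>\<^bsub>G\<^esub> l q) = p (c \<otimes>\<^bsub>G\<^esub> (i k' \<otimes>\<^bsub>G\<^esub> l q') \<otimes>\<^bsub>G\<^esub> inv\<^bsub>G\<^esub> (\<phi> c))"
          using c(2) by simp
        then have "rp q = p c \<otimes>\<^bsub>Q\<^esub> rp q \<otimes>\<^bsub>Q\<^esub> inv\<^bsub>Q\<^esub> (\<theta> (p c))"
          using c(1) z l rp pi rpqq by (simp add: comm_p)
        \<comment> \<open>Commutativity of \<open>Q\<close> separates \<open>rp q\<close> from the
          conjugator, leaving \<open>p c\<close> as a fixed point of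
          \<open>\<theta>\<close>.\<close>
        then have "rp q = rp q \<otimes>\<^bsub>Q\<^esub> (p c \<otimes>\<^bsub>Q\<^esub> inv\<^bsub>Q\<^esub> (\<theta> (p c)))"
          using c(1) rp[OF z(2)] by (simp add: Q.m_ac)
        then have "p c \<otimes>\<^bsub>Q\<^esub> inv\<^bsub>Q\<^esub> (\<theta> (p c)) = \<one>\<^bsub>Q\<^esub>"
          using Q.l_cancel_one'[of "rp q" "p c \<otimes>\<^bsub>Q\<^esub> inv\<^bsub>Q\<^esub> (\<theta> (p c))"] c(1) rp[OF z(2)] by simp
        then have "\<theta> (p c) = p c"
          using Q.inv_solve_right[of "\<one>\<^bsub>Q\<^esub>" "p c" "\<theta> (p c)"] c(1) by simp
        then have "p c = \<one>\<^bsub>Q\<^esub>" using fixed[OF False] c(1) by simp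
        then obtain d where d: "d \<in> carrier K" "c = i d" using ker c(1) by auto
        then have "i k \<otimes>\<^bsub>G\<^esub> l q = i (d \<otimes>\<^bsub>K\<^esub> k' \<otimes>\<^bsub>K\<^esub> inv\<^bsub>K\<^esub> (\<chi> d)) \<otimes>\<^bsub>G\<^esub> l q'"
          using c conj_i by simp
        then have "i k = i (d \<otimes>\<^bsub>K\<^esub> k' \<otimes>\<^bsub>K\<^esub> inv\<^bsub>K\<^esub> (\<chi> d))"
          using lqq l z d by (metis G.r_cancel K.inv_closed K.m_closed chi.hom_closed i.hom_closed)
        then have "k = d \<otimes>\<^bsub>K\<^esub> k' \<otimes>\<^bsub>K\<^esub> inv\<^bsub>K\<^esub> (\<chi> d)"
          using i(2) d z by (auto simp: inj_on_def)
        then show "tconj K \<chi> k k' \<and> tconj Q \<theta> q q'"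
          using d qq tclass_eq_iff[OF Q.is_group theta] z by (auto simp: tconj_def)
      next
        assume a: "tconj K \<chi> k k' \<and> tconj Q \<theta> q q'"
        then have "tclass Q \<theta> q = tclass Q \<theta> q'" using tclass_eq_iff[OF Q.is_group theta] z by simp
        then have lqq: "l q = l q'" using rp_eq[OF z(2,4)] by (simp_all add: l_def)
        obtain d where d: "d \<in> carrier K" "k = d \<otimes>\<^bsub>K\<^esub> k' \<otimes>\<^bsub>K\<^esub> inv\<^bsub>K\<^esub> (\<chi> d)" using a by (auto simp: tconj_def)
        then have "f (k, q) = i d \<otimes>\<^bsub>G\<^esub> f (k', q') \<otimes>\<^bsub>G\<^esub> inv\<^bsub>G\<^esub> (\<phi> (i d))"
          using conj_i[OF d(1)] lqq by (simp add: f_def)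
        then show "tconj G \<phi> (f (k, q)) (f (k', q'))" using d(1) by (auto simp: tconj_def)
      qed
      then show ?thesis
        using tclass_eq_iff[OF G phi] tclass_eq_iff[OF K chi] tclass_eq_iff[OF Q.is_group theta] fG z by simp
    qed
    have surj: "\<exists>z\<in>carrier K \<times> carrier Q. tclass G \<phi> (f z) = tclass G \<phi> g" if g: "g \<in> carrier G" for g
    proof -
      have pg: "p g \<in> carrier Q" using g by simp
      have "tconj Q \<theta> (rp (p g)) (p g)" using tclass_eq_iff[OF Q.is_group theta] rp[OF pg] pg by simp
      then obtain q where q: "q \<in> carrier Q" "rp (p g) = q \<otimes>\<^bsub>Q\<^esub> p g \<otimes>\<^bsub>Q\<^esub> inv\<^bsub>Q\<^esub> (\<theta> q)" by (auto simp: tconj_def)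
      obtain c where c: "c \<in> carrier G" "q = p c" using q(1) p(2) by blast
      \<comment> \<open>Twisted conjugation by a lift of \<open>q\<close> moves \<open>g\<close>
        into the fibre over the representative, where it differs from the chosen lift by an element
        of the kernel.\<close>
      define g' where "g' = c \<otimes>\<^bsub>G\<^esub> g \<otimes>\<^bsub>G\<^esub> inv\<^bsub>G\<^esub> (\<phi> c)"
      have g': "g' \<in> carrier G" "p g' = rp (p g)" using c g q by (auto simp: g'_def comm_p)
      have "p (g' \<otimes>\<^bsub>G\<^esub> inv\<^bsub>G\<^esub> (l (p g))) = \<one>\<^bsub>Q\<^esub>" using g' l[OF pg] rp[OF pg] by simp
      then obtain k where k: "k \<in> carrier K" "g' \<otimes>\<^bsub>G\<^esub> inv\<^bsub>G\<^esub> (l (p g)) = i k"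
        using ker[of "g' \<otimes>\<^bsub>G\<^esub> inv\<^bsub>G\<^esub> (l (p g))"] g' l[OF pg] by auto
      then have "f (k, p g) = g'" using g' l[OF pg] by (simp add: f_def flip: k(2)) (simp add: G.m_assoc)
      moreover have "tclass G \<phi> g' = tclass G \<phi> g"
        using tclass_eq_iff[OF G phi g'(1) g] c(1) by (auto simp: tconj_def g'_def)
      ultimately show ?thesis using k pg by blast
    qed
    have "reidemeister G \<phi> = ecard ((\<lambda>z. tclass G \<phi> (f z)) ` (carrier K \<times> carrier Q))"
    proof -
      have "(\<lambda>z. tclass G \<phi> (f z)) ` (carrier K \<times> carrier Q) = tclass G \<phi> ` carrier G"
        using surj fG by (auto simp: image_iff) metis+
      then show ?thesis by (simp add: reidemeister_tclass)
    qed
    also have "\<dots> = ecard ((\<lambda>(k, q). (tclass K \<chi> k, tclass Q \<theta> q)) ` (carrier K \<times> carrier Q))"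
      by (rule ecard_image_eq) (clarsimp simp: key)
    also have "(\<lambda>(k, q). (tclass K \<chi> k, tclass Q \<theta> q)) ` (carrier K \<times> carrier Q)
        = (tclass K \<chi> ` carrier K) \<times> (tclass Q \<theta> ` carrier Q)" by force
    also have "ecard \<dots> = reidemeister K \<chi> * reidemeister Q \<theta>"
      unfolding reidemeister_tclass by (rule ecard_Times) auto
    finally show ?thesis .
  qed
qed

text \<open>\<open>auto\<close> only contains maps that are \<open>undefined\<close> off the
  carrier. Passing to \<open>iso\<close> removes this condition, so induced and composed maps can be
  used without restricting them.\<close>

lemma spec_R_iso:
  assumes "group G" shows "spec_R G = reidemeister G ` iso G G"
proof
  show "spec_R G \<subseteq> reidemeister G ` iso G G"
    by (auto simp: spec_R_def auto_def Bij_def iso_def)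
  show "reidemeister G ` iso G G \<subseteq> spec_R G"
  proof
    fix n assume "n \<in> reidemeister G ` iso G G"
    then obtain \<phi> where phi: "\<phi> \<in> iso G G" "n = reidemeister G \<phi>" by blast
    let ?\<psi> = "restrict \<phi> (carrier G)"
    have hom: "\<phi> \<in> hom G G" "bij_betw \<phi> (carrier G) (carrier G)" using phi by (auto simp: iso_def)
    have "?\<psi> \<in> hom G G" by (rule group.hom_restrict[OF assms hom(1)]) simp
    moreover have "bij_betw ?\<psi> (carrier G) (carrier G)" using hom(2) by simp
    ultimately have "?\<psi> \<in> auto G" by (simp add: auto_def Bij_def)
    moreover have "n = reidemeister G ?\<psi>" unfolding phi(2) by (rule reidemeister_cong[OF assms hom(1)]) simp
    ultimately show "n \<in> spec_R G" by (auto simp: spec_R_def)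
  qed
qed

lemma spec_R_mono_iso:
  assumes G: "group G" and H: "group H" and f: "f \<in> iso G H"
  shows "spec_R G \<subseteq> spec_R H"
proof
  fix n assume "n \<in> spec_R G"
  then obtain \<phi> where phi: "\<phi> \<in> iso G G" "n = reidemeister G \<phi>" unfolding spec_R_iso[OF G] by blast
  let ?g = "inv_into (carrier G) f"
  have g: "?g \<in> iso H G" using group.iso_set_sym[OF G f] .
  define \<psi> where "\<psi> = f \<circ> (\<phi> \<circ> ?g)"
  have "\<psi> \<in> iso H H" unfolding \<psi>_def using phi(1) f g by (intro iso_set_trans)
  moreover have "n = reidemeister H \<psi>" unfolding phi(2)
  proof (rule reidemeister_iso[OF G H f])
    show "\<phi> \<in> hom G G" "\<psi> \<in> hom H H" using phi \<open>\<psi> \<in> iso H H\<close> by (auto simp: iso_def)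
    show "f (\<phi> x) = \<psi> (f x)" if "x \<in> carrier G" for x
      using f that by (simp add: \<psi>_def iso_def bij_betw_def)
  qed
  ultimately show "n \<in> spec_R H" unfolding spec_R_iso[OF H] by blast
qed

lemma spec_R_cong:
  assumes "group G" "group H" "G \<cong> H"
  shows "spec_R G = spec_R H"
  using assms spec_R_mono_iso[of G H] spec_R_mono_iso[of H G] group.iso_sym[OF assms(1)]
  unfolding is_iso_def by blast

section \<open>Free abelian groups\<close>

text \<open>Vectors are zero, not \<open>undefined\<close>, off the index set. For
  \<open>A \<subseteq> B\<close> this makes \<open>Zf A\<close> a subset of \<open>Zf B\<close> with
  the same addition, and inclusions are the identity function.\<close>

definition Zf :: "'a set \<Rightarrow> ('a \<Rightarrow> int) monoid" where
  "Zf A = \<lparr>carrier = {f. \<forall>v. v \<notin> A \<longrightarrow> f v = 0}, monoid.mult = (\<lambda>f g v. f v + g v), one = (\<lambda>_. 0)\<rparr>"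

lemma Zf_simps [simp]:
  "f \<in> carrier (Zf A) \<longleftrightarrow> (\<forall>v. v \<notin> A \<longrightarrow> f v = 0)"
  "f \<otimes>\<^bsub>Zf A\<^esub> g = (\<lambda>v. f v + g v)"
  "\<one>\<^bsub>Zf A\<^esub> = (\<lambda>_. 0)"
  by (simp_all add: Zf_def)

lemma Zf_mono: "A \<subseteq> B \<Longrightarrow> f \<in> carrier (Zf A) \<Longrightarrow> f \<in> carrier (Zf B)"
  by auto

lemma comm_group_Zf [simp]: "comm_group (Zf A)"
proof (rule comm_groupI)
  fix f assume "f \<in> carrier (Zf A)"
  then show "\<exists>g\<in>carrier (Zf A). g \<otimes>\<^bsub>Zf A\<^esub> f = \<one>\<^bsub>Zf A\<^esub>"
    by (intro bexI[of _ "\<lambda>v. - f v"]) auto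
qed (auto simp: fun_eq_iff)

lemma group_Zf [simp]: "group (Zf A)"
  using comm_group_Zf comm_group.axioms(2) by blast

lemma inv_Zf [simp]: "f \<in> carrier (Zf A) \<Longrightarrow> inv\<^bsub>Zf A\<^esub> f = (\<lambda>v. - f v)"
  by (rule group.inv_equality[OF group_Zf]) (auto simp: fun_eq_iff)

lemma Zpow_eq_Zf: "Zpow m = Zf {..<m}"
  by (simp add: Zpow_def Zf_def not_less)

lemma Zf_iso:
  assumes "bij_betw h A B"
  shows "Zf A \<cong> Zf B"
proof (rule is_isoI)
  let ?g = "inv_into A h"
  let ?f = "\<lambda>f b. if b \<in> B then f (?g b) else (0::int)"
  have g: "bij_betw ?g B A" using assms by (rule bij_betw_inv_into)
  have hg: "?g (h v) = v" if "v \<in> A" for v using assms that by (simp add: bij_betw_def)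
  have gA: "?g b \<in> A" if "b \<in> B" for b using g that by (auto simp: bij_betw_def)
  have hB: "h v \<in> B" if "v \<in> A" for v using assms that by (auto simp: bij_betw_def)
  have gh: "h (?g b) = b" if "b \<in> B" for b using assms that by (simp add: bij_betw_def f_inv_into_f)
  show "?f \<in> iso (Zf A) (Zf B)"
    unfolding iso_def
  proof (intro CollectI conjI)
    show "?f \<in> hom (Zf A) (Zf B)" by (auto simp: hom_def fun_eq_iff)
    show "bij_betw ?f (carrier (Zf A)) (carrier (Zf B))"
      by (rule bij_betw_byWitness[where f' = "\<lambda>f v. if v \<in> A then f (h v) else 0"])
        (auto simp: fun_eq_iff hg gA hB gh)
  qed
qed

definition unit_vec :: "'a \<Rightarrow> 'a \<Rightarrow> int" where
  "unit_vec v u = (if u = v then 1 else 0)"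

lemma unit_vec_in [simp]: "v \<in> A \<Longrightarrow> unit_vec v \<in> carrier (Zf A)"
  by (auto simp: unit_vec_def)

lemma Zf_induct [consumes 2, case_names zero upd]:
  assumes "finite A" "f \<in> carrier (Zf A)" "P (\<lambda>_. 0)"
    and "\<And>f v k. v \<in> A \<Longrightarrow> f \<in> carrier (Zf A) \<Longrightarrow> f v = 0 \<Longrightarrow> P f \<Longrightarrow> P (f(v := k))"
  shows "P f"
  using assms
proof (induction A arbitrary: f rule: finite_induct)
  case empty
  then have "f = (\<lambda>_. 0)" by auto
  then show ?case using empty by simp
next
  case (insert v A)
  have "P (f(v := 0))"
  proof (rule insert.IH)
    fix g u k assume "u \<in> A" "g \<in> carrier (Zf A)" "g u = 0" "P g"
    then show "P (g(u := k))" by (intro insert.prems(3)) auto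
  qed (use insert.prems in auto)
  have "P ((f(v := 0))(v := f v))"
    by (rule insert.prems(3)[OF _ _ _ \<open>P (f(v := 0))\<close>]) (use insert.prems(1) in auto)
  then show ?case by simp
qed

lemma hom_Zf_add:
  assumes "\<theta> \<in> hom (Zf A) (Zf B)" "f \<in> carrier (Zf A)" "g \<in> carrier (Zf A)"
  shows "\<theta> (\<lambda>v. f v + g v) = (\<lambda>b. \<theta> f b + \<theta> g b)"
  using hom_mult[OF assms] by simp

lemma hom_Zf_in:
  assumes "\<theta> \<in> hom (Zf A) (Zf B)" "f \<in> carrier (Zf A)"
  shows "\<theta> f \<in> carrier (Zf B)"
  using assms by (rule hom_in_carrier)

lemma hom_Zf_zero:
  assumes "\<theta> \<in> hom (Zf A) (Zf B)" shows "\<theta> (\<lambda>_. 0) = (\<lambda>_. 0)"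
  using hom_one[OF assms group_Zf group_Zf] by simp

lemma hom_Zf_scale:
  assumes "\<theta> \<in> hom (Zf A) (Zf B)" "f \<in> carrier (Zf A)"
  shows "\<theta> (\<lambda>v. k * f v) = (\<lambda>b. k * \<theta> f b)"
proof (induction k rule: int_induct[where k = 0])
  case base
  then show ?case using hom_Zf_zero[OF assms(1)] by simp
next
  case (step1 k)
  have "\<theta> (\<lambda>v. k * f v + f v) = (\<lambda>b. \<theta> (\<lambda>v. k * f v) b + \<theta> f b)"
    using assms by (intro hom_Zf_add[OF assms(1)]) auto
  then show ?case using step1 by (simp add: algebra_simps)
next
  case (step2 k)
  have "\<theta> (\<lambda>v. (k - 1) * f v + f v) = (\<lambda>b. \<theta> (\<lambda>v. (k - 1) * f v) b + \<theta> f b)"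
    using assms by (intro hom_Zf_add[OF assms(1)]) auto
  then have "(\<lambda>b. k * \<theta> f b) = (\<lambda>b. \<theta> (\<lambda>v. (k - 1) * f v) b + \<theta> f b)"
    using step2 by (simp add: algebra_simps)
  then show ?case by (auto simp: fun_eq_iff algebra_simps)
qed

lemma hom_Zf_expand:
  assumes "\<theta> \<in> hom (Zf A) (Zf B)" "finite A" "f \<in> carrier (Zf A)"
  shows "\<theta> f b = (\<Sum>v\<in>A. \<theta> (unit_vec v) b * f v)"
  using assms(2,3)
proof (induction f rule: Zf_induct)
  case zero
  then show ?case using hom_Zf_zero[OF assms(1)] by simp
next
  case (upd f v k)
  have eq: "f(v := k) = (\<lambda>u. f u + k * unit_vec v u)"
    using upd by (auto simp: unit_vec_def fun_eq_iff)
  have "\<theta> (f(v := k)) b = \<theta> f b + \<theta> (\<lambda>u. k * unit_vec v u) b"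
    unfolding eq using upd by (subst hom_Zf_add[OF assms(1)]) (auto simp: unit_vec_def)
  also have "\<theta> (\<lambda>u. k * unit_vec v u) b = k * \<theta> (unit_vec v) b"
    using upd by (subst hom_Zf_scale[OF assms(1)]) (auto simp: unit_vec_def)
  also have "\<theta> f b + k * \<theta> (unit_vec v) b = (\<Sum>u\<in>A. \<theta> (unit_vec u) b * (f(v := k)) u)"
  proof -
    have "(\<Sum>u\<in>A. \<theta> (unit_vec u) b * (k * unit_vec v u)) = k * \<theta> (unit_vec v) b"
      using upd assms(2) by (subst sum.remove[of _ v]) (auto simp: unit_vec_def intro!: sum.neutral)
    then show ?thesis unfolding eq upd.IH by (simp add: distrib_left sum.distrib)
  qed
  finally show ?case .
qed

text \<open>Finitely many classes put a non-zero multiple of each unit vector into the image of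
  \<open>\<theta> - 1\<close>. An endomorphism of a lattice whose image has full rank is injective,
  so \<open>\<theta> - 1\<close> has trivial kernel.\<close>

lemma reidemeister_Zf_fixed:
  assumes fin: "finite A" and hom: "\<theta> \<in> hom (Zf A) (Zf A)"
    and R: "reidemeister (Zf A) \<theta> \<noteq> \<infinity>" and q: "q \<in> carrier (Zf A)" "\<theta> q = q"
  shows "q = \<one>\<^bsub>Zf A\<^esub>"
proof -
  have ex: "\<exists>D w. D \<noteq> 0 \<and> w \<in> carrier (Zf A) \<and> (\<forall>b. \<theta> w b - w b = D * unit_vec v b)" if v: "v \<in> A" for v
  proof -
    \<comment> \<open>Pigeonhole on the multiples of a unit vector: two of them are twisted
      conjugate, and the conjugator is the required \<open>w\<close>, with \<open>D\<close> the
      difference of the two multipliers.\<close>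
    let ?e = "\<lambda>n::nat. \<lambda>u. int n * unit_vec v u"
    have e: "?e n \<in> carrier (Zf A)" for n using v by (auto simp: unit_vec_def)
    have "finite (range (\<lambda>n. tclass (Zf A) \<theta> (?e n)))"
    proof (rule finite_subset)
      show "range (\<lambda>n. tclass (Zf A) \<theta> (?e n)) \<subseteq> tclass (Zf A) \<theta> ` carrier (Zf A)" using e by blast
      show "finite (tclass (Zf A) \<theta> ` carrier (Zf A))"
        using R by (auto simp: reidemeister_tclass ecard_def split: if_splits)
    qed
    then have "\<not> inj (\<lambda>n. tclass (Zf A) \<theta> (?e n))" using finite_imageD by blast
    then obtain n n' where n: "n \<noteq> n'" "tclass (Zf A) \<theta> (?e n) = tclass (Zf A) \<theta> (?e n')"
      by (auto simp: inj_def)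
    then have "tconj (Zf A) \<theta> (?e n) (?e n')" using tclass_eq_iff[OF group_Zf hom e e] by simp
    then obtain c where c: "c \<in> carrier (Zf A)"
      "?e n = c \<otimes>\<^bsub>Zf A\<^esub> ?e n' \<otimes>\<^bsub>Zf A\<^esub> inv\<^bsub>Zf A\<^esub> (\<theta> c)" unfolding tconj_def by blast
    have "?e n = (\<lambda>u. c u + ?e n' u + - \<theta> c u)"
      using c(2) unfolding inv_Zf[OF hom_Zf_in[OF hom c(1)]] by simp
    then have "\<theta> c b - c b = (int n' - int n) * unit_vec v b" for b
      by (auto dest!: fun_cong[of _ _ b] simp: algebra_simps)
    then show ?thesis using n c(1) by (intro exI[of _ "int n' - int n"] exI[of _ c]) auto
  qed
  then have "\<forall>v\<in>A. \<exists>D w. D \<noteq> 0 \<and> w \<in> carrier (Zf A) \<and> (\<forall>b. \<theta> w b - w b = D * unit_vec v b)" by blast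
  then obtain D w where w: "\<And>v. v \<in> A \<Longrightarrow> D v \<noteq> 0 \<and> w v \<in> carrier (Zf A) \<and>
      (\<forall>b. \<theta> (w v) b - w v b = D v * unit_vec v b)" by metis
  \<comment> \<open>Applying \<open>\<theta> - 1\<close> to a combination of the \<open>w v\<close>
    that equals the fixed vector \<open>t * q\<close> leaves \<open>D b * x b = 0\<close> in each
    coordinate. With \<open>t = 0\<close> this is injectivity of the matrix \<open>w\<close>; with
    the \<open>t \<noteq> 0\<close> that injectivity then provides, it forces
    \<open>q = 0\<close>.\<close>
  have key: "x b = 0" if x: "\<forall>b\<in>A. (\<Sum>v\<in>A. w v b * x v) = t * q b" and b: "b \<in> A" for t x b
  proof -
    have eq: "(\<lambda>b. t * q b) = (\<lambda>b. \<Sum>v\<in>A. w v b * x v)"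
    proof
      fix b show "t * q b = (\<Sum>v\<in>A. w v b * x v)"
      proof (cases "b \<in> A")
        case False
        then have "(\<Sum>v\<in>A. w v b * x v) = 0" using w by (intro sum.neutral) auto
        then show ?thesis using q False by auto
      qed (use x in auto)
    qed
    have tq: "\<theta> (\<lambda>b. t * q b) b = t * q b" using hom_Zf_scale[OF hom q(1)] q(2) by simp
    have "\<theta> (\<lambda>b. t * q b) b = (\<Sum>u\<in>A. \<theta> (unit_vec u) b * (t * q u))"
      using q(1) by (intro hom_Zf_expand[OF hom fin]) auto
    also have "\<dots> = (\<Sum>u\<in>A. \<Sum>v\<in>A. \<theta> (unit_vec u) b * (w v u * x v))"
      by (rule sum.cong) (use x in \<open>auto simp flip: sum_distrib_left\<close>)
    also have "\<dots> = (\<Sum>v\<in>A. (\<Sum>u\<in>A. \<theta> (unit_vec u) b * w v u) * x v)"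
      by (subst sum.swap) (simp add: sum_distrib_right mult.assoc)
    also have "\<dots> = (\<Sum>v\<in>A. \<theta> (w v) b * x v)"
      by (rule sum.cong[OF HOL.refl], subst hom_Zf_expand[OF hom fin]) (use w in auto)
    finally have "(\<Sum>v\<in>A. \<theta> (w v) b * x v) = (\<Sum>v\<in>A. w v b * x v)" using tq x b by simp
    then have "0 = (\<Sum>v\<in>A. (\<theta> (w v) b - w v b) * x v)" by (simp add: left_diff_distrib sum_subtractf)
    also have "\<dots> = (\<Sum>v\<in>A. if v = b then D b * x b else 0)"
      by (rule sum.cong) (use w in \<open>auto simp: unit_vec_def\<close>)
    also have "\<dots> = D b * x b" using fin b by simp
    finally show ?thesis using w[OF b] by simp
  qed
  have "int_inj A A (\<lambda>b v. w v b)"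
    unfolding int_inj_def using key[of _ 0] by auto
  from int_inj_solvable[OF fin fin this HOL.refl, of q]
  obtain t x where t: "t \<noteq> 0" "\<And>b. b \<in> A \<Longrightarrow> (\<Sum>v\<in>A. w v b * x v) = t * q b" by blast
  have "x b = 0" if "b \<in> A" for b using key[of x t] t(2) that by blast
  then have "q b = 0" if "b \<in> A" for b using t(2)[OF that] t(1) by simp
  then show ?thesis using q(1) by auto
qed

section \<open>Restricting integer vectors to blocks\<close>

definition zrestr :: "'a set \<Rightarrow> ('a \<Rightarrow> int) \<Rightarrow> 'a \<Rightarrow> int" where
  "zrestr S f v = (if v \<in> S then f v else 0)"

lemma zrestr_in [simp]: "zrestr S f \<in> carrier (Zf S)"
  by (simp add: zrestr_def)

lemma zrestr_id: "f \<in> carrier (Zf S) \<Longrightarrow> zrestr S f = f"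
  by (auto simp: zrestr_def fun_eq_iff)

lemma zrestr_hom: "zrestr S \<in> hom (Zf A) (Zf S)"
  by (auto simp: hom_def zrestr_def fun_eq_iff)

lemma zrestr_bij:
  assumes un: "(\<Union>t\<in>J. S t) = A" and disj: "\<And>t u. t \<in> J \<Longrightarrow> u \<in> J \<Longrightarrow> t \<noteq> u \<Longrightarrow> S t \<inter> S u = {}"
  shows "bij_betw (\<lambda>f. \<lambda>t\<in>J. zrestr (S t) f) (carrier (Zf A)) (\<Pi>\<^sub>E t\<in>J. carrier (Zf (S t)))"
proof -
  define i where "i v = (THE t. t \<in> J \<and> v \<in> S t)" for v
  have i: "i v = t" if "t \<in> J" "v \<in> S t" for t v
    unfolding i_def using that disj by (intro the_equality) auto
  show ?thesis
  proof (rule bij_betw_byWitness[where f' = "\<lambda>F v. if v \<in> A then F (i v) v else 0"])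
    show "\<forall>f\<in>carrier (Zf A). (\<lambda>v. if v \<in> A then (\<lambda>t\<in>J. zrestr (S t) f) (i v) v else 0) = f"
    proof (intro ballI ext)
      fix f v assume f: "f \<in> carrier (Zf A)"
      show "(if v \<in> A then (\<lambda>t\<in>J. zrestr (S t) f) (i v) v else 0) = f v"
      proof (cases "v \<in> A")
        case True
        then obtain t where t: "t \<in> J" "v \<in> S t" using un by blast
        then show ?thesis using True i[OF t] by (simp add: zrestr_def)
      qed (use f in auto)
    qed
    show "\<forall>F\<in>\<Pi>\<^sub>E t\<in>J. carrier (Zf (S t)). (\<lambda>t\<in>J. zrestr (S t) (\<lambda>v. if v \<in> A then F (i v) v else 0)) = F"
    proof
      fix F assume F: "F \<in> (\<Pi>\<^sub>E t\<in>J. carrier (Zf (S t)))"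
      show "(\<lambda>t\<in>J. zrestr (S t) (\<lambda>v. if v \<in> A then F (i v) v else 0)) = F"
      proof
        fix t
        show "(\<lambda>t\<in>J. zrestr (S t) (\<lambda>v. if v \<in> A then F (i v) v else 0)) t = F t"
        proof (cases "t \<in> J")
          case True
          then have Ft: "F t \<in> carrier (Zf (S t))" using F by blast
          have "zrestr (S t) (\<lambda>v. if v \<in> A then F (i v) v else 0) v = F t v" for v
            using Ft True i[OF True, of v] un by (cases "v \<in> S t") (auto simp: zrestr_def)
          then show ?thesis using True by (simp add: fun_eq_iff)
        qed (use F in \<open>auto simp: PiE_def extensional_def\<close>)
      qed
    qed
  qed (use un in \<open>auto simp: zrestr_def\<close>)
qed

lemma zrestr_block:
  assumes hom: "\<theta> \<in> hom (Zf A) (Zf A)" and fin: "finite A" and S: "S \<subseteq> A"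
    and block: "\<And>v b. v \<in> A - S \<Longrightarrow> b \<in> S \<Longrightarrow> \<theta> (unit_vec v) b = 0"
    and f: "f \<in> carrier (Zf A)"
  shows "zrestr S (\<theta> f) = zrestr S (\<theta> (zrestr S f))"
proof
  fix b
  have g: "zrestr S f \<in> carrier (Zf A)" using S by (auto simp: zrestr_def)
  have "\<theta> f b = \<theta> (zrestr S f) b" if "b \<in> S"
    unfolding hom_Zf_expand[OF hom fin f] hom_Zf_expand[OF hom fin g]
    by (rule sum.cong) (use block that in \<open>auto simp: zrestr_def\<close>)
  then show "zrestr S (\<theta> f) b = zrestr S (\<theta> (zrestr S f)) b" by (simp add: zrestr_def)
qed

lemma Zf_support:
  assumes hom: "\<theta> \<in> hom (Zf A) (Zf A)" and fin: "finite A" and S: "S \<subseteq> A"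
    and block: "\<And>v b. v \<in> S \<Longrightarrow> b \<in> A - S \<Longrightarrow> \<theta> (unit_vec v) b = 0"
    and f: "f \<in> carrier (Zf S)"
  shows "\<theta> f \<in> carrier (Zf S)"
proof -
  have g: "f \<in> carrier (Zf A)" using S f by auto
  have "\<theta> f b = 0" if "b \<in> A - S" for b
    unfolding hom_Zf_expand[OF hom fin g]
    by (rule sum.neutral) (use block that f in auto)
  moreover have "\<theta> f b = 0" if "b \<notin> A" for b using hom_Zf_in[OF hom g] that by auto
  ultimately show ?thesis by auto
qed

lemma zrestr_comp_hom:
  assumes "\<theta> \<in> hom (Zf A) (Zf A)" "S \<subseteq> A"
  shows "(\<lambda>f. zrestr S (\<theta> f)) \<in> hom (Zf S) (Zf S)"
proof (rule homI)
  fix f g assume fg: "f \<in> carrier (Zf S)" "g \<in> carrier (Zf S)"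
  then have "f \<in> carrier (Zf A)" "g \<in> carrier (Zf A)" using assms(2) by auto
  from hom_Zf_add[OF assms(1) this] show "zrestr S (\<theta> (f \<otimes>\<^bsub>Zf S\<^esub> g)) = zrestr S (\<theta> f) \<otimes>\<^bsub>Zf S\<^esub> zrestr S (\<theta> g)"
    by (auto simp: zrestr_def fun_eq_iff)
qed (rule zrestr_in)

text \<open>By \<open>b1\<close> the block is invariant, so the restriction inherits injectivity; by
  \<open>b2\<close> a preimage may be cut down to the block, so it inherits surjectivity.\<close>

lemma block_bij:
  assumes hom: "\<theta> \<in> hom (Zf A) (Zf A)" and bij: "bij_betw \<theta> (carrier (Zf A)) (carrier (Zf A))"
    and fin: "finite A" and S: "S \<subseteq> A"
    and b1: "\<And>v b. v \<in> S \<Longrightarrow> b \<in> A - S \<Longrightarrow> \<theta> (unit_vec v) b = 0"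
    and b2: "\<And>v b. v \<in> A - S \<Longrightarrow> b \<in> S \<Longrightarrow> \<theta> (unit_vec v) b = 0"
  shows "bij_betw (\<lambda>f. zrestr S (\<theta> f)) (carrier (Zf S)) (carrier (Zf S))"
  unfolding bij_betw_def
proof
  have SA: "f \<in> carrier (Zf A)" if "f \<in> carrier (Zf S)" for f using that S by auto
  have id: "zrestr S (\<theta> f) = \<theta> f" if "f \<in> carrier (Zf S)" for f
    using zrestr_id[OF Zf_support[OF hom fin S b1 that]] by blast
  show "inj_on (\<lambda>f. zrestr S (\<theta> f)) (carrier (Zf S))"
  proof (rule inj_onI)
    fix f g assume fg: "f \<in> carrier (Zf S)" "g \<in> carrier (Zf S)" "zrestr S (\<theta> f) = zrestr S (\<theta> g)"
    then have "\<theta> f = \<theta> g" using id by simp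
    then show "f = g" using bij SA[OF fg(1)] SA[OF fg(2)] by (auto simp: bij_betw_def inj_on_def)
  qed
  show "(\<lambda>f. zrestr S (\<theta> f)) ` carrier (Zf S) = carrier (Zf S)"
  proof
    show "carrier (Zf S) \<subseteq> (\<lambda>f. zrestr S (\<theta> f)) ` carrier (Zf S)"
    proof
      fix g assume g: "g \<in> carrier (Zf S)"
      then have "g \<in> \<theta> ` carrier (Zf A)" using SA bij unfolding bij_betw_def by blast
      then obtain f where f: "f \<in> carrier (Zf A)" "g = \<theta> f" by blast
      then have "g = zrestr S (\<theta> (zrestr S f))"
        using zrestr_block[OF hom fin S b2 f(1)] zrestr_id[OF g] by simp
      then show "g \<in> (\<lambda>f. zrestr S (\<theta> f)) ` carrier (Zf S)"
        using imageI[OF zrestr_in[of S f], of "\<lambda>f. zrestr S (\<theta> f)"] by simp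
    qed
  qed (use zrestr_in in blast)
qed

section \<open>A model of the group of a graph\<close>

definition nonedges :: "'v::linorder set \<Rightarrow> ('v \<Rightarrow> 'v \<Rightarrow> bool) \<Rightarrow> ('v \<times> 'v) set" where
  "nonedges V E = {(i, j). i \<in> V \<and> j \<in> V \<and> i < j \<and> \<not> E i j}"

text \<open>Collecting \<open>(x\<^sub>1^a\<^sub>1 \<dots> x\<^sub>n^a\<^sub>n) (x\<^sub>1^b\<^sub>1 \<dots> x\<^sub>n^b\<^sub>n)\<close> moves \<open>x\<^sub>j^a\<^sub>j\<close> to the right past \<open>x\<^sub>i^b\<^sub>i\<close> for
  \<open>i < j\<close>, which produces \<open>y\<^sub>i\<^sub>j^(a\<^sub>j b\<^sub>i)\<close>.\<close>

definition cocyc :: "('v::linorder \<Rightarrow> 'v \<Rightarrow> bool) \<Rightarrow> ('v \<Rightarrow> int) \<Rightarrow> ('v \<Rightarrow> int) \<Rightarrow> 'v \<times> 'v \<Rightarrow> int" where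
  "cocyc E a b p = (if fst p < snd p \<and> \<not> E (fst p) (snd p) then a (snd p) * b (fst p) else 0)"

text \<open>The pair \<open>(a, c)\<close> stands for the product of the powers of the
  \<open>x\<close> generators with exponents \<open>a\<close>, in increasing order, times the powers
  of the \<open>y\<close> generators with exponents \<open>c\<close>.\<close>

definition model ::
    "'v::linorder set \<Rightarrow> ('v \<Rightarrow> 'v \<Rightarrow> bool) \<Rightarrow> (('v \<Rightarrow> int) \<times> ('v \<times> 'v \<Rightarrow> int)) monoid" where
  "model V E = \<lparr>carrier = carrier (Zf V) \<times> carrier (Zf (nonedges V E)),
     monoid.mult = (\<lambda>g h. (\<lambda>v. fst g v + fst h v, \<lambda>p. snd g p + snd h p + cocyc E (fst g) (fst h) p)),
     one = (\<lambda>_. 0, \<lambda>_. 0)\<rparr>"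

lemma model_simps:
  "g \<in> carrier (model V E) \<longleftrightarrow> fst g \<in> carrier (Zf V) \<and> snd g \<in> carrier (Zf (nonedges V E))"
  "g \<otimes>\<^bsub>model V E\<^esub> h = (\<lambda>v. fst g v + fst h v, \<lambda>p. snd g p + snd h p + cocyc E (fst g) (fst h) p)"
  "\<one>\<^bsub>model V E\<^esub> = (\<lambda>_. 0, \<lambda>_. 0)"
  by (auto simp: model_def mem_Times_iff)

lemma cocyc_in: "a \<in> carrier (Zf V) \<Longrightarrow> b \<in> carrier (Zf V) \<Longrightarrow> cocyc E a b \<in> carrier (Zf (nonedges V E))"
  by (auto simp: cocyc_def nonedges_def)

lemma cocyc_zero [simp]: "cocyc E (\<lambda>_. 0) b = (\<lambda>_. 0)" "cocyc E a (\<lambda>_. 0) = (\<lambda>_. 0)"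
  by (auto simp: cocyc_def fun_eq_iff)

lemma cocyc_add:
  "cocyc E (\<lambda>v. a v + a' v) b p = cocyc E a b p + cocyc E a' b p"
  "cocyc E a (\<lambda>v. b v + b' v) p = cocyc E a b p + cocyc E a b' p"
  by (auto simp: cocyc_def algebra_simps)

lemma cocyc_minus: "cocyc E (\<lambda>v. - a v) b p = - cocyc E a b p"
  by (auto simp: cocyc_def)

lemma model_group [simp]: "group (model V E)"
proof (rule groupI)
  fix g h assume "g \<in> carrier (model V E)" "h \<in> carrier (model V E)"
  then show "g \<otimes>\<^bsub>model V E\<^esub> h \<in> carrier (model V E)"
    using cocyc_in[of "fst g" V "fst h" E] by (auto simp: model_simps)
next
  fix g assume g: "g \<in> carrier (model V E)"
  \<comment> \<open>The term \<open>cocyc E (fst g) (fst g)\<close> cancels the cocycle of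
    \<open>- fst g\<close> with \<open>fst g\<close>.\<close>
  let ?h = "(\<lambda>v. - fst g v, \<lambda>p. - snd g p + cocyc E (fst g) (fst g) p)"
  have "?h \<in> carrier (model V E)" using g cocyc_in[of "fst g" V "fst g" E] by (auto simp: model_simps)
  moreover have "?h \<otimes>\<^bsub>model V E\<^esub> g = \<one>\<^bsub>model V E\<^esub>"
    by (simp add: model_simps cocyc_minus)
  ultimately show "\<exists>h\<in>carrier (model V E). h \<otimes>\<^bsub>model V E\<^esub> g = \<one>\<^bsub>model V E\<^esub>" by blast
qed (auto simp: model_simps fun_eq_iff cocyc_add algebra_simps cocyc_def)

lemma finite_nonedges: "finite V \<Longrightarrow> finite (nonedges V E)"
  by (rule finite_subset[of _ "V \<times> V"]) (auto simp: nonedges_def)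

section \<open>Induced subgraphs and joins in the model\<close>

definition nil_restr :: "'v::linorder set \<Rightarrow> ('v \<Rightarrow> 'v \<Rightarrow> bool) \<Rightarrow>
    ('v \<Rightarrow> int) \<times> ('v \<times> 'v \<Rightarrow> int) \<Rightarrow> ('v \<Rightarrow> int) \<times> ('v \<times> 'v \<Rightarrow> int)" where
  "nil_restr S E g = (zrestr S (fst g), zrestr (nonedges S E) (snd g))"

lemma nil_restr_in: "nil_restr S E g \<in> carrier (model S E)"
  unfolding model_simps nil_restr_def fst_conv snd_conv by (intro conjI zrestr_in)

text \<open>The cocycle at a pair reads only the coordinates at its two ends, so forgetting
  everything outside the induced subgraph respects multiplication.\<close>

lemma nil_restr_hom: "nil_restr S E \<in> hom (model V E) (model S E)"
proof (rule homI)
  fix g h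
  show "nil_restr S E (g \<otimes>\<^bsub>model V E\<^esub> h) = nil_restr S E g \<otimes>\<^bsub>model S E\<^esub> nil_restr S E h"
    by (auto simp: model_simps nil_restr_def zrestr_def cocyc_def nonedges_def fun_eq_iff)
qed (rule nil_restr_in)

lemma nonedges_mono: "S \<subseteq> V \<Longrightarrow> nonedges S E \<subseteq> nonedges V E"
  by (auto simp: nonedges_def)

lemma model_mono: "S \<subseteq> V \<Longrightarrow> g \<in> carrier (model S E) \<Longrightarrow> g \<in> carrier (model V E)"
  unfolding model_simps using Zf_mono nonedges_mono by metis

lemma nil_incl_hom: "S \<subseteq> V \<Longrightarrow> (\<lambda>g. g) \<in> hom (model S E) (model V E)"
  by (auto simp: hom_def model_mono model_simps(2))

lemma nonedges_join:
  assumes un: "(\<Union>t\<in>J. Q t) = V"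
    and disj: "\<And>t u. t \<in> J \<Longrightarrow> u \<in> J \<Longrightarrow> t \<noteq> u \<Longrightarrow> Q t \<inter> Q u = {}"
    and adj: "\<And>t u x y. t \<in> J \<Longrightarrow> u \<in> J \<Longrightarrow> t \<noteq> u \<Longrightarrow> x \<in> Q t \<Longrightarrow> y \<in> Q u \<Longrightarrow> E x y"
  shows "(\<Union>t\<in>J. nonedges (Q t) E) = nonedges V E"
    and "t \<in> J \<Longrightarrow> u \<in> J \<Longrightarrow> t \<noteq> u \<Longrightarrow> nonedges (Q t) E \<inter> nonedges (Q u) E = {}"
proof -
  show "(\<Union>t\<in>J. nonedges (Q t) E) = nonedges V E"
    unfolding nonedges_def un[symmetric] using adj by blast
  show "t \<in> J \<Longrightarrow> u \<in> J \<Longrightarrow> t \<noteq> u \<Longrightarrow> nonedges (Q t) E \<inter> nonedges (Q u) E = {}"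
    unfolding nonedges_def using disj by blast
qed

text \<open>No non-edge runs between two parts of a join, so the cocycle has no mixed terms and the
  restrictions to the parts are the coordinates of a direct product.\<close>

lemma model_join:
  assumes un: "(\<Union>t\<in>J. Q t) = V"
    and disj: "\<And>t u. t \<in> J \<Longrightarrow> u \<in> J \<Longrightarrow> t \<noteq> u \<Longrightarrow> Q t \<inter> Q u = {}"
    and adj: "\<And>t u x y. t \<in> J \<Longrightarrow> u \<in> J \<Longrightarrow> t \<noteq> u \<Longrightarrow> x \<in> Q t \<Longrightarrow> y \<in> Q u \<Longrightarrow> E x y"
  shows "model V E \<cong> product_group J (\<lambda>t. model (Q t) E)"
proof (rule is_isoI)
  let ?f = "\<lambda>g. \<lambda>t\<in>J. nil_restr (Q t) E g"
  have b1: "bij_betw (\<lambda>f. \<lambda>t\<in>J. zrestr (Q t) f) (carrier (Zf V)) (\<Pi>\<^sub>E t\<in>J. carrier (Zf (Q t)))"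
    by (rule zrestr_bij[OF un disj])
  have b2: "bij_betw (\<lambda>f. \<lambda>t\<in>J. zrestr (nonedges (Q t) E) f) (carrier (Zf (nonedges V E)))
      (\<Pi>\<^sub>E t\<in>J. carrier (Zf (nonedges (Q t) E)))"
    by (rule zrestr_bij[OF nonedges_join(1)[OF un disj adj] nonedges_join(2)[OF un disj adj]])
  have "bij_betw ?f (carrier (model V E)) (\<Pi>\<^sub>E t\<in>J. carrier (model (Q t) E))"
    unfolding bij_betw_def
  proof
    show "inj_on ?f (carrier (model V E))"
    proof (rule inj_onI)
      fix g h assume gh: "g \<in> carrier (model V E)" "h \<in> carrier (model V E)" "?f g = ?f h"
      have eq: "nil_restr (Q t) E g = nil_restr (Q t) E h" if "t \<in> J" for t
        using fun_cong[OF gh(3), of t] that by simp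
      then have "(\<lambda>t\<in>J. zrestr (Q t) (fst g)) = (\<lambda>t\<in>J. zrestr (Q t) (fst h))"
        by (intro restrict_ext) (simp add: nil_restr_def)
      moreover have "(\<lambda>t\<in>J. zrestr (nonedges (Q t) E) (snd g)) = (\<lambda>t\<in>J. zrestr (nonedges (Q t) E) (snd h))"
        using eq by (intro restrict_ext) (simp add: nil_restr_def)
      moreover have "fst g \<in> carrier (Zf V)" "fst h \<in> carrier (Zf V)"
        "snd g \<in> carrier (Zf (nonedges V E))" "snd h \<in> carrier (Zf (nonedges V E))"
        using gh unfolding model_simps by blast+
      ultimately show "g = h"
        using b1 b2 unfolding bij_betw_def inj_on_def by (simp add: prod_eq_iff)
    qed
    show "?f ` carrier (model V E) = (\<Pi>\<^sub>E t\<in>J. carrier (model (Q t) E))"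
    proof
      show "(\<Pi>\<^sub>E t\<in>J. carrier (model (Q t) E)) \<subseteq> ?f ` carrier (model V E)"
      proof
        fix F assume F: "F \<in> (\<Pi>\<^sub>E t\<in>J. carrier (model (Q t) E))"
        then have Ft: "fst (F t) \<in> carrier (Zf (Q t))" "snd (F t) \<in> carrier (Zf (nonedges (Q t) E))" if "t \<in> J" for t
          using that unfolding PiE_iff model_simps by blast+
        have "(\<lambda>t\<in>J. fst (F t)) \<in> (\<Pi>\<^sub>E t\<in>J. carrier (Zf (Q t)))" 
          unfolding restrict_PiE_iff using Ft(1) by blast
        then obtain a where a: "a \<in> carrier (Zf V)" "(\<lambda>t\<in>J. fst (F t)) = (\<lambda>t\<in>J. zrestr (Q t) a)"
          using b1 unfolding bij_betw_def by blast
        have "(\<lambda>t\<in>J. snd (F t)) \<in> (\<Pi>\<^sub>E t\<in>J. carrier (Zf (nonedges (Q t) E)))" 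
          unfolding restrict_PiE_iff using Ft(2) by blast
        then obtain c where c: "c \<in> carrier (Zf (nonedges V E))"
          "(\<lambda>t\<in>J. snd (F t)) = (\<lambda>t\<in>J. zrestr (nonedges (Q t) E) c)"
          using b2 unfolding bij_betw_def by blast
        have "?f (a, c) = F"
        proof
          fix t show "?f (a, c) t = F t"
          proof (cases "t \<in> J")
            case True
            then show ?thesis using fun_cong[OF a(2), of t] fun_cong[OF c(2), of t]
              by (simp add: nil_restr_def prod_eq_iff)
          qed (use F in \<open>auto simp: PiE_def extensional_def\<close>)
        qed
        moreover have "(a, c) \<in> carrier (model V E)" using a c by (simp add: model_simps)
        ultimately show "F \<in> ?f ` carrier (model V E)" by blast
      qed
    qed (rule image_subsetI, simp only: restrict_PiE_iff nil_restr_in, blast)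
  qed
  moreover have "?f \<in> hom (model V E) (product_group J (\<lambda>t. model (Q t) E))"
  proof (rule homI)
    fix g h assume gh: "g \<in> carrier (model V E)" "h \<in> carrier (model V E)"
    show "?f (g \<otimes>\<^bsub>model V E\<^esub> h) = ?f g \<otimes>\<^bsub>product_group J (\<lambda>t. model (Q t) E)\<^esub> ?f h"
      using hom_mult[OF nil_restr_hom gh] by (simp add: fun_eq_iff)
  qed (simp only: carrier_product_group restrict_PiE_iff nil_restr_in, blast)
  ultimately show "?f \<in> iso (model V E) (product_group J (\<lambda>t. model (Q t) E))"
    by (simp add: iso_def)
qed

lemma model_complete:
  assumes "nonedges V E = {}"
  shows "model V E \<cong> Zf V"
proof (rule is_isoI)
  have "bij_betw fst (carrier (model V E)) (carrier (Zf V))"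
    by (rule bij_betw_byWitness[where f' = "\<lambda>a. (a, \<lambda>_. 0)"]) (auto simp: model_simps assms)
  moreover have "fst \<in> hom (model V E) (Zf V)"
    by (rule homI) (simp_all add: model_simps)
  ultimately show "fst \<in> iso (model V E) (Zf V)" by (simp add: iso_def)
qed

section \<open>Maps induced by a homomorphism of models\<close>

text \<open>The induced map is read off at the lift \<open>(a, 0)\<close>. This section of the
  projection is not a homomorphism, but its defect lies in the second component, which
  \<open>ab_map\<close> discards; \<open>nil_hom_ab\<close> shows that any other lift gives the same
  value.\<close>

definition ab_map :: "(('v \<Rightarrow> int) \<times> ('v \<times> 'v \<Rightarrow> int) \<Rightarrow> ('w \<Rightarrow> int) \<times> 'c) \<Rightarrow> ('v \<Rightarrow> int) \<Rightarrow> 'w \<Rightarrow> int" where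
  "ab_map h a = fst (h (a, \<lambda>_. 0))"

definition ce_map :: "(('v \<Rightarrow> int) \<times> ('v \<times> 'v \<Rightarrow> int) \<Rightarrow> 'b \<times> 'c) \<Rightarrow> ('v \<times> 'v \<Rightarrow> int) \<Rightarrow> 'c" where
  "ce_map h c = snd (h (\<lambda>_. 0, c))"

context
  fixes V W :: "'v::linorder set" and E F :: "'v \<Rightarrow> 'v \<Rightarrow> bool" and h
  assumes fin: "finite V" and h: "h \<in> hom (model V E) (model W F)"
begin

lemma nil_hom_in: "g \<in> carrier (model V E) \<Longrightarrow> h g \<in> carrier (model W F)"
  using h by (rule hom_in_carrier)

lemma nil_hom_fst:
  assumes "g \<in> carrier (model V E)" "g' \<in> carrier (model V E)"
  shows "fst (h (g \<otimes>\<^bsub>model V E\<^esub> g')) v = fst (h g) v + fst (h g') v"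
  using hom_mult[OF h assms] by (simp add: model_simps)

text \<open>The equation on \<open>c\<close> says that \<open>(0, c)\<close> is the commutator of
  the lifts of \<open>a\<close> and \<open>b\<close>. Since \<open>h\<close> preserves commutators,
  this both forces the image into the second component and computes it from
  \<open>ab_map h\<close>.\<close>

lemma nil_hom_commutator:
  assumes a: "a \<in> carrier (Zf V)" "b \<in> carrier (Zf V)" and c: "c \<in> carrier (Zf (nonedges V E))"
    and eq: "\<And>p. cocyc E a b p = cocyc E b a p + c p"
  shows "fst (h (\<lambda>_. 0, c)) = (\<lambda>_. 0)"
    and "snd (h (\<lambda>_. 0, c)) p = cocyc F (ab_map h a) (ab_map h b) p - cocyc F (ab_map h b) (ab_map h a) p"
proof -
  let ?G = "model V E"
  let ?a = "(a, \<lambda>_. 0)" and ?b = "(b, \<lambda>_. 0)" and ?c = "(\<lambda>_. 0, c)"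
  have G: "?a \<in> carrier ?G" "?b \<in> carrier ?G" "?c \<in> carrier ?G" using a c by (auto simp: model_simps)
  have G2: "?b \<otimes>\<^bsub>?G\<^esub> ?a \<in> carrier ?G" using G group.is_monoid[OF model_group] monoid.m_closed by metis
  have "?a \<otimes>\<^bsub>?G\<^esub> ?b = (?b \<otimes>\<^bsub>?G\<^esub> ?a) \<otimes>\<^bsub>?G\<^esub> ?c"
    by (auto simp: model_simps eq fun_eq_iff)
  then have e: "h ?a \<otimes>\<^bsub>model W F\<^esub> h ?b = (h ?b \<otimes>\<^bsub>model W F\<^esub> h ?a) \<otimes>\<^bsub>model W F\<^esub> h ?c"
    using hom_mult[OF h G(1,2)] hom_mult[OF h G2 G(3)] hom_mult[OF h G(2,1)] by simp
  have "fst (h ?c) v = 0" for v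
    using arg_cong[OF e, of "\<lambda>g. fst g v"] by (simp add: model_simps)
  then show f: "fst (h ?c) = (\<lambda>_. 0)" by auto
  show "snd (h ?c) p = cocyc F (ab_map h a) (ab_map h b) p - cocyc F (ab_map h b) (ab_map h a) p"
    using arg_cong[OF e, of "\<lambda>g. snd g p"] f by (simp add: model_simps ab_map_def)
qed

text \<open>\<open>unit_vec (i, j)\<close> is the commutator of the generators at \<open>j\<close>
  and \<open>i\<close>, so the entries of \<open>ce_map h\<close> are 2x2 minors of the matrix of
  \<open>ab_map h\<close>. The factor \<open>k\<close>, obtained from a \<open>k\<close>-th power of
  the generator at \<open>j\<close>, serves the induction in \<open>nil_hom_central\<close>.\<close>

lemma nil_hom_unit:
  assumes "(i, j) \<in> nonedges V E"
  shows "fst (h (\<lambda>_. 0, \<lambda>q. k * unit_vec (i, j) q)) = (\<lambda>_. 0)"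
    and "snd (h (\<lambda>_. 0, unit_vec (i, j))) p =
      cocyc F (ab_map h (unit_vec j)) (ab_map h (unit_vec i)) p - cocyc F (ab_map h (unit_vec i)) (ab_map h (unit_vec j)) p"
proof -
  have ij: "i \<in> V" "j \<in> V" "i < j" "\<not> E i j" using assms by (auto simp: nonedges_def)
  show "fst (h (\<lambda>_. 0, \<lambda>q. k * unit_vec (i, j) q)) = (\<lambda>_. 0)"
    by (rule nil_hom_commutator(1)[of "\<lambda>v. k * unit_vec j v" "unit_vec i"])
      (use ij in \<open>auto simp: cocyc_def unit_vec_def nonedges_def\<close>)
  show "snd (h (\<lambda>_. 0, unit_vec (i, j))) p =
      cocyc F (ab_map h (unit_vec j)) (ab_map h (unit_vec i)) p - cocyc F (ab_map h (unit_vec i)) (ab_map h (unit_vec j)) p"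
    by (rule nil_hom_commutator(2)[of "unit_vec j" "unit_vec i"])
      (use ij in \<open>auto simp: cocyc_def unit_vec_def nonedges_def\<close>)
qed

text \<open>Centrality would not be enough, as vertices of full degree are central too. What counts
  is that the vectors on non-edges are products of commutators.\<close>

lemma nil_hom_central:
  assumes "c \<in> carrier (Zf (nonedges V E))"
  shows "h (\<lambda>_. 0, c) = (\<lambda>_. 0, ce_map h c)"
proof -
  have "fst (h (\<lambda>_. 0, c)) = (\<lambda>_. 0)"
    using finite_nonedges[OF fin] assms
  proof (induction c rule: Zf_induct)
    case zero
    show ?case using hom_one[OF h] by (simp add: model_simps)
  next
    case (upd c p k)
    have G: "(\<lambda>_. 0, c) \<in> carrier (model V E)" "(\<lambda>_. 0, \<lambda>q. k * unit_vec p q) \<in> carrier (model V E)"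
      using upd by (auto simp: model_simps unit_vec_def)
    have eq: "(\<lambda>_. 0, c(p := k)) = (\<lambda>_. 0, c) \<otimes>\<^bsub>model V E\<^esub> (\<lambda>_. 0, \<lambda>q. k * unit_vec p q)"
      using upd by (auto simp: model_simps unit_vec_def fun_eq_iff)
    show ?case unfolding eq
      using nil_hom_fst[OF G] upd.IH nil_hom_unit(1)[of "fst p" "snd p" k] upd.hyps by (auto simp: fun_eq_iff)
  qed
  then show ?thesis by (simp add: ce_map_def prod_eq_iff)
qed

lemma nil_hom_ab:
  assumes "g \<in> carrier (model V E)"
  shows "fst (h g) = ab_map h (fst g)"
proof -
  have G: "(fst g, \<lambda>_. 0) \<in> carrier (model V E)" "(\<lambda>_. 0, snd g) \<in> carrier (model V E)"
    "snd g \<in> carrier (Zf (nonedges V E))"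
    using assms by (auto simp: model_simps)
  have "g = (fst g, \<lambda>_. 0) \<otimes>\<^bsub>model V E\<^esub> (\<lambda>_. 0, snd g)" by (simp add: model_simps)
  then have "fst (h g) v = ab_map h (fst g) v" for v
    using nil_hom_fst[OF G(1,2), of v] nil_hom_central[OF G(3)] by (simp add: ab_map_def)
  then show ?thesis by auto
qed

lemma ab_map_in:
  assumes "a \<in> carrier (Zf V)" shows "ab_map h a \<in> carrier (Zf W)"
  using nil_hom_in[of "(a, \<lambda>_. 0)"] assms by (simp add: ab_map_def model_simps)

lemma ce_map_in:
  assumes "c \<in> carrier (Zf (nonedges V E))" shows "ce_map h c \<in> carrier (Zf (nonedges W F))"
  using nil_hom_in[of "(\<lambda>_. 0, c)"] assms by (simp add: ce_map_def model_simps)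

lemma ab_map_hom: "ab_map h \<in> hom (Zf V) (Zf W)"
proof (rule homI)
  fix a b assume ab: "a \<in> carrier (Zf V)" "b \<in> carrier (Zf V)"
  then have G: "(a, \<lambda>_. 0) \<in> carrier (model V E)" "(b, \<lambda>_. 0) \<in> carrier (model V E)"
    by (auto simp: model_simps)
  have G2: "(a, \<lambda>_. 0) \<otimes>\<^bsub>model V E\<^esub> (b, \<lambda>_. 0) \<in> carrier (model V E)"
    using G group.is_monoid[OF model_group] monoid.m_closed by metis
  from nil_hom_ab[OF G2] nil_hom_fst[OF G]
  show "ab_map h (a \<otimes>\<^bsub>Zf V\<^esub> b) = ab_map h a \<otimes>\<^bsub>Zf W\<^esub> ab_map h b"
    by (auto simp: model_simps ab_map_def fun_eq_iff)
qed (rule ab_map_in)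

lemma ce_map_hom: "ce_map h \<in> hom (Zf (nonedges V E)) (Zf (nonedges W F))"
proof (rule homI)
  fix a b assume ab: "a \<in> carrier (Zf (nonedges V E))" "b \<in> carrier (Zf (nonedges V E))"
  then have G: "(\<lambda>_. 0, a) \<in> carrier (model V E)" "(\<lambda>_. 0, b) \<in> carrier (model V E)"
    by (auto simp: model_simps)
  have "(\<lambda>_. 0, a \<otimes>\<^bsub>Zf (nonedges V E)\<^esub> b) = (\<lambda>_. 0, a) \<otimes>\<^bsub>model V E\<^esub> (\<lambda>_. 0, b)"
    by (simp add: model_simps)
  moreover have "fst (h (\<lambda>_. 0, a)) = (\<lambda>_. 0)" by (simp add: nil_hom_central[OF ab(1)])
  ultimately show "ce_map h (a \<otimes>\<^bsub>Zf (nonedges V E)\<^esub> b) = ce_map h a \<otimes>\<^bsub>Zf (nonedges W F)\<^esub> ce_map h b"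
    using hom_mult[OF h G] unfolding ce_map_def by (simp add: model_simps)
qed (rule ce_map_in)

text \<open>The injective half of the short five lemma.\<close>

lemma nil_hom_inj:
  assumes ab: "inj_on (ab_map h) (carrier (Zf V))" and ce: "inj_on (ce_map h) (carrier (Zf (nonedges V E)))"
  shows "inj_on h (carrier (model V E))"
proof -
  interpret group_hom "model V E" "model W F" h
    using h by (simp add: group_hom_def group_hom_axioms_def)
  show ?thesis
  proof (rule inj_on_one_iff[THEN iffD2], intro allI impI)
  fix g assume g: "g \<in> carrier (model V E)" "h g = \<one>\<^bsub>model W F\<^esub>"
  have z: "(\<lambda>_. 0) \<in> carrier (Zf V)" "(\<lambda>_. 0) \<in> carrier (Zf (nonedges V E))" by auto
  have g': "fst g \<in> carrier (Zf V)" "snd g \<in> carrier (Zf (nonedges V E))" using g(1) unfolding model_simps by blast+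
  have "ab_map h (fst g) = ab_map h (\<lambda>_. 0)"
    using nil_hom_ab[OF g(1)] g(2) hom_Zf_zero[OF ab_map_hom] by (simp add: model_simps)
  then have 1: "fst g = (\<lambda>_. 0)" using ab g'(1) z(1) by (meson inj_onD)
  then have "h (\<lambda>_. 0, snd g) = (\<lambda>_. 0, \<lambda>_. 0)" using g by (simp add: model_simps flip: 1)
  then have "ce_map h (snd g) = ce_map h (\<lambda>_. 0)" using hom_Zf_zero[OF ce_map_hom] by (simp add: ce_map_def)
  then have "snd g = (\<lambda>_. 0)" using ce g'(2) z(2) by (meson inj_onD)
  with 1 show "g = \<one>\<^bsub>model V E\<^esub>" by (simp add: model_simps prod_eq_iff)
  qed
qed

text \<open>The surjective half of the short five lemma: a preimage of the first component is
  corrected by a preimage, under \<open>ce_map h\<close>, of the remaining error in the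
  second.\<close>

lemma nil_hom_surj:
  assumes ab: "ab_map h ` carrier (Zf V) = carrier (Zf W)"
    and ce: "ce_map h ` carrier (Zf (nonedges V E)) = carrier (Zf (nonedges W F))"
  shows "h ` carrier (model V E) = carrier (model W F)"
proof
  show "carrier (model W F) \<subseteq> h ` carrier (model V E)"
  proof
    fix g assume g: "g \<in> carrier (model W F)"
    then have "fst g \<in> carrier (Zf W)" unfolding model_simps by blast
    then obtain a where a: "a \<in> carrier (Zf V)" "fst g = ab_map h a" using ab by blast
    have aG: "(a, \<lambda>_. 0) \<in> carrier (model V E)" using a by (simp add: model_simps)
    have "snd (h (a, \<lambda>_. 0)) \<in> carrier (Zf (nonedges W F))" "snd g \<in> carrier (Zf (nonedges W F))"
      using nil_hom_in[OF aG] g unfolding model_simps by blast+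
    then have "(\<lambda>p. snd g p - snd (h (a, \<lambda>_. 0)) p) \<in> carrier (Zf (nonedges W F))" by auto
    then have "(\<lambda>p. snd g p - snd (h (a, \<lambda>_. 0)) p) \<in> ce_map h ` carrier (Zf (nonedges V E))"
      by (simp only: ce)
    then obtain c where c: "c \<in> carrier (Zf (nonedges V E))" "(\<lambda>p. snd g p - snd (h (a, \<lambda>_. 0)) p) = ce_map h c"
      by (rule imageE)
    have cG: "(\<lambda>_. 0, c) \<in> carrier (model V E)" using c by (simp add: model_simps)
    have ac: "(a, \<lambda>_. 0) \<otimes>\<^bsub>model V E\<^esub> (\<lambda>_. 0, c) \<in> carrier (model V E)"
      using aG cG group.is_monoid[OF model_group] monoid.m_closed by metis
    have "h ((a, \<lambda>_. 0) \<otimes>\<^bsub>model V E\<^esub> (\<lambda>_. 0, c)) = g"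
      unfolding hom_mult[OF h aG cG] nil_hom_central[OF c(1)]
      using a(2) by (simp add: model_simps prod_eq_iff ab_map_def flip: c(2))
    then show "g \<in> h ` carrier (model V E)" using ac by blast
  qed
qed (use nil_hom_in in blast)

end

lemma reidemeister_nil:
  assumes fin: "finite V" and h: "h \<in> hom (model V E) (model V E)"
  shows "reidemeister (model V E) h
    = reidemeister (Zf (nonedges V E)) (ce_map h) * reidemeister (Zf V) (ab_map h)"
proof (rule reidemeister_central_extension[where i = "\<lambda>c. (\<lambda>_. 0, c)" and p = fst])
  show "(\<lambda>c. (\<lambda>_. 0, c)) \<in> hom (Zf (nonedges V E)) (model V E)"
    by (rule homI) (simp_all add: model_simps)
  show "fst \<in> hom (model V E) (Zf V)"
    by (rule homI) (simp_all add: model_simps)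
  show "fst ` carrier (model V E) = carrier (Zf V)"
  proof
    show "carrier (Zf V) \<subseteq> fst ` carrier (model V E)"
      by (rule subsetI, rule image_eqI[of _ _ "(x, \<lambda>_. 0)" for x]) (simp_all add: model_simps)
  qed (auto simp: model_simps)
  show "(fst g = \<one>\<^bsub>Zf V\<^esub>) = (g \<in> (\<lambda>c. (\<lambda>_. 0, c)) ` carrier (Zf (nonedges V E)))"
    if "g \<in> carrier (model V E)" for g
    using that by (cases g) (auto simp: model_simps)
  show "(\<lambda>_. 0, k) \<otimes>\<^bsub>model V E\<^esub> g = g \<otimes>\<^bsub>model V E\<^esub> (\<lambda>_. 0, k)" for k g
    by (simp add: model_simps add.commute)
  show "h (\<lambda>_. 0, k) = (\<lambda>_. 0, ce_map h k)" if "k \<in> carrier (Zf (nonedges V E))" for k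
    by (rule nil_hom_central[OF fin h that])
  show "fst (h g) = ab_map h (fst g)" if "g \<in> carrier (model V E)" for g
    by (rule nil_hom_ab[OF fin h that])
  show "q = \<one>\<^bsub>Zf V\<^esub>" if "reidemeister (Zf V) (ab_map h) \<noteq> \<infinity>" "q \<in> carrier (Zf V)" "ab_map h q = q" for q
    by (rule reidemeister_Zf_fixed[OF fin ab_map_hom[OF fin h] that])
qed (simp_all add: inj_on_def ab_map_hom[OF fin h] ce_map_hom[OF fin h] h)

lemma ab_map_comp:
  assumes "finite V" "g \<in> hom (model V E) (model V E)" "h \<in> hom (model V E) (model V E)" "a \<in> carrier (Zf V)"
  shows "ab_map g (ab_map h a) = ab_map (g \<circ> h) a"
proof -
  have "(a, \<lambda>_. 0) \<in> carrier (model V E)" using assms by (simp add: model_simps)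
  from nil_hom_ab[OF assms(1,2) nil_hom_in[OF assms(1,3) this]] show ?thesis by (simp add: ab_map_def)
qed

lemma ce_map_comp:
  assumes "finite V" "g \<in> hom (model V E) (model V E)" "h \<in> hom (model V E) (model V E)"
    "c \<in> carrier (Zf (nonedges V E))"
  shows "ce_map g (ce_map h c) = ce_map (g \<circ> h) c"
  using nil_hom_central[OF assms(1,3,4)] by (simp add: ce_map_def)

section \<open>Groups given by presentations\<close>

definition wclass :: "'g set \<Rightarrow> ('g \<times> bool) list set \<Rightarrow> ('g \<times> bool) list \<Rightarrow> ('g \<times> bool) list set" where
  "wclass S R w = pres_equiv S R `` {w}"

abbreviation "gwords S \<equiv> lists (S \<times> (UNIV :: bool set))"

lemma pres_rel_in: "pres_rel S R u v \<Longrightarrow> u \<in> gwords S \<and> v \<in> gwords S"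
  by (induction rule: pres_rel.induct) auto

lemma equiv_pres: "equiv (gwords S) (pres_equiv S R)"
  by (rule equivI)
    (auto simp: pres_equiv_def refl_on_def sym_def trans_def
      intro: pres_rel.refl pres_rel.sym dest: pres_rel_in pres_rel.trans)

lemma pres_equiv_iff: "(u, v) \<in> pres_equiv S R \<longleftrightarrow> pres_rel S R u v"
  by (simp add: pres_equiv_def)

lemma wclass_eq_iff: "u \<in> gwords S \<Longrightarrow> v \<in> gwords S \<Longrightarrow> wclass S R u = wclass S R v \<longleftrightarrow> pres_rel S R u v"
  unfolding wclass_def using eq_equiv_class_iff[OF equiv_pres, of u S v R] by (simp only: pres_equiv_iff)

lemma pres_rel_append_left:
  "pres_rel S R u v \<Longrightarrow> w \<in> gwords S \<Longrightarrow> pres_rel S R (w @ u) (w @ v)"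
proof (induction rule: pres_rel.induct)
  case (refl w')
  then have "w @ w' \<in> gwords S" by simp
  then show ?case by (rule pres_rel.refl)
next
  case (cancel u v x b)
  then show ?case using pres_rel.cancel[of "w @ u" S v x R b] by simp
next
  case (relator u v r)
  then show ?case using pres_rel.relator[of "w @ u" S v r R] by simp
qed (auto intro: pres_rel.sym pres_rel.trans)

lemma pres_rel_append_right:
  "pres_rel S R u v \<Longrightarrow> w \<in> gwords S \<Longrightarrow> pres_rel S R (u @ w) (v @ w)"
proof (induction rule: pres_rel.induct)
  case (refl w')
  then have "w' @ w \<in> gwords S" by simp
  then show ?case by (rule pres_rel.refl)
next
  case (cancel u v x b)
  then show ?case using pres_rel.cancel[of u S "v @ w" x R b] by simp
next
  case (relator u v r)
  then show ?case using pres_rel.relator[of u S "v @ w" r R] by simp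
qed (auto intro: pres_rel.sym pres_rel.trans)

lemma pres_carrier: "carrier (pres_group S R) = wclass S R ` gwords S"
  by (auto simp: pres_group_def quotient_def wclass_def)

lemma pres_one: "\<one>\<^bsub>pres_group S R\<^esub> = wclass S R []"
  by (simp add: pres_group_def wclass_def)

text \<open>Multiplication in \<open>pres_group\<close> goes through representatives chosen by
  \<open>SOME\<close>; knowing that the chosen word is equivalent to the given one makes the choice
  harmless.\<close>

lemma wclass_some:
  assumes "w \<in> gwords S"
  shows "pres_rel S R w (SOME a. a \<in> wclass S R w)"
proof -
  have "w \<in> wclass S R w" using assms by (auto simp: wclass_def pres_equiv_def intro: pres_rel.refl)
  then have "(SOME a. a \<in> wclass S R w) \<in> wclass S R w" by (rule someI)
  then show ?thesis by (simp add: wclass_def pres_equiv_def)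
qed

lemma pres_mult:
  assumes "u \<in> gwords S" "v \<in> gwords S"
  shows "wclass S R u \<otimes>\<^bsub>pres_group S R\<^esub> wclass S R v = wclass S R (u @ v)"
proof -
  let ?u = "SOME a. a \<in> wclass S R u" and ?v = "SOME a. a \<in> wclass S R v"
  have r: "pres_rel S R u ?u" "pres_rel S R v ?v" using wclass_some assms by blast+
  have "pres_rel S R (u @ v) (?u @ v)" "pres_rel S R (?u @ v) (?u @ ?v)"
    using pres_rel_append_right[OF r(1) assms(2)] pres_rel_append_left[OF r(2)] pres_rel_in[OF r(1)] by simp_all
  then have "pres_rel S R (u @ v) (?u @ ?v)" by (rule pres_rel.trans)
  then have "wclass S R (u @ v) = wclass S R (?u @ ?v)"
    using wclass_eq_iff[of "u @ v" S "?u @ ?v" R] pres_rel_in[of S R "u @ v" "?u @ ?v"] by blast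
  then show ?thesis by (simp add: pres_group_def wclass_def)
qed

lemma pres_group_group: "group (pres_group S R)"
proof (rule groupI)
  show "\<one>\<^bsub>pres_group S R\<^esub> \<in> carrier (pres_group S R)" by (auto simp: pres_one pres_carrier)
  fix x assume "x \<in> carrier (pres_group S R)"
  then obtain u where u: "u \<in> gwords S" "x = wclass S R u" by (auto simp: pres_carrier)
  show "\<one>\<^bsub>pres_group S R\<^esub> \<otimes>\<^bsub>pres_group S R\<^esub> x = x"
    using u by (simp add: pres_one pres_mult)
  have "\<exists>v\<in>gwords S. pres_rel S R (v @ u) []" using u(1)
  proof (induction u)
    case Nil
    then show ?case by (intro bexI[of _ "[]"]) (auto intro: pres_rel.refl)
  next
    case (Cons l u)
    then obtain v where v: "v \<in> gwords S" "pres_rel S R (v @ u) []" by auto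
    obtain y b where l: "l = (y, b)" "y \<in> S" using Cons by (cases l) auto
    let ?w = "v @ [(y, \<not> b)]"
    have "pres_rel S R (?w @ l # u) (v @ u)"
    proof -
      have "u \<in> gwords S" using Cons by blast
      from pres_rel.cancel[OF v(1) this l(2), of R "\<not> b"] show ?thesis using l(1) by simp
    qed
    then have "pres_rel S R (?w @ l # u) []" using v(2) by (rule pres_rel.trans)
    moreover have "?w \<in> gwords S" using v l by simp
    ultimately show ?case by blast
  qed
  then obtain v where v: "v \<in> gwords S" "pres_rel S R (v @ u) []" by blast
  then have "wclass S R v \<otimes>\<^bsub>pres_group S R\<^esub> x = \<one>\<^bsub>pres_group S R\<^esub>"
    using u wclass_eq_iff[of "v @ u" S "[]" R] by (simp add: pres_mult pres_one)
  then show "\<exists>y\<in>carrier (pres_group S R). y \<otimes>\<^bsub>pres_group S R\<^esub> x = \<one>\<^bsub>pres_group S R\<^esub>"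
    using v by (auto simp: pres_carrier)
next
  fix x y z assume "x \<in> carrier (pres_group S R)" "y \<in> carrier (pres_group S R)" "z \<in> carrier (pres_group S R)"
  then obtain u v w where "x = wclass S R u" "y = wclass S R v" "z = wclass S R w"
    and uvw: "u \<in> gwords S" "v \<in> gwords S" "w \<in> gwords S" unfolding pres_carrier by blast
  moreover from uvw have "u @ v \<in> gwords S" "v @ w \<in> gwords S" by simp_all
  ultimately show "x \<otimes>\<^bsub>pres_group S R\<^esub> y \<otimes>\<^bsub>pres_group S R\<^esub> z
      = x \<otimes>\<^bsub>pres_group S R\<^esub> (y \<otimes>\<^bsub>pres_group S R\<^esub> z)"
    by (simp only: pres_mult append_assoc)
next
  fix x y assume "x \<in> carrier (pres_group S R)" "y \<in> carrier (pres_group S R)"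
  then obtain u v where "x = wclass S R u" "y = wclass S R v"
    and uv: "u \<in> gwords S" "v \<in> gwords S" unfolding pres_carrier by blast
  moreover from uv have "u @ v \<in> gwords S" by simp
  ultimately show "x \<otimes>\<^bsub>pres_group S R\<^esub> y \<in> carrier (pres_group S R)"
    unfolding pres_carrier by (simp only: pres_mult) blast
qed

definition letter :: "'g set \<Rightarrow> ('g \<times> bool) list set \<Rightarrow> 'g \<Rightarrow> bool \<Rightarrow> ('g \<times> bool) list set" where
  "letter S R x b = wclass S R [(x, b)]"

lemma letter_in: "x \<in> S \<Longrightarrow> letter S R x b \<in> carrier (pres_group S R)"
  by (auto simp: letter_def pres_carrier)

lemma letter_inv:
  assumes "x \<in> S"
  shows "letter S R x False = inv\<^bsub>pres_group S R\<^esub> (letter S R x True)"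
proof -
  have "pres_rel S R [(x, False), (x, True)] []"
    using pres_rel.cancel[of "[]" S "[]" x R False] assms by simp
  then have "wclass S R [(x, False), (x, True)] = wclass S R []"
    using wclass_eq_iff[of _ S _ R] assms by simp
  then have "letter S R x False \<otimes>\<^bsub>pres_group S R\<^esub> letter S R x True = \<one>\<^bsub>pres_group S R\<^esub>"
    using assms by (simp add: letter_def pres_mult pres_one)
  from group.inv_equality[OF pres_group_group this letter_in[OF assms] letter_in[OF assms]]
  show ?thesis by simp
qed

lemma pres_group_induct [consumes 1, case_names one letter]:
  assumes "g \<in> carrier (pres_group S R)" "P \<one>\<^bsub>pres_group S R\<^esub>"
    and "\<And>x b g. x \<in> S \<Longrightarrow> g \<in> carrier (pres_group S R) \<Longrightarrow> P g \<Longrightarrow> P (letter S R x b \<otimes>\<^bsub>pres_group S R\<^esub> g)"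
  shows "P g"
proof -
  obtain w where "w \<in> gwords S" "g = wclass S R w" using assms(1) by (auto simp: pres_carrier)
  moreover have "w \<in> gwords S \<Longrightarrow> P (wclass S R w)" for w
  proof (induction w)
    case Nil
    then show ?case using assms(2) by (simp add: pres_one)
  next
    case (Cons l w)
    then obtain x b where l: "l = (x, b)" "x \<in> S" "w \<in> gwords S" by (cases l) auto
    have "letter S R x b \<otimes>\<^bsub>pres_group S R\<^esub> wclass S R w = wclass S R (l # w)"
      using l pres_mult[of "[l]" S w R] by (simp add: letter_def)
    moreover have "wclass S R w \<in> carrier (pres_group S R)" using l by (auto simp: pres_carrier)
    ultimately show ?case using assms(3)[OF l(2), of "wclass S R w" b] Cons l by auto
  qed
  ultimately show ?thesis by simp
qed

definition word_eval :: "('h, 'x) monoid_scheme \<Rightarrow> ('g \<Rightarrow> 'h) \<Rightarrow> ('g \<times> bool) list \<Rightarrow> 'h" where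
  "word_eval H f w = foldr (\<lambda>(x, b) h. (if b then f x else inv\<^bsub>H\<^esub> (f x)) \<otimes>\<^bsub>H\<^esub> h) w \<one>\<^bsub>H\<^esub>"

lemma word_eval_simps [simp]:
  "word_eval H f [] = \<one>\<^bsub>H\<^esub>"
  "word_eval H f ((x, b) # w) = (if b then f x else inv\<^bsub>H\<^esub> (f x)) \<otimes>\<^bsub>H\<^esub> word_eval H f w"
  by (simp_all add: word_eval_def)

context
  fixes H :: "('h, 'x) monoid_scheme" and S :: "'g set" and R f
  assumes H: "group H" and f: "\<And>x. x \<in> S \<Longrightarrow> f x \<in> carrier H"
    and R: "\<And>r. r \<in> R \<Longrightarrow> r \<in> gwords S \<Longrightarrow> word_eval H f r = \<one>\<^bsub>H\<^esub>"
begin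

interpretation H: group H by (rule H)

lemma word_eval_in: "w \<in> gwords S \<Longrightarrow> word_eval H f w \<in> carrier H"
  by (induction w) (auto simp: f)

lemma word_eval_append:
  "u \<in> gwords S \<Longrightarrow> v \<in> gwords S \<Longrightarrow> word_eval H f (u @ v) = word_eval H f u \<otimes>\<^bsub>H\<^esub> word_eval H f v"
proof (induction u)
  case (Cons l u)
  then show ?case by (cases l) (auto simp: f word_eval_in H.m_assoc)
qed (simp add: word_eval_in)

lemma word_eval_rel: "pres_rel S R u v \<Longrightarrow> word_eval H f u = word_eval H f v"
proof (induction rule: pres_rel.induct)
  case (cancel u v x b)
  then have "word_eval H f ([(x, b), (x, \<not> b)] @ v) = word_eval H f v"
    using f[of x] word_eval_in[of v] by (cases b) (simp_all flip: H.m_assoc)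
  then show ?case using cancel by (subst (1 2) word_eval_append) auto
next
  case (relator u v r)
  then show ?case by (simp add: word_eval_append word_eval_in R)
qed auto

text \<open>Von Dyck's theorem for \<open>pres_group\<close>.\<close>

lemma pres_hom_ex:
  "\<exists>h\<in>hom (pres_group S R) H. \<forall>x\<in>S. h (letter S R x True) = f x"
proof -
  define h where "h A = word_eval H f (SOME a. a \<in> A)" for A
  have h: "h (wclass S R w) = word_eval H f w" if "w \<in> gwords S" for w
    unfolding h_def using word_eval_rel[OF wclass_some[OF that]] by simp
  have "h \<in> hom (pres_group S R) H"
  proof (rule homI)
    fix x assume "x \<in> carrier (pres_group S R)"
    then obtain u where u: "u \<in> gwords S" "x = wclass S R u" unfolding pres_carrier by blast
    then show "h x \<in> carrier H" using word_eval_in[OF u(1)] h[OF u(1)] by simp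
    fix y assume "y \<in> carrier (pres_group S R)"
    then obtain v where v: "v \<in> gwords S" "y = wclass S R v" unfolding pres_carrier by blast
    have "u @ v \<in> gwords S" using u v by simp
    then show "h (x \<otimes>\<^bsub>pres_group S R\<^esub> y) = h x \<otimes>\<^bsub>H\<^esub> h y"
      unfolding u(2) v(2) pres_mult[OF u(1) v(1)] using word_eval_append[OF u(1) v(1)] u(1) v(1) by (simp only: h)
  qed
  moreover have "\<forall>x\<in>S. h (letter S R x True) = f x"
  proof
    fix x assume x: "x \<in> S"
    then have "[(x, True)] \<in> gwords S" by simp
    from h[OF this] show "h (letter S R x True) = f x" using f[OF x] by (simp add: letter_def)
  qed
  ultimately show ?thesis by blast
qed

end

section \<open>Powers and ordered products of powers\<close>

text \<open>Conjugation by \<open>a\<close> is a homomorphism sending \<open>b\<close> to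
  \<open>b \<otimes> z\<close>, so it sends a power of \<open>b\<close> to the same power of
  \<open>b \<otimes> z\<close>, which splits because \<open>z\<close> and \<open>b\<close>
  commute.\<close>

lemma (in group) conj_int_pow:
  assumes abz: "a \<in> carrier G" "b \<in> carrier G" "z \<in> carrier G"
    and eq: "a \<otimes> b = b \<otimes> a \<otimes> z" and central: "z \<otimes> a = a \<otimes> z" "z \<otimes> b = b \<otimes> z"
  shows "a \<otimes> b [^] (m::int) = b [^] m \<otimes> a \<otimes> z [^] m"
proof -
  let ?c = "\<lambda>g. a \<otimes> g \<otimes> inv a"
  have c: "?c \<in> hom G G"
    using abz by (intro homI) (simp_all add: m_assoc, simp flip: m_assoc)
  have "a \<otimes> b = b \<otimes> z \<otimes> a" using abz eq central by (simp add: m_assoc)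
  then have "?c b = b \<otimes> z" using abz by (simp add: inv_solve_right')
  then have "?c (b [^] m) = (b \<otimes> z) [^] m" using hom_int_pow[OF c abz(2) is_group is_group] by simp
  also have "\<dots> = b [^] m \<otimes> z [^] m" using abz central by (intro int_pow_mult_distrib) auto
  finally have "a \<otimes> b [^] m = b [^] m \<otimes> z [^] m \<otimes> a"
    using abz by (simp add: inv_solve_right')
  moreover have "z [^] m \<otimes> a = a \<otimes> z [^] m"
  proof -
    have "?c z = z" using abz central by (simp add: inv_solve_right')
    then have "?c (z [^] m) = z [^] m" using hom_int_pow[OF c abz(3) is_group is_group] by simp
    then show ?thesis using abz by (simp add: inv_solve_right')
  qed
  ultimately show ?thesis using abz by (simp add: m_assoc)
qed

text \<open>A homomorphism from the integers is determined by its value at \<open>1\<close>; this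
  computes powers in the model from an explicit formula.\<close>

lemma (in group) int_pow_unique:
  fixes f :: "int \<Rightarrow> 'a"
  assumes "\<And>k. f k \<in> carrier G" "\<And>i j. f (i + j) = f i \<otimes> f j"
  shows "f 1 [^] (k::int) = f k"
proof -
  have "f 0 = f 0 \<otimes> f 0" using assms(2)[of 0 0] by simp
  then have f0: "f 0 = \<one>" using assms(1) by simp
  show ?thesis
  proof (induction k rule: int_induct[where k = 0])
    case base
    show ?case by (simp add: f0)
  next
    case (step1 k)
    then show ?case using assms(1)[of 1] by (simp add: int_pow_mult assms(2))
  next
    case (step2 k)
    have "f (k - 1) \<otimes> f 1 = f k" using assms(2)[of "k - 1" 1] by simp
    then have "f (k - 1) = f k \<otimes> inv (f 1)" using assms(1) by (simp add: inv_solve_right)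
    then show ?case using step2 assms(1)[of 1] by (simp add: int_pow_diff)
  qed
qed

definition pow_list :: "('a, 'b) monoid_scheme \<Rightarrow> ('p \<Rightarrow> 'a) \<Rightarrow> 'p list \<Rightarrow> ('p \<Rightarrow> int) \<Rightarrow> 'a" where
  "pow_list G x ps a = foldr (\<lambda>p g. x p [^]\<^bsub>G\<^esub> a p \<otimes>\<^bsub>G\<^esub> g) ps \<one>\<^bsub>G\<^esub>"

lemma pow_list_simps [simp]:
  "pow_list G x [] a = \<one>\<^bsub>G\<^esub>"
  "pow_list G x (p # ps) a = x p [^]\<^bsub>G\<^esub> a p \<otimes>\<^bsub>G\<^esub> pow_list G x ps a"
  by (simp_all add: pow_list_def)

lemma pow_list_cong: "(\<And>p. p \<in> set ps \<Longrightarrow> a p = b p) \<Longrightarrow> pow_list G x ps a = pow_list G x ps b"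
  by (induction ps) auto

lemma (in group) pow_list_closed:
  "(\<And>p. p \<in> set ps \<Longrightarrow> x p \<in> carrier G) \<Longrightarrow> pow_list G x ps a \<in> carrier G"
  by (induction ps) auto

lemma (in group) pow_list_zero: "pow_list G x ps (\<lambda>_. 0) = \<one>"
  by (induction ps) auto

lemma (in group) pow_list_central_add:
  assumes "\<And>p. p \<in> set ps \<Longrightarrow> x p \<in> carrier G"
    and "\<And>p g. p \<in> set ps \<Longrightarrow> g \<in> carrier G \<Longrightarrow> x p \<otimes> g = g \<otimes> x p"
    and "distinct ps" "p \<in> set ps"
  shows "x p [^] (k::int) \<otimes> pow_list G x ps a = pow_list G x ps (a(p := a p + k))"
  using assms
proof (induction ps)
  case (Cons q ps)
  have xq: "x q \<in> carrier G" and xp: "x p \<in> carrier G" using Cons.prems by auto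
  have cl: "pow_list G x ps b \<in> carrier G" for b using Cons.prems by (intro pow_list_closed) auto
  show ?case
  proof (cases "p = q")
    case True
    then have "pow_list G x ps (a(p := a p + k)) = pow_list G x ps a"
      using Cons.prems by (intro pow_list_cong) auto
    moreover have "x q [^] (a q + k) = x q [^] k \<otimes> x q [^] a q" using xq by (simp add: int_pow_mult add.commute)
    moreover have "x p [^] k \<otimes> pow_list G x (q # ps) a = x q [^] k \<otimes> x q [^] a q \<otimes> pow_list G x ps a"
      using True xq cl by (simp add: m_assoc)
    ultimately show ?thesis using True by (simp only: pow_list_simps fun_upd_same)
  next
    case False
    have "x p [^] k \<otimes> pow_list G x ps a = pow_list G x ps (a(p := a p + k))"
      using False Cons.prems by (intro Cons.IH) auto
    moreover have "x p [^] k \<otimes> x q [^] a q = x q [^] a q \<otimes> x p [^] k"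
    proof -
      have "x q [^] a q \<otimes> x p = x p \<otimes> x q [^] a q"
        using Cons.prems(2)[OF Cons.prems(4), of "x q [^] a q"] xq by simp
      then have "x q [^] a q \<otimes> x p [^] k = x p [^] k \<otimes> x q [^] a q \<otimes> \<one> [^] k"
        using xp xq by (intro conj_int_pow) auto
      then show ?thesis using xp xq by simp
    qed
    moreover have "x p [^] k \<otimes> pow_list G x (q # ps) a = x p [^] k \<otimes> x q [^] a q \<otimes> pow_list G x ps a"
      using xp xq cl by (simp add: m_assoc)
    moreover have "x q [^] a q \<otimes> x p [^] k \<otimes> pow_list G x ps a = x q [^] a q \<otimes> (x p [^] k \<otimes> pow_list G x ps a)"
      using xp xq cl by (simp add: m_assoc)
    moreover have "(a(p := a p + k)) q = a q" using False by simp
    ultimately show ?thesis by (simp only: pow_list_simps)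
  qed
qed simp

section \<open>The presentation and the model agree\<close>

context
  fixes V :: "'v::linorder set" and E :: "'v \<Rightarrow> 'v \<Rightarrow> bool"
  assumes fin: "finite V" and symE: "\<And>u v. E u v \<longleftrightarrow> E v u"
begin

abbreviation (input) "GG \<equiv> graph_group V E"
abbreviation (input) "NN \<equiv> model V E"
abbreviation (input) "gl \<equiv> letter (gg_gens V E) (gg_rels V E)"

definition xgen :: "'v \<Rightarrow> ('v gen \<times> bool) list set" where
  "xgen v = letter (gg_gens V E) (gg_rels V E) (GX v) True"

definition ygen :: "'v \<times> 'v \<Rightarrow> ('v gen \<times> bool) list set" where
  "ygen p = letter (gg_gens V E) (gg_rels V E) (GY (fst p) (snd p)) True"

lemma GX_in: "v \<in> V \<Longrightarrow> GX v \<in> gg_gens V E"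
  by (auto simp: gg_gens_def)

lemma GY_in: "p \<in> nonedges V E \<Longrightarrow> GY (fst p) (snd p) \<in> gg_gens V E"
  by (auto simp: gg_gens_def nonedges_def)

lemma gg_gensE:
  assumes "x \<in> gg_gens V E"
  obtains v where "v \<in> V" "x = GX v" | p where "p \<in> nonedges V E" "x = GY (fst p) (snd p)"
  using assms that(2)[of "(i, j)" for i j] by (auto simp: gg_gens_def nonedges_def)

lemma gg_rels_words: "r \<in> gg_rels V E \<Longrightarrow> r \<in> gwords (gg_gens V E)"
  by (auto simp: gg_rels_def comm_word_def gg_gens_def)

interpretation G: group "graph_group V E"
  unfolding graph_group_def by (rule pres_group_group)

interpretation N: group "model V E" by simp

lemma xgen_in: "v \<in> V \<Longrightarrow> xgen v \<in> carrier GG"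
  unfolding xgen_def graph_group_def by (intro letter_in GX_in)

lemma ygen_in: "p \<in> nonedges V E \<Longrightarrow> ygen p \<in> carrier GG"
  unfolding ygen_def graph_group_def by (intro letter_in GY_in)

text \<open>Evaluating a word at the letters themselves yields its own class, so every relator turns
  into an equation in the group.\<close>

lemma rel_letters:
  assumes "r \<in> gg_rels V E"
  shows "word_eval GG (\<lambda>x. gl x True) r = \<one>\<^bsub>GG\<^esub>"
proof -
  let ?S = "gg_gens V E" and ?R = "gg_rels V E"
  have ev: "word_eval GG (\<lambda>x. gl x True) w = wclass ?S ?R w" if "w \<in> gwords ?S" for w
    using that
  proof (induction w)
    case Nil
    then show ?case by (simp add: graph_group_def pres_one)
  next
    case (Cons l w)
    obtain x b where l: "l = (x, b)" by (cases l)
    have x: "x \<in> ?S" and w: "w \<in> gwords ?S" using Cons l by auto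
    have A: "(if b then gl x True else inv\<^bsub>GG\<^esub> (gl x True)) = wclass ?S ?R [(x, b)]"
      using letter_inv[OF x, of ?R] by (simp add: letter_def graph_group_def)
    have xb: "[(x, b)] \<in> gwords ?S" using x by simp
    have "word_eval GG (\<lambda>x. gl x True) (l # w) = wclass ?S ?R [(x, b)] \<otimes>\<^bsub>GG\<^esub> wclass ?S ?R w"
      by (simp only: l word_eval_simps A Cons.IH)
    then show ?case using pres_mult[OF xb w, of ?R] l by (simp add: graph_group_def)
  qed
  have rw: "r \<in> gwords ?S" using gg_rels_words[OF assms] .
  have "pres_rel ?S ?R r []" using pres_rel.relator[of "[]" ?S "[]" r ?R] assms rw by simp
  then have "wclass ?S ?R r = wclass ?S ?R []" using wclass_eq_iff[OF rw, of "[]" ?R] by simp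
  then show ?thesis using ev[OF rw] by (simp add: graph_group_def pres_one)
qed

text \<open>The left side is the value of \<open>comm_word\<close> followed by one more factor
  \<open>z\<close>. Commutation relators use \<open>z = 1\<close>; the relators defining the
  \<open>y\<close> generators use the inverse of a \<open>y\<close>.\<close>

lemma comm_solve:
  assumes "group H" "a \<in> carrier H" "b \<in> carrier H" "z \<in> carrier H"
  shows "inv\<^bsub>H\<^esub> a \<otimes>\<^bsub>H\<^esub> (inv\<^bsub>H\<^esub> b \<otimes>\<^bsub>H\<^esub> (a \<otimes>\<^bsub>H\<^esub> (b \<otimes>\<^bsub>H\<^esub> z))) = \<one>\<^bsub>H\<^esub> \<longleftrightarrow> a \<otimes>\<^bsub>H\<^esub> b \<otimes>\<^bsub>H\<^esub> z = b \<otimes>\<^bsub>H\<^esub> a"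
proof -
  interpret group H by fact
  have "inv\<^bsub>H\<^esub> a \<otimes>\<^bsub>H\<^esub> (inv\<^bsub>H\<^esub> b \<otimes>\<^bsub>H\<^esub> (a \<otimes>\<^bsub>H\<^esub> (b \<otimes>\<^bsub>H\<^esub> z))) = inv\<^bsub>H\<^esub> (b \<otimes>\<^bsub>H\<^esub> a) \<otimes>\<^bsub>H\<^esub> (a \<otimes>\<^bsub>H\<^esub> b \<otimes>\<^bsub>H\<^esub> z)"
    using assms by (simp add: inv_mult_group m_assoc)
  then show ?thesis using assms by (simp add: inv_solve_left')
qed

lemma xgen_edge:
  assumes "i \<in> V" "j \<in> V" "E i j"
  shows "xgen j \<otimes>\<^bsub>GG\<^esub> xgen i = xgen i \<otimes>\<^bsub>GG\<^esub> xgen j"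
proof -
  have *: "xgen j \<otimes>\<^bsub>GG\<^esub> xgen i = xgen i \<otimes>\<^bsub>GG\<^esub> xgen j" if "i \<in> V" "j \<in> V" "E i j" "i < j" for i j
  proof -
    have "comm_word (GX j) (GX i) \<in> gg_rels V E" using that by (auto simp: gg_rels_def)
    from rel_letters[OF this] show ?thesis
      using comm_solve[OF G.is_group xgen_in[OF that(2)] xgen_in[OF that(1)] G.one_closed] xgen_in that
      by (simp add: comm_word_def xgen_def)
  qed
  have "i < j \<or> j < i \<or> i = j" by auto
  then show ?thesis using *[of i j] *[of j i] assms symE by auto
qed

lemma xgen_nonedge:
  assumes "(i, j) \<in> nonedges V E"
  shows "xgen j \<otimes>\<^bsub>GG\<^esub> xgen i = xgen i \<otimes>\<^bsub>GG\<^esub> xgen j \<otimes>\<^bsub>GG\<^esub> ygen (i, j)"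
proof -
  have ij: "i \<in> V" "j \<in> V" "i < j" "\<not> E i j" using assms by (auto simp: nonedges_def)
  then have "comm_word (GX j) (GX i) @ [(GY i j, False)] \<in> gg_rels V E" unfolding gg_rels_def by blast
  from rel_letters[OF this]
  have "xgen j \<otimes>\<^bsub>GG\<^esub> xgen i \<otimes>\<^bsub>GG\<^esub> inv\<^bsub>GG\<^esub> (ygen (i, j)) = xgen i \<otimes>\<^bsub>GG\<^esub> xgen j"
    using comm_solve[OF G.is_group xgen_in[OF ij(2)] xgen_in[OF ij(1)] G.inv_closed[OF ygen_in[OF assms]]] xgen_in ij ygen_in[OF assms]
    by (simp add: comm_word_def xgen_def ygen_def)
  then show ?thesis using xgen_in ij ygen_in[OF assms] by (simp add: G.inv_solve_right')
qed

lemma xgen_ygen: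
  assumes "v \<in> V" "p \<in> nonedges V E"
  shows "ygen p \<otimes>\<^bsub>GG\<^esub> xgen v = xgen v \<otimes>\<^bsub>GG\<^esub> ygen p"
proof -
  have "comm_word (GX v) (GY (fst p) (snd p)) \<in> gg_rels V E"
    using assms unfolding gg_rels_def nonedges_def by (cases p) auto
  from rel_letters[OF this] show ?thesis
    using comm_solve[OF G.is_group xgen_in[OF assms(1)] ygen_in[OF assms(2)] G.one_closed] xgen_in ygen_in assms
    by (simp add: comm_word_def xgen_def ygen_def)
qed

lemma commute_mult:
  assumes "x \<otimes>\<^bsub>GG\<^esub> a = a \<otimes>\<^bsub>GG\<^esub> x" "x \<otimes>\<^bsub>GG\<^esub> b = b \<otimes>\<^bsub>GG\<^esub> x" "x \<in> carrier GG" "a \<in> carrier GG" "b \<in> carrier GG"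
  shows "x \<otimes>\<^bsub>GG\<^esub> (a \<otimes>\<^bsub>GG\<^esub> b) = (a \<otimes>\<^bsub>GG\<^esub> b) \<otimes>\<^bsub>GG\<^esub> x"
proof -
  have "x \<otimes>\<^bsub>GG\<^esub> (a \<otimes>\<^bsub>GG\<^esub> b) = (a \<otimes>\<^bsub>GG\<^esub> x) \<otimes>\<^bsub>GG\<^esub> b"
    using assms by (simp flip: G.m_assoc)
  also have "\<dots> = a \<otimes>\<^bsub>GG\<^esub> (b \<otimes>\<^bsub>GG\<^esub> x)" using assms by (simp add: G.m_assoc)
  finally show ?thesis using assms by (simp add: G.m_assoc)
qed

lemma commute_inv:
  assumes "x \<otimes>\<^bsub>GG\<^esub> a = a \<otimes>\<^bsub>GG\<^esub> x" "x \<in> carrier GG" "a \<in> carrier GG"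
  shows "x \<otimes>\<^bsub>GG\<^esub> inv\<^bsub>GG\<^esub> a = inv\<^bsub>GG\<^esub> a \<otimes>\<^bsub>GG\<^esub> x"
proof -
  have "x = a \<otimes>\<^bsub>GG\<^esub> x \<otimes>\<^bsub>GG\<^esub> inv\<^bsub>GG\<^esub> a" using assms by (simp add: G.inv_solve_right)
  then have "x = a \<otimes>\<^bsub>GG\<^esub> (x \<otimes>\<^bsub>GG\<^esub> inv\<^bsub>GG\<^esub> a)" using assms by (simp add: G.m_assoc)
  then have "inv\<^bsub>GG\<^esub> a \<otimes>\<^bsub>GG\<^esub> x = x \<otimes>\<^bsub>GG\<^esub> inv\<^bsub>GG\<^esub> a"
    using assms by (subst G.inv_solve_left') auto
  then show ?thesis by simp
qed

text \<open>The relators only let the \<open>y\<close> generators commute with the \<open>x\<close>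
  generators. They commute with each other because each of them is itself a product of
  \<open>x\<close> generators and their inverses.\<close>

lemma ygen_ygen:
  assumes p: "p \<in> nonedges V E" and q: "q \<in> nonedges V E"
  shows "ygen p \<otimes>\<^bsub>GG\<^esub> ygen q = ygen q \<otimes>\<^bsub>GG\<^esub> ygen p"
proof -
  obtain i j where ij: "q = (i, j)" by (cases q)
  then have V: "i \<in> V" "j \<in> V" using q by (auto simp: nonedges_def)
  note c = xgen_in[OF V(1)] xgen_in[OF V(2)] ygen_in[OF p] ygen_in[OF q]
  have m: "xgen j \<otimes>\<^bsub>GG\<^esub> xgen i \<in> carrier GG" "xgen i \<otimes>\<^bsub>GG\<^esub> xgen j \<in> carrier GG" using c by auto
  have "ygen q = inv\<^bsub>GG\<^esub> (xgen i \<otimes>\<^bsub>GG\<^esub> xgen j) \<otimes>\<^bsub>GG\<^esub> (xgen j \<otimes>\<^bsub>GG\<^esub> xgen i)"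
    using xgen_nonedge[of i j] q c m unfolding ij by (subst G.inv_solve_left) auto
  moreover have "ygen p \<otimes>\<^bsub>GG\<^esub> (inv\<^bsub>GG\<^esub> (xgen i \<otimes>\<^bsub>GG\<^esub> xgen j) \<otimes>\<^bsub>GG\<^esub> (xgen j \<otimes>\<^bsub>GG\<^esub> xgen i))
      = inv\<^bsub>GG\<^esub> (xgen i \<otimes>\<^bsub>GG\<^esub> xgen j) \<otimes>\<^bsub>GG\<^esub> (xgen j \<otimes>\<^bsub>GG\<^esub> xgen i) \<otimes>\<^bsub>GG\<^esub> ygen p"
    by (rule commute_mult[OF commute_inv[OF commute_mult[OF xgen_ygen[OF V(1) p] xgen_ygen[OF V(2) p] c(3,1,2)] c(3) m(2)]
        commute_mult[OF xgen_ygen[OF V(2) p] xgen_ygen[OF V(1) p] c(3,2,1)] c(3) G.inv_closed[OF m(2)] m(1)])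
  ultimately show ?thesis by simp
qed

lemma gl_cases:
  assumes "x \<in> gg_gens V E"
  obtains v where "v \<in> V" "gl x b = xgen v [^]\<^bsub>GG\<^esub> (if b then 1 else - 1 :: int)"
    | p where "p \<in> nonedges V E" "gl x b = ygen p [^]\<^bsub>GG\<^esub> (if b then 1 else - 1 :: int)"
proof -
  have eq: "gl x b = gl x True [^]\<^bsub>GG\<^esub> (if b then 1 else - 1 :: int)"
    using letter_inv[OF assms, of "gg_rels V E"] letter_in[OF assms, of "gg_rels V E" True]
    by (cases b) (simp_all add: G.int_pow_neg flip: graph_group_def)
  show thesis using assms
    by (cases rule: gg_gensE) (use that eq in \<open>auto simp: xgen_def ygen_def\<close>)
qed

lemma ygen_central:
  assumes p: "p \<in> nonedges V E" and g: "g \<in> carrier GG"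
  shows "ygen p \<otimes>\<^bsub>GG\<^esub> g = g \<otimes>\<^bsub>GG\<^esub> ygen p"
  using g unfolding graph_group_def
proof (induction g rule: pres_group_induct)
  case one
  then show ?case using ygen_in[OF p] by (simp flip: graph_group_def)
next
  case (letter x b g)
  have "ygen p \<otimes>\<^bsub>GG\<^esub> gl x b = gl x b \<otimes>\<^bsub>GG\<^esub> ygen p" using letter(1)
  proof (cases rule: gl_cases[where b = b])
    case (1 v)
    then show ?thesis using xgen_ygen[OF 1(1) p] xgen_in[OF 1(1)] ygen_in[OF p] commute_inv
      by (auto simp: G.int_pow_neg)
  next
    case (2 q)
    then show ?thesis using ygen_ygen[OF p 2(1)] ygen_in[OF 2(1)] ygen_in[OF p] commute_inv
      by (auto simp: G.int_pow_neg)
  qed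
  then show ?case
    using letter commute_mult[of "ygen p" "gl x b" g] ygen_in[OF p] letter_in[OF letter(1), of "gg_rels V E" b]
    by (simp flip: graph_group_def)
qed

lemma xgen_xgen:
  assumes "u \<in> V" "v \<in> V"
  obtains p k where "p \<in> nonedges V E"
      "xgen u \<otimes>\<^bsub>GG\<^esub> xgen v = xgen v \<otimes>\<^bsub>GG\<^esub> xgen u \<otimes>\<^bsub>GG\<^esub> ygen p [^]\<^bsub>GG\<^esub> (k::int)"
    | "xgen u \<otimes>\<^bsub>GG\<^esub> xgen v = xgen v \<otimes>\<^bsub>GG\<^esub> xgen u"
proof -
  consider "u = v" | "E u v" | "(v, u) \<in> nonedges V E" | "(u, v) \<in> nonedges V E"
    using assms symE[of u v] by (cases u v rule: linorder_cases) (auto simp: nonedges_def)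
  then show thesis
  proof cases
    case 2
    then show thesis using that(2) xgen_edge[OF assms(2,1)] symE by blast
  next
    case 3
    then show thesis using that(1)[OF 3, of 1] xgen_nonedge[OF 3] ygen_in[OF 3] by simp
  next
    case 4
    have c: "xgen v \<otimes>\<^bsub>GG\<^esub> xgen u \<in> carrier GG" "xgen u \<otimes>\<^bsub>GG\<^esub> xgen v \<in> carrier GG" using xgen_in assms by auto
    have "xgen u \<otimes>\<^bsub>GG\<^esub> xgen v = xgen v \<otimes>\<^bsub>GG\<^esub> xgen u \<otimes>\<^bsub>GG\<^esub> inv\<^bsub>GG\<^esub> (ygen (u, v))"
      using xgen_nonedge[OF 4] c ygen_in[OF 4] by (subst G.inv_solve_right) auto
    then show thesis using that(1)[OF 4, of "- 1"] ygen_in[OF 4] by (simp add: G.int_pow_neg)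
  qed (use that in simp)
qed

section \<open>Collection into normal form\<close>

text \<open>The factors at vertices do not commute and are listed in the order of \<open>V\<close>.
  The factors at non-edges are central, so any enumeration serves for \<open>nlist\<close>.\<close>

definition vlist :: "'v list" where "vlist = sorted_list_of_set V"
definition nlist :: "('v \<times> 'v) list" where "nlist = (SOME l. set l = nonedges V E \<and> distinct l)"

lemma nlist: "set nlist = nonedges V E" "distinct nlist"
  using someI_ex[OF finite_distinct_list[OF finite_nonedges[OF fin, of E]]] by (auto simp: nlist_def)

lemma gY_in: "pow_list GG ygen nlist c \<in> carrier GG"
  by (rule G.pow_list_closed) (simp add: nlist ygen_in)

lemma gY_add:
  "p \<in> nonedges V E \<Longrightarrow> ygen p [^]\<^bsub>GG\<^esub> (k::int) \<otimes>\<^bsub>GG\<^esub> pow_list GG ygen nlist c = pow_list GG ygen nlist (c(p := c p + k))"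
  by (rule G.pow_list_central_add) (simp_all add: nlist ygen_in ygen_central)

lemma ygen_pow_central:
  assumes p: "p \<in> nonedges V E" and g: "g \<in> carrier GG"
  shows "ygen p [^]\<^bsub>GG\<^esub> (k::int) \<otimes>\<^bsub>GG\<^esub> g = g \<otimes>\<^bsub>GG\<^esub> ygen p [^]\<^bsub>GG\<^esub> k"
proof -
  have "g \<otimes>\<^bsub>GG\<^esub> ygen p [^]\<^bsub>GG\<^esub> k = ygen p [^]\<^bsub>GG\<^esub> k \<otimes>\<^bsub>GG\<^esub> g \<otimes>\<^bsub>GG\<^esub> \<one>\<^bsub>GG\<^esub> [^]\<^bsub>GG\<^esub> k"
    using ygen_central[OF p g] ygen_in[OF p] g by (intro G.conj_int_pow) auto
  then show ?thesis using ygen_in[OF p] g by simp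
qed

text \<open>One step of the collection process: a letter moves right past the powers of other
  generators until it meets its own, each exchange leaving a central power of a \<open>y\<close>
  that joins the tail. The tail changes on the way, so \<open>c\<close> is arbitrary in the
  induction. Only existence of the new exponents is claimed.\<close>

lemma xgen_push:
  assumes "distinct l" "set l \<subseteq> V" "v \<in> set l" "e = 1 \<or> e = - 1"
  shows "\<exists>a' c'. xgen v [^]\<^bsub>GG\<^esub> (e::int) \<otimes>\<^bsub>GG\<^esub> (pow_list GG xgen l a \<otimes>\<^bsub>GG\<^esub> pow_list GG ygen nlist c)
    = pow_list GG xgen l a' \<otimes>\<^bsub>GG\<^esub> pow_list GG ygen nlist c'"
  using assms
proof (induction l arbitrary: c)
  case (Cons u l)
  let ?Y = "pow_list GG ygen nlist"
  have V: "u \<in> V" "v \<in> V" using Cons.prems by auto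
  have cl: "pow_list GG xgen l b \<in> carrier GG" for b using Cons.prems xgen_in by (intro G.pow_list_closed) auto
  note c = xgen_in[OF V(1)] xgen_in[OF V(2)] cl gY_in
  show ?case
  proof (cases "v = u")
    case True
    define a' where "a' = a(u := e + a u)"
    have "pow_list GG xgen l a' = pow_list GG xgen l a" using Cons.prems by (intro pow_list_cong) (auto simp: a'_def)
    moreover have "xgen u [^]\<^bsub>GG\<^esub> a' u = xgen u [^]\<^bsub>GG\<^esub> e \<otimes>\<^bsub>GG\<^esub> xgen u [^]\<^bsub>GG\<^esub> a u"
      using c by (simp add: G.int_pow_mult a'_def)
    ultimately have "xgen v [^]\<^bsub>GG\<^esub> e \<otimes>\<^bsub>GG\<^esub> (pow_list GG xgen (u # l) a \<otimes>\<^bsub>GG\<^esub> ?Y c)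
        = pow_list GG xgen (u # l) a' \<otimes>\<^bsub>GG\<^esub> ?Y c"
      using c True by (simp add: G.m_assoc)
    then show ?thesis by blast
  next
    case False
    then have vset: "v \<in> set l" using Cons.prems by auto
    \<comment> \<open>The central factor \<open>z\<close> treats commuting and non-commuting pairs
      uniformly, in either order of the two vertices.\<close>
    have "\<exists>z. (z = \<one>\<^bsub>GG\<^esub> \<or> (\<exists>p\<in>nonedges V E. \<exists>k::int. z = ygen p [^]\<^bsub>GG\<^esub> k)) \<and>
        xgen u \<otimes>\<^bsub>GG\<^esub> xgen v = xgen v \<otimes>\<^bsub>GG\<^esub> xgen u \<otimes>\<^bsub>GG\<^esub> z"
      using V
      by (cases rule: xgen_xgen) (use c xgen_in V in auto)
    then obtain z where z: "z = \<one>\<^bsub>GG\<^esub> \<or> (\<exists>p\<in>nonedges V E. \<exists>k::int. z = ygen p [^]\<^bsub>GG\<^esub> k)"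
      "xgen u \<otimes>\<^bsub>GG\<^esub> xgen v = xgen v \<otimes>\<^bsub>GG\<^esub> xgen u \<otimes>\<^bsub>GG\<^esub> z" by blast
    have zG: "z \<in> carrier GG" using z(1) ygen_in by auto
    have zc: "z \<otimes>\<^bsub>GG\<^esub> g = g \<otimes>\<^bsub>GG\<^esub> z" if "g \<in> carrier GG" for g
      using z(1) ygen_pow_central that by auto
    have zpow: "\<exists>c'. z [^]\<^bsub>GG\<^esub> k \<otimes>\<^bsub>GG\<^esub> ?Y c = ?Y c'" for k :: int and c
      using z(1)
    proof (elim disjE bexE exE)
      assume "z = \<one>\<^bsub>GG\<^esub>"
      then have "z [^]\<^bsub>GG\<^esub> k \<otimes>\<^bsub>GG\<^esub> ?Y c = ?Y c" using gY_in by simp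
      then show ?thesis by blast
    next
      fix p k' assume p: "p \<in> nonedges V E" "z = ygen p [^]\<^bsub>GG\<^esub> (k' :: int)"
      then have "z [^]\<^bsub>GG\<^esub> k = ygen p [^]\<^bsub>GG\<^esub> (k' * k)" using ygen_in by (simp add: G.int_pow_pow)
      then show ?thesis using gY_add[OF p(1)] by metis
    qed
    have zpc: "z [^]\<^bsub>GG\<^esub> k \<otimes>\<^bsub>GG\<^esub> g = g \<otimes>\<^bsub>GG\<^esub> z [^]\<^bsub>GG\<^esub> k" if "g \<in> carrier GG" for g and k :: int
      using G.conj_int_pow[of g z "\<one>\<^bsub>GG\<^esub>" k] zc[OF that] zG that by simp
    have "xgen u \<otimes>\<^bsub>GG\<^esub> xgen v [^]\<^bsub>GG\<^esub> e = xgen v [^]\<^bsub>GG\<^esub> e \<otimes>\<^bsub>GG\<^esub> xgen u \<otimes>\<^bsub>GG\<^esub> z [^]\<^bsub>GG\<^esub> e"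
      using c zG zc z(2) by (intro G.conj_int_pow) auto
    then have "xgen v [^]\<^bsub>GG\<^esub> e \<otimes>\<^bsub>GG\<^esub> xgen u = xgen u \<otimes>\<^bsub>GG\<^esub> xgen v [^]\<^bsub>GG\<^esub> e \<otimes>\<^bsub>GG\<^esub> z [^]\<^bsub>GG\<^esub> (- e)"
      using c zG by (simp add: G.int_pow_neg G.m_assoc)
    \<comment> \<open>\<open>conj_int_pow\<close> moves a single factor past a power, so it is
      applied twice: above, \<open>xgen u\<close> past the power \<open>e\<close> of
      \<open>xgen v\<close>; here, that power past the whole power \<open>a u\<close> of
      \<open>xgen u\<close>.\<close>
    then have "xgen v [^]\<^bsub>GG\<^esub> e \<otimes>\<^bsub>GG\<^esub> xgen u [^]\<^bsub>GG\<^esub> a u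
        = xgen u [^]\<^bsub>GG\<^esub> a u \<otimes>\<^bsub>GG\<^esub> xgen v [^]\<^bsub>GG\<^esub> e \<otimes>\<^bsub>GG\<^esub> (z [^]\<^bsub>GG\<^esub> (- e)) [^]\<^bsub>GG\<^esub> a u"
      using c zG zpc by (intro G.conj_int_pow) auto
    then have push: "xgen v [^]\<^bsub>GG\<^esub> e \<otimes>\<^bsub>GG\<^esub> xgen u [^]\<^bsub>GG\<^esub> a u
        = xgen u [^]\<^bsub>GG\<^esub> a u \<otimes>\<^bsub>GG\<^esub> xgen v [^]\<^bsub>GG\<^esub> e \<otimes>\<^bsub>GG\<^esub> z [^]\<^bsub>GG\<^esub> (- e * a u)"
      using zG by (simp add: G.int_pow_pow)
    let ?z = "z [^]\<^bsub>GG\<^esub> (- e * a u)"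
    have zz: "?z \<in> carrier GG" using zG by simp
    obtain c1 where c1: "?z \<otimes>\<^bsub>GG\<^esub> ?Y c = ?Y c1" using zpow by blast
    obtain a' c' where IH: "xgen v [^]\<^bsub>GG\<^esub> e \<otimes>\<^bsub>GG\<^esub> (pow_list GG xgen l a \<otimes>\<^bsub>GG\<^esub> ?Y c1)
        = pow_list GG xgen l a' \<otimes>\<^bsub>GG\<^esub> ?Y c'" using Cons.IH[of c1] Cons.prems vset by auto
    \<comment> \<open>The induction hypothesis says nothing about \<open>a'\<close> at
      \<open>u\<close>, which does not occur in \<open>l\<close>, so the exponent there is reset to
      \<open>a u\<close>.\<close>
    define a'' where "a'' = a'(u := a u)"
    have a'': "pow_list GG xgen l a'' = pow_list GG xgen l a'" "a'' u = a u"
      using Cons.prems by (auto simp: a''_def intro!: pow_list_cong)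
    have "xgen v [^]\<^bsub>GG\<^esub> e \<otimes>\<^bsub>GG\<^esub> (pow_list GG xgen (u # l) a \<otimes>\<^bsub>GG\<^esub> ?Y c)
        = (xgen v [^]\<^bsub>GG\<^esub> e \<otimes>\<^bsub>GG\<^esub> xgen u [^]\<^bsub>GG\<^esub> a u) \<otimes>\<^bsub>GG\<^esub> (pow_list GG xgen l a \<otimes>\<^bsub>GG\<^esub> ?Y c)"
      using c by (simp add: G.m_assoc)
    also have "\<dots> = xgen u [^]\<^bsub>GG\<^esub> a u \<otimes>\<^bsub>GG\<^esub> (xgen v [^]\<^bsub>GG\<^esub> e \<otimes>\<^bsub>GG\<^esub> ((?z \<otimes>\<^bsub>GG\<^esub> pow_list GG xgen l a) \<otimes>\<^bsub>GG\<^esub> ?Y c))"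
      unfolding push using c zz by (simp add: G.m_assoc)
    also have "(?z \<otimes>\<^bsub>GG\<^esub> pow_list GG xgen l a) \<otimes>\<^bsub>GG\<^esub> ?Y c = pow_list GG xgen l a \<otimes>\<^bsub>GG\<^esub> ?Y c1"
      unfolding zpc[OF cl] c1[symmetric] using c zz by (simp add: G.m_assoc)
    also note IH
    also have "xgen u [^]\<^bsub>GG\<^esub> a u \<otimes>\<^bsub>GG\<^esub> (pow_list GG xgen l a' \<otimes>\<^bsub>GG\<^esub> ?Y c') = pow_list GG xgen (u # l) a'' \<otimes>\<^bsub>GG\<^esub> ?Y c'"
      using c a'' by (simp add: G.m_assoc)
    finally show ?thesis by blast
  qed
qed simp

lemma vlist: "set vlist = V" "distinct vlist" "sorted_wrt (<) vlist"
  using fin by (auto simp: vlist_def)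

lemma gX_in: "pow_list GG xgen vlist a \<in> carrier GG"
  by (rule G.pow_list_closed) (simp add: vlist xgen_in)

text \<open>Existence is enough: uniqueness of the exponents follows from the homomorphism to the
  model, which reads them off.\<close>

lemma normal_form:
  assumes "g \<in> carrier GG"
  shows "\<exists>a c. g = pow_list GG xgen vlist a \<otimes>\<^bsub>GG\<^esub> pow_list GG ygen nlist c"
  using assms unfolding graph_group_def
proof (induction g rule: pres_group_induct)
  case one
  have "\<one>\<^bsub>GG\<^esub> = pow_list GG xgen vlist (\<lambda>_. 0) \<otimes>\<^bsub>GG\<^esub> pow_list GG ygen nlist (\<lambda>_. 0)"
    by (simp add: G.pow_list_zero)
  then show ?case unfolding graph_group_def by blast
next
  case (letter x b g)
  then obtain a c where g: "g = pow_list GG xgen vlist a \<otimes>\<^bsub>GG\<^esub> pow_list GG ygen nlist c"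
    by (auto simp: graph_group_def)
  have "\<exists>a c. gl x b \<otimes>\<^bsub>GG\<^esub> g = pow_list GG xgen vlist a \<otimes>\<^bsub>GG\<^esub> pow_list GG ygen nlist c"
    using letter(1)
  proof (cases rule: gl_cases[where b = b])
    case (1 v)
    show ?thesis unfolding 1(2) g by (rule xgen_push) (use 1 vlist in auto)
  next
    case (2 p)
    let ?e = "if b then 1 else - 1 :: int"
    have "ygen p [^]\<^bsub>GG\<^esub> ?e \<otimes>\<^bsub>GG\<^esub> (pow_list GG xgen vlist a \<otimes>\<^bsub>GG\<^esub> pow_list GG ygen nlist c)
       = pow_list GG xgen vlist a \<otimes>\<^bsub>GG\<^esub> (ygen p [^]\<^bsub>GG\<^esub> ?e \<otimes>\<^bsub>GG\<^esub> pow_list GG ygen nlist c)"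
      using ygen_pow_central[OF 2(1) gX_in, of ?e a] gX_in gY_in ygen_in[OF 2(1)]
      by (simp flip: G.m_assoc)
    then show ?thesis unfolding 2(2) g gY_add[OF 2(1)] by blast
  qed
  then show ?case by (simp add: graph_group_def)
qed

section \<open>The isomorphism with the model\<close>

definition nx :: "'v gen \<Rightarrow> ('v \<Rightarrow> int) \<times> ('v \<times> 'v \<Rightarrow> int)" where
  "nx x = (case x of GX v \<Rightarrow> (unit_vec v, \<lambda>_. 0) | GY i j \<Rightarrow> (\<lambda>_. 0, unit_vec (i, j)))"

lemma nx_in: "x \<in> gg_gens V E \<Longrightarrow> nx x \<in> carrier NN"
  by (auto simp: gg_gens_def nx_def model_simps unit_vec_def nonedges_def)

lemma nx_rels:
  assumes "r \<in> gg_rels V E"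
  shows "word_eval NN nx r = \<one>\<^bsub>NN\<^esub>"
proof -
  have x: "nx (GX v) \<in> carrier NN" if "v \<in> V" for v using nx_in GX_in that by blast
  have y: "nx (GY i j) \<in> carrier NN" if "i \<in> V" "j \<in> V" "i < j" "\<not> E i j" for i j
    using nx_in GY_in[of "(i, j)"] that by (simp add: nonedges_def)
  have 1: "word_eval NN nx (comm_word (GX j) (GX i)) = \<one>\<^bsub>NN\<^esub>" if "i \<in> V" "j \<in> V" "i < j" "E i j" for i j
  proof -
    have "nx (GX j) \<otimes>\<^bsub>NN\<^esub> nx (GX i) \<otimes>\<^bsub>NN\<^esub> \<one>\<^bsub>NN\<^esub> = nx (GX i) \<otimes>\<^bsub>NN\<^esub> nx (GX j)"
      using that symE by (auto simp: model_simps nx_def cocyc_def unit_vec_def fun_eq_iff)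
    then show ?thesis using comm_solve[OF N.is_group x x N.one_closed] that by (simp add: comm_word_def)
  qed
  have 2: "word_eval NN nx (comm_word (GX j) (GX i) @ [(GY i j, False)]) = \<one>\<^bsub>NN\<^esub>" if "i \<in> V" "j \<in> V" "i < j" "\<not> E i j" for i j
  proof -
    have "nx (GX j) \<otimes>\<^bsub>NN\<^esub> nx (GX i) = nx (GX i) \<otimes>\<^bsub>NN\<^esub> nx (GX j) \<otimes>\<^bsub>NN\<^esub> nx (GY i j)"
      using that by (auto simp: model_simps nx_def cocyc_def unit_vec_def fun_eq_iff)
    then have "nx (GX j) \<otimes>\<^bsub>NN\<^esub> nx (GX i) \<otimes>\<^bsub>NN\<^esub> inv\<^bsub>NN\<^esub> nx (GY i j) = nx (GX i) \<otimes>\<^bsub>NN\<^esub> nx (GX j)"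
      using x y that by (subst N.inv_solve_right') auto
    then show ?thesis using comm_solve[OF N.is_group x x N.inv_closed[OF y]] that y by (simp add: comm_word_def)
  qed
  have 3: "word_eval NN nx (comm_word (GX l) (GY i j)) = \<one>\<^bsub>NN\<^esub>" if "l \<in> V" "i \<in> V" "j \<in> V" "i < j" "\<not> E i j" for l i j
  proof -
    have "nx (GX l) \<otimes>\<^bsub>NN\<^esub> nx (GY i j) \<otimes>\<^bsub>NN\<^esub> \<one>\<^bsub>NN\<^esub> = nx (GY i j) \<otimes>\<^bsub>NN\<^esub> nx (GX l)"
      by (auto simp: model_simps nx_def)
    then show ?thesis using comm_solve[OF N.is_group x y N.one_closed] that by (simp add: comm_word_def)
  qed
  show ?thesis using assms 1 2 3 unfolding gg_rels_def by blast
qed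

text \<open>The homomorphism given by the presentation sends a normal form to the pair of its
  exponent vectors. Hence it is injective, as normal forms exhaust the group, and surjective, as all
  exponents occur.\<close>

lemma graph_group_iso: "graph_group V E \<cong> model V E"
proof -
  have "\<exists>h\<in>hom GG NN. \<forall>x\<in>gg_gens V E. h (gl x True) = nx x"
    unfolding graph_group_def by (rule pres_hom_ex[OF N.is_group nx_in nx_rels])
  then obtain h where h: "h \<in> hom GG NN" "\<And>x. x \<in> gg_gens V E \<Longrightarrow> h (gl x True) = nx x"
    by (elim bexE) simp
  interpret h: group_hom GG NN h using h(1) by unfold_locales
  have hx: "h (xgen v [^]\<^bsub>GG\<^esub> (k::int)) = (\<lambda>u. k * unit_vec v u, \<lambda>_. 0)" if "v \<in> V" for v k
  proof -
    let ?f = "\<lambda>k::int. (\<lambda>u. k * unit_vec v u, \<lambda>_. 0 :: int)"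
    have "?f 1 [^]\<^bsub>NN\<^esub> k = ?f k"
      by (rule N.int_pow_unique)
        (use that in \<open>auto simp: model_simps unit_vec_def cocyc_def fun_eq_iff algebra_simps\<close>)
    then show ?thesis using that h(2)[OF GX_in[OF that]] xgen_in[OF that]
      by (simp add: h.hom_int_pow xgen_def nx_def)
  qed
  have hy: "h (ygen p [^]\<^bsub>GG\<^esub> (k::int)) = (\<lambda>_. 0, \<lambda>q. k * unit_vec p q)" if "p \<in> nonedges V E" for p k
  proof -
    let ?f = "\<lambda>k::int. (\<lambda>_. 0 :: int, \<lambda>q. k * unit_vec p q)"
    have "?f 1 [^]\<^bsub>NN\<^esub> k = ?f k"
      by (rule N.int_pow_unique)
        (use that in \<open>auto simp: model_simps unit_vec_def fun_eq_iff algebra_simps\<close>)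
    then show ?thesis using that h(2)[OF GY_in[OF that]] ygen_in[OF that]
      by (simp add: h.hom_int_pow ygen_def nx_def)
  qed
  \<comment> \<open>Sortedness makes the cocycle vanish: it would need a vertex smaller than
    \<open>v\<close> to the right of \<open>v\<close>.\<close>
  have hX: "h (pow_list GG xgen l a) = (zrestr (set l) a, \<lambda>_. 0)" if "set l \<subseteq> V" "sorted_wrt (<) l" for l a
    using that
  proof (induction l)
    case Nil
    then show ?case by (simp add: model_simps zrestr_def fun_eq_iff)
  next
    case (Cons v l)
    have "pow_list GG xgen l a \<in> carrier GG" using Cons.prems xgen_in by (intro G.pow_list_closed) auto
    moreover have "v \<notin> set l" using Cons.prems by auto
    ultimately show ?case using Cons xgen_in[of v]
      by (auto simp: hx model_simps zrestr_def unit_vec_def cocyc_def fun_eq_iff)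
  qed
  have hY: "h (pow_list GG ygen l c) = (\<lambda>_. 0, zrestr (set l) c)" if "set l \<subseteq> nonedges V E" "distinct l" for l c
    using that
  proof (induction l)
    case Nil
    then show ?case by (simp add: model_simps zrestr_def fun_eq_iff)
  next
    case (Cons p l)
    have "pow_list GG ygen l c \<in> carrier GG" using Cons.prems ygen_in by (intro G.pow_list_closed) auto
    then show ?case using Cons ygen_in[of p]
      by (auto simp: hy model_simps zrestr_def unit_vec_def fun_eq_iff)
  qed
  have hXY: "h (pow_list GG xgen vlist a \<otimes>\<^bsub>GG\<^esub> pow_list GG ygen nlist c) = (zrestr V a, zrestr (nonedges V E) c)" for a c
    using hX[of vlist a] hY[of nlist c] vlist nlist gX_in gY_in by (simp add: model_simps)
  have "bij_betw h (carrier GG) (carrier NN)"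
    unfolding bij_betw_def
  proof
    show "inj_on h (carrier GG)"
    proof (rule inj_onI)
      fix g g' assume g: "g \<in> carrier GG" "g' \<in> carrier GG" "h g = h g'"
      obtain a c a' c' where nf: "g = pow_list GG xgen vlist a \<otimes>\<^bsub>GG\<^esub> pow_list GG ygen nlist c"
        "g' = pow_list GG xgen vlist a' \<otimes>\<^bsub>GG\<^esub> pow_list GG ygen nlist c'" using normal_form g by metis
      then have "zrestr V a = zrestr V a'" "zrestr (nonedges V E) c = zrestr (nonedges V E) c'"
        using g(3) by (simp_all add: hXY)
      then have "\<And>v. v \<in> V \<Longrightarrow> a v = a' v" "\<And>p. p \<in> nonedges V E \<Longrightarrow> c p = c' p"
        unfolding zrestr_def by (metis)+
      then show "g = g'" unfolding nf using pow_list_cong[of vlist a a'] pow_list_cong[of nlist c c'] vlist nlist by metis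
    qed
    show "h ` carrier GG = carrier NN"
    proof
      show "carrier NN \<subseteq> h ` carrier GG"
      proof
        fix g assume "g \<in> carrier NN"
        then have g: "fst g \<in> carrier (Zf V)" "snd g \<in> carrier (Zf (nonedges V E))" unfolding model_simps by blast+
        have "h (pow_list GG xgen vlist (fst g) \<otimes>\<^bsub>GG\<^esub> pow_list GG ygen nlist (snd g)) = g"
          unfolding hXY zrestr_id[OF g(1)] zrestr_id[OF g(2)] by simp
        then show "g \<in> h ` carrier GG" using gX_in gY_in by (metis G.m_closed imageI)
      qed
    qed auto
  qed
  then show ?thesis using h(1) by (intro is_isoI[of h]) (simp add: iso_def)
qed

end

section \<open>Splitting a block-triangular automorphism\<close>

locale nil_blocks =
  fixes V F :: "'v::linorder set" and E :: "'v \<Rightarrow> 'v \<Rightarrow> bool" and J :: "'t set" and Q :: "'t \<Rightarrow> 'v set"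
  assumes finV: "finite V" and finJ: "finite J"
    and FV: "F \<subseteq> V" and UnQ: "(\<Union>t\<in>J. Q t) = V - F"
    and disj: "t \<in> J \<Longrightarrow> t' \<in> J \<Longrightarrow> t \<noteq> t' \<Longrightarrow> Q t \<inter> Q t' = {}"
    and adj: "t \<in> J \<Longrightarrow> t' \<in> J \<Longrightarrow> t \<noteq> t' \<Longrightarrow> x \<in> Q t \<Longrightarrow> y \<in> Q t' \<Longrightarrow> E x y"
    and full: "v \<in> F \<Longrightarrow> u \<in> V \<Longrightarrow> u \<noteq> v \<Longrightarrow> E v u \<and> E u v"
begin

abbreviation "W \<equiv> V - F"

lemma QW: "t \<in> J \<Longrightarrow> Q t \<subseteq> W" using UnQ by blast

lemma nonedges_W: "nonedges V E = nonedges W E"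
  using full by (auto simp: nonedges_def)

lemma nonedges_Q: "(\<Union>t\<in>J. nonedges (Q t) E) = nonedges V E"
  unfolding nonedges_W by (rule nonedges_join(1)[OF UnQ disj adj])

lemma nonedges_Q_disj: "t \<in> J \<Longrightarrow> u \<in> J \<Longrightarrow> t \<noteq> u \<Longrightarrow> nonedges (Q t) E \<inter> nonedges (Q u) E = {}"
  by (rule nonedges_join(2)[OF UnQ disj adj])

text \<open>Entries from \<open>Q t\<close> into \<open>F\<close> are left free; they form the
  off-diagonal part of the triangular matrix.\<close>

definition blocked :: "(('v \<Rightarrow> int) \<times> ('v \<times> 'v \<Rightarrow> int) \<Rightarrow> ('v \<Rightarrow> int) \<times> ('v \<times> 'v \<Rightarrow> int)) \<Rightarrow> bool" where
  "blocked h \<longleftrightarrow> h \<in> hom (model V E) (model V E) \<and>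
    (\<forall>v\<in>F. \<forall>b\<in>W. ab_map h (unit_vec v) b = 0) \<and>
    (\<forall>t\<in>J. \<forall>v\<in>Q t. \<forall>b\<in>W - Q t. ab_map h (unit_vec v) b = 0)"

definition blk :: "'t \<Rightarrow> (('v \<Rightarrow> int) \<times> ('v \<times> 'v \<Rightarrow> int) \<Rightarrow> ('v \<Rightarrow> int) \<times> ('v \<times> 'v \<Rightarrow> int)) \<Rightarrow>
    ('v \<Rightarrow> int) \<times> ('v \<times> 'v \<Rightarrow> int) \<Rightarrow> ('v \<Rightarrow> int) \<times> ('v \<times> 'v \<Rightarrow> int)" where
  "blk t h g = nil_restr (Q t) E (h g)"

lemma ab_blk: "ab_map (blk t h) a = zrestr (Q t) (ab_map h a)"
  by (simp add: ab_map_def blk_def nil_restr_def)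

lemma ce_blk: "ce_map (blk t h) c = zrestr (nonedges (Q t) E) (ce_map h c)"
  by (simp add: ce_map_def blk_def nil_restr_def)

lemma blk_hom:
  assumes "h \<in> hom (model V E) (model V E)" "t \<in> J"
  shows "blk t h \<in> hom (model (Q t) E) (model (Q t) E)"
proof -
  have "Q t \<subseteq> V" using QW[OF assms(2)] by blast
  then have "nil_restr (Q t) E \<circ> (h \<circ> (\<lambda>g. g)) \<in> hom (model (Q t) E) (model (Q t) E)"
    by (intro hom_compose[OF hom_compose[OF nil_incl_hom assms(1)] nil_restr_hom])
  then show ?thesis by (simp add: blk_def[abs_def] o_def)
qed

context
  fixes h assumes h: "blocked h"
begin

lemma blocked_hom: "h \<in> hom (model V E) (model V E)"
  using h by (simp add: blocked_def)

lemmas ab_hom = ab_map_hom[OF finV blocked_hom]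
lemmas ce_hom = ce_map_hom[OF finV blocked_hom]

text \<open>An entry of \<open>ce_map h\<close> is a minor of \<open>ab_map h\<close> with columns
  in \<open>Q t\<close> and rows at the two ends of \<open>p\<close>. Non-edges avoid
  \<open>F\<close>, so a non-zero minor forces both ends of \<open>p\<close> into
  \<open>Q t\<close>.\<close>

lemma ce_block:
  assumes t: "t \<in> J" and q: "q \<in> nonedges (Q t) E" and p: "p \<in> nonedges V E - nonedges (Q t) E"
  shows "ce_map h (unit_vec q) p = 0"
proof (rule ccontr)
  assume n: "ce_map h (unit_vec q) p \<noteq> 0"
  obtain i j where ij: "q = (i, j)" by (cases q)
  obtain p1 p2 where pp: "p = (p1, p2)" by (cases p)
  have ijQ: "i \<in> Q t" "j \<in> Q t" using q ij by (auto simp: nonedges_def)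
  have qV: "(i, j) \<in> nonedges V E" using q ij t nonedges_Q by blast
  have "ab_map h (unit_vec j) p2 * ab_map h (unit_vec i) p1 \<noteq> 0 \<or> ab_map h (unit_vec i) p2 * ab_map h (unit_vec j) p1 \<noteq> 0"
    using n nil_hom_unit(2)[OF finV blocked_hom qV, of p] unfolding ij pp
    by (auto simp: ce_map_def cocyc_def split: if_splits)
  then obtain i' j' where ij': "i' \<in> Q t" "j' \<in> Q t" "ab_map h (unit_vec j') p2 \<noteq> 0" "ab_map h (unit_vec i') p1 \<noteq> 0"
    using ijQ by auto
  have pW: "p1 \<in> W" "p2 \<in> W" using p pp nonedges_W by (auto simp: nonedges_def)
  have "p1 \<in> Q t" "p2 \<in> Q t" using ij' pW t h unfolding blocked_def by blast+
  then show False using p pp by (auto simp: nonedges_def)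
qed

text \<open>Every non-edge lies in exactly one block, so \<open>q\<close> belongs to another block
  and \<open>ce_block\<close> applies to that one.\<close>

lemma ce_block':
  assumes t: "t \<in> J" and q: "q \<in> nonedges V E - nonedges (Q t) E" and p: "p \<in> nonedges (Q t) E"
  shows "ce_map h (unit_vec q) p = 0"
proof -
  obtain u where u: "u \<in> J" "q \<in> nonedges (Q u) E" using q nonedges_Q by blast
  then have "u \<noteq> t" using q by blast
  then have "p \<in> nonedges V E - nonedges (Q u) E" using p nonedges_Q nonedges_Q_disj[OF u(1) t] t by blast
  then show ?thesis by (rule ce_block[OF u])
qed

lemma ab_F: "a \<in> carrier (Zf F) \<Longrightarrow> ab_map h a \<in> carrier (Zf F)"
  by (rule Zf_support[OF ab_hom finV FV]) (use h in \<open>auto simp: blocked_def\<close>)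

lemma ab_W:
  assumes "a \<in> carrier (Zf V)"
  shows "zrestr W (ab_map h a) = zrestr W (ab_map h (zrestr W a))"
  by (rule zrestr_block[OF ab_hom finV _ _ assms]) (use h in \<open>auto simp: blocked_def\<close>)

lemma abW_hom: "(\<lambda>f. zrestr W (ab_map h f)) \<in> hom (Zf W) (Zf W)"
  by (rule zrestr_comp_hom[OF ab_hom]) blast

lemma ab_F_hom: "ab_map h \<in> hom (Zf F) (Zf F)"
proof (rule homI)
  fix f g assume "f \<in> carrier (Zf F)" "g \<in> carrier (Zf F)"
  then have "f \<in> carrier (Zf V)" "g \<in> carrier (Zf V)" using Zf_mono[OF FV] by blast+
  from hom_mult[OF ab_hom this] show "ab_map h (f \<otimes>\<^bsub>Zf F\<^esub> g) = ab_map h f \<otimes>\<^bsub>Zf F\<^esub> ab_map h g" by simp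
qed (rule ab_F)

lemma abW_block:
  assumes "t \<in> J"
  shows "v \<in> Q t \<Longrightarrow> b \<in> W - Q t \<Longrightarrow> zrestr W (ab_map h (unit_vec v)) b = 0"
    and "v \<in> W - Q t \<Longrightarrow> b \<in> Q t \<Longrightarrow> zrestr W (ab_map h (unit_vec v)) b = 0"
proof -
  have 1: "zrestr W (ab_map h (unit_vec v)) b = 0" if "t \<in> J" "v \<in> Q t" "b \<in> W - Q t" for t v b
    using that h by (auto simp: zrestr_def blocked_def)
  show "zrestr W (ab_map h (unit_vec v)) b = 0" if "v \<in> Q t" "b \<in> W - Q t"
    using 1[OF assms that] .
  show "zrestr W (ab_map h (unit_vec v)) b = 0" if v: "v \<in> W - Q t" "b \<in> Q t"
  proof -
    obtain u where u: "u \<in> J" "v \<in> Q u" using v UnQ by blast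
    then have "u \<noteq> t" using v by blast
    then have "b \<in> W - Q u" using v QW[OF assms] disj[OF u(1) assms] by blast
    from 1[OF u this] show ?thesis .
  qed
qed

lemma zrestr_QW: "t \<in> J \<Longrightarrow> zrestr (Q t) (zrestr W f) = zrestr (Q t) f"
  using QW by (auto simp: zrestr_def fun_eq_iff)

text \<open>The group splits into its abelianisation and its central part, the abelianisation into
  \<open>F\<close> and the quotient \<open>W\<close>, and both \<open>W\<close> and the non-edges
  into blocks. Reading \<open>reidemeister_nil\<close> backwards in each block recombines the
  factors.\<close>

lemma reidemeister_blocks:
  "reidemeister (model V E) h =
     reidemeister (Zf F) (ab_map h) * (\<Prod>t\<in>J. reidemeister (model (Q t) E) (blk t h))"
proof -
  let ?W = "\<lambda>f. zrestr W (ab_map h f)"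
  have ext: "reidemeister (Zf V) (ab_map h) = reidemeister (Zf F) (ab_map h) * reidemeister (Zf W) ?W"
  proof (rule reidemeister_central_extension[where i = "\<lambda>f. f" and p = "zrestr W"])
    show "(\<lambda>f. f) \<in> hom (Zf F) (Zf V)" using Zf_mono[OF FV] by (intro homI) simp_all
    show "zrestr W \<in> hom (Zf V) (Zf W)" by (rule zrestr_hom)
    show "zrestr W ` carrier (Zf V) = carrier (Zf W)"
    proof
      show "carrier (Zf W) \<subseteq> zrestr W ` carrier (Zf V)"
      proof
        fix f assume f: "f \<in> carrier (Zf W)"
        then have "f \<in> carrier (Zf V)" by (rule Zf_mono[rotated]) blast
        then show "f \<in> zrestr W ` carrier (Zf V)" using zrestr_id[OF f] by (metis imageI)
      qed
    qed (rule image_subsetI, rule zrestr_in)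
    show "(zrestr W g = \<one>\<^bsub>Zf W\<^esub>) = (g \<in> (\<lambda>f. f) ` carrier (Zf F))" if "g \<in> carrier (Zf V)" for g
      using that by (auto simp: zrestr_def fun_eq_iff)
    show "zrestr W (ab_map h g) = ?W (zrestr W g)" if "g \<in> carrier (Zf V)" for g
      by (rule ab_W[OF that])
    show "q = \<one>\<^bsub>Zf W\<^esub>" if "reidemeister (Zf W) ?W \<noteq> \<infinity>" "q \<in> carrier (Zf W)" "?W q = q" for q
      by (rule reidemeister_Zf_fixed[OF _ abW_hom that]) (use finV in blast)
  qed (simp_all add: ab_hom abW_hom ab_F_hom inj_on_def add.commute)
  have prodW: "reidemeister (Zf W) ?W = (\<Prod>t\<in>J. reidemeister (Zf (Q t)) (ab_map (blk t h)))"
  proof (rule reidemeister_product[where r = "\<lambda>t. zrestr (Q t)", OF finJ])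
    fix t assume t: "t \<in> J"
    then have QV: "Q t \<subseteq> V" using QW by blast
    show "ab_map (blk t h) \<in> hom (Zf (Q t)) (Zf (Q t))"
      unfolding ab_blk[abs_def] by (rule zrestr_comp_hom[OF ab_hom QV])
    show "zrestr (Q t) \<in> hom (Zf W) (Zf (Q t))" by (rule zrestr_hom)
    fix g assume g: "g \<in> carrier (Zf W)"
    show "zrestr (Q t) (?W g) = ab_map (blk t h) (zrestr (Q t) g)"
      using zrestr_block[OF abW_hom _ QW[OF t] abW_block(2)[OF t] g] finV
      by (simp add: ab_blk zrestr_QW[OF t])
  next
    show "bij_betw (\<lambda>g. \<lambda>t\<in>J. zrestr (Q t) g) (carrier (Zf W)) (\<Pi>\<^sub>E t\<in>J. carrier (Zf (Q t)))"
      by (rule zrestr_bij[OF UnQ disj])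
  qed (simp_all add: abW_hom)
  have prodN: "reidemeister (Zf (nonedges V E)) (ce_map h)
      = (\<Prod>t\<in>J. reidemeister (Zf (nonedges (Q t) E)) (ce_map (blk t h)))"
  proof (rule reidemeister_product[where r = "\<lambda>t. zrestr (nonedges (Q t) E)", OF finJ])
    fix t assume t: "t \<in> J"
    then have QV: "nonedges (Q t) E \<subseteq> nonedges V E" using nonedges_Q by blast
    show "ce_map (blk t h) \<in> hom (Zf (nonedges (Q t) E)) (Zf (nonedges (Q t) E))"
      unfolding ce_blk[abs_def] by (rule zrestr_comp_hom[OF ce_hom QV])
    show "zrestr (nonedges (Q t) E) \<in> hom (Zf (nonedges V E)) (Zf (nonedges (Q t) E))" by (rule zrestr_hom)
    fix g assume g: "g \<in> carrier (Zf (nonedges V E))"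
    show "zrestr (nonedges (Q t) E) (ce_map h g) = ce_map (blk t h) (zrestr (nonedges (Q t) E) g)"
      unfolding ce_blk by (rule zrestr_block[OF ce_hom finite_nonedges[OF finV] QV ce_block'[OF t] g])
  next
    show "bij_betw (\<lambda>g. \<lambda>t\<in>J. zrestr (nonedges (Q t) E) g) (carrier (Zf (nonedges V E)))
        (\<Pi>\<^sub>E t\<in>J. carrier (Zf (nonedges (Q t) E)))"
      by (rule zrestr_bij[OF nonedges_Q nonedges_Q_disj])
  qed (simp_all add: ce_hom)
  have "reidemeister (model (Q t) E) (blk t h)
      = reidemeister (Zf (nonedges (Q t) E)) (ce_map (blk t h)) * reidemeister (Zf (Q t)) (ab_map (blk t h))"
    if "t \<in> J" for t
  proof (rule reidemeister_nil[OF _ blk_hom[OF blocked_hom that]])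
    show "finite (Q t)" using QW[OF that] finV by (meson finite_Diff finite_subset)
  qed
  then have "(\<Prod>t\<in>J. reidemeister (model (Q t) E) (blk t h))
      = (\<Prod>t\<in>J. reidemeister (Zf (nonedges (Q t) E)) (ce_map (blk t h)))
        * (\<Prod>t\<in>J. reidemeister (Zf (Q t)) (ab_map (blk t h)))"
    by (simp add: prod.distrib)
  then show ?thesis
    unfolding reidemeister_nil[OF finV blocked_hom] ext prodW prodN by (simp add: ac_simps)
qed

end

text \<open>The inverse \<open>k\<close> has to be triangular as well, since only then do its
  diagonal parts on \<open>F\<close> and \<open>W\<close> invert those of \<open>h\<close>. For a
  single block, bijectivity of the two induced maps is combined by the five lemma.\<close>

lemma blocked_iso:
  assumes h: "blocked h" and k: "blocked k"
    and kh: "\<And>g. g \<in> carrier (model V E) \<Longrightarrow> k (h g) = g"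
    and hk: "\<And>g. g \<in> carrier (model V E) \<Longrightarrow> h (k g) = g"
  shows "ab_map h \<in> iso (Zf F) (Zf F)"
    and "t \<in> J \<Longrightarrow> blk t h \<in> iso (model (Q t) E) (model (Q t) E)"
proof -
  have abid: "ab_map k (ab_map h a) = a \<and> ab_map h (ab_map k a) = a" if "a \<in> carrier (Zf V)" for a
  proof -
    have "(a, \<lambda>_. 0) \<in> carrier (model V E)" using that by (simp add: model_simps)
    then show ?thesis
      unfolding ab_map_comp[OF finV blocked_hom[OF k] blocked_hom[OF h] that]
        ab_map_comp[OF finV blocked_hom[OF h] blocked_hom[OF k] that]
      by (simp add: ab_map_def kh hk)
  qed
  have ceid: "ce_map k (ce_map h a) = a \<and> ce_map h (ce_map k a) = a" if "a \<in> carrier (Zf (nonedges V E))" for a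
  proof -
    have "(\<lambda>_. 0, a) \<in> carrier (model V E)" using that by (simp add: model_simps)
    then show ?thesis
      unfolding ce_map_comp[OF finV blocked_hom[OF k] blocked_hom[OF h] that]
        ce_map_comp[OF finV blocked_hom[OF h] blocked_hom[OF k] that]
      by (simp add: ce_map_def kh hk)
  qed
  have "bij_betw (ab_map h) (carrier (Zf F)) (carrier (Zf F))"
    by (rule bij_betw_byWitness[where f' = "ab_map k"])
      (use abid Zf_mono[OF FV] ab_F[OF h] ab_F[OF k] in blast)+
  then show "ab_map h \<in> iso (Zf F) (Zf F)" using ab_F_hom[OF h] by (simp add: iso_def)
  assume t: "t \<in> J"
  have WV: "a \<in> carrier (Zf V)" if "a \<in> carrier (Zf W)" for a using that by (rule Zf_mono[rotated]) blast
  have Wid: "zrestr W (ab_map h' (zrestr W (ab_map h a))) = a"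
    if a: "a \<in> carrier (Zf W)" and h: "blocked h" and h': "blocked h'"
      and id: "\<And>a. a \<in> carrier (Zf V) \<Longrightarrow> ab_map h' (ab_map h a) = a" for a h h'
  proof -
    have "ab_map h a \<in> carrier (Zf V)" using hom_Zf_in[OF ab_hom[OF h] WV[OF a]] .
    from ab_W[OF h' this] id[OF WV[OF a]] zrestr_id[OF a] show ?thesis by simp
  qed
  have bijW: "bij_betw (\<lambda>f. zrestr W (ab_map h f)) (carrier (Zf W)) (carrier (Zf W))"
  proof (rule bij_betw_byWitness[where f' = "\<lambda>f. zrestr W (ab_map k f)"])
    show "\<forall>a\<in>carrier (Zf W). zrestr W (ab_map k (zrestr W (ab_map h a))) = a"
      using Wid[OF _ h k] abid by blast
    show "\<forall>a\<in>carrier (Zf W). zrestr W (ab_map h (zrestr W (ab_map k a))) = a"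
      using Wid[OF _ k h] abid by blast
  qed (rule image_subsetI, rule zrestr_in)+
  have "bij_betw (\<lambda>f. zrestr (Q t) (zrestr W (ab_map h f))) (carrier (Zf (Q t))) (carrier (Zf (Q t)))"
    by (rule block_bij[OF abW_hom[OF h] bijW _ QW[OF t] abW_block[OF h t]]) (use finV in blast)
  then have bij_ab: "bij_betw (ab_map (blk t h)) (carrier (Zf (Q t))) (carrier (Zf (Q t)))"
    by (simp only: ab_blk[abs_def] zrestr_QW[OF h t])
  have "bij_betw (ce_map h) (carrier (Zf (nonedges V E))) (carrier (Zf (nonedges V E)))"
    by (rule bij_betw_byWitness[where f' = "ce_map k"])
      (use ceid hom_Zf_in[OF ce_hom[OF h]] hom_Zf_in[OF ce_hom[OF k]] in blast)+
  then have "bij_betw (\<lambda>f. zrestr (nonedges (Q t) E) (ce_map h f))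
      (carrier (Zf (nonedges (Q t) E))) (carrier (Zf (nonedges (Q t) E)))"
    by (rule block_bij[OF ce_hom[OF h] _ finite_nonedges[OF finV] _ ce_block[OF h t] ce_block'[OF h t]])
      (use nonedges_Q t in blast)
  then have bij_ce: "bij_betw (ce_map (blk t h)) (carrier (Zf (nonedges (Q t) E))) (carrier (Zf (nonedges (Q t) E)))"
    by (simp only: ce_blk[abs_def])
  have finQ: "finite (Q t)" using QW[OF t] finV by (meson finite_Diff finite_subset)
  note hom = blk_hom[OF blocked_hom[OF h] t]
  have "bij_betw (blk t h) (carrier (model (Q t) E)) (carrier (model (Q t) E))"
    unfolding bij_betw_def
    using nil_hom_inj[OF finQ hom] nil_hom_surj[OF finQ hom] bij_ab bij_ce by (simp add: bij_betw_def)
  then show "blk t h \<in> iso (model (Q t) E) (model (Q t) E)" using hom by (simp add: iso_def)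
qed

end

section \<open>The matrix of an automorphism\<close>

lemma iso_matrix:
  fixes V :: "'v::linorder set"
  assumes fin: "finite V" and sym: "\<And>u v. E u v \<longleftrightarrow> E v u" and irr: "\<And>v. \<not> E v v"
    and h: "h \<in> iso (model V E) (model V E)"
  shows "\<exists>\<pi>. graph_matrix V E (\<lambda>b v. ab_map h (unit_vec v) b) \<pi>"
proof -
  let ?G = "model V E" and ?m = "\<lambda>b v. ab_map h (unit_vec v) b"
  have hom: "h \<in> hom ?G ?G" and bij: "bij_betw h (carrier ?G) (carrier ?G)" using h by (auto simp: iso_def)
  note abh = ab_map_hom[OF fin hom]
  define k where "k = inv_into (carrier ?G) h"
  have k: "k \<in> hom ?G ?G" using group.iso_set_sym[OF model_group h] by (simp add: k_def iso_def)
  have ab0: "a = (\<lambda>_. 0)" if a: "a \<in> carrier (Zf V)" "ab_map h a = (\<lambda>_. 0)" for a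
  proof -
    have "(a, \<lambda>_. 0) \<in> carrier ?G" using a by (simp add: model_simps)
    then have "k (h (a, \<lambda>_. 0)) = (a, \<lambda>_. 0)" using bij by (simp add: k_def bij_betw_def)
    then have "ab_map k (ab_map h a) = a" using ab_map_comp[OF fin k hom a(1)] by (simp add: ab_map_def)
    then show ?thesis using a(2) hom_Zf_zero[OF ab_map_hom[OF fin k]] by simp
  qed
  have inj: "int_inj V V ?m"
    unfolding int_inj_def
  proof (intro allI impI ballI)
    fix x v assume x: "\<forall>b\<in>V. (\<Sum>v\<in>V. ?m b v * x v) = 0" and v: "v \<in> V"
    let ?f = "zrestr V x"
    have f: "?f \<in> carrier (Zf V)" by (rule zrestr_in)
    have "ab_map h ?f b = 0" for b
    proof (cases "b \<in> V")
      case True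
      have "ab_map h ?f b = (\<Sum>v\<in>V. ?m b v * ?f v)" by (rule hom_Zf_expand[OF abh fin f])
      also have "\<dots> = (\<Sum>v\<in>V. ?m b v * x v)" by (rule sum.cong) (auto simp: zrestr_def)
      finally show ?thesis using x True by simp
    qed (use hom_Zf_in[OF abh f] in simp)
    then have "?f = (\<lambda>_. 0)" using ab0[OF f] by blast
    then show "x v = 0" using v by (auto simp: zrestr_def dest: fun_cong[of _ _ v])
  qed
  have comm: "?m i u * ?m j v = ?m j u * ?m i v"
    if uv: "u \<in> V" "v \<in> V" "E u v" and ij: "i \<in> V" "j \<in> V" "\<not> E i j" for u v i j
  proof -
    \<comment> \<open>The commutator of adjacent vertices is the zero vector; that its image is zero
      again is the vanishing of the minors.\<close>
    have z: "(\<lambda>_. 0) \<in> carrier (Zf (nonedges V E))" by simp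
    have "cocyc E (unit_vec u) (unit_vec v) p = cocyc E (unit_vec v) (unit_vec u) p + 0" for p
      using uv sym by (auto simp: cocyc_def unit_vec_def)
    from nil_hom_commutator(2)[OF fin hom unit_vec_in[OF uv(1)] unit_vec_in[OF uv(2)] z this]
    have c: "cocyc E (ab_map h (unit_vec u)) (ab_map h (unit_vec v)) p = cocyc E (ab_map h (unit_vec v)) (ab_map h (unit_vec u)) p" for p
      using hom_one[OF hom] by (simp add: model_simps)
    show ?thesis
    proof (cases i j rule: linorder_cases)
      case less
      then show ?thesis using c[of "(i, j)"] ij by (simp add: cocyc_def ac_simps)
    next
      case greater
      then show ?thesis using c[of "(j, i)"] ij sym by (auto simp: cocyc_def ac_simps)
    qed simp
  qed
  obtain \<pi> where pi: "bij_betw \<pi> V V" "\<forall>v\<in>V. ?m (\<pi> v) v \<noteq> 0"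
    using int_inj_transversal[OF fin fin HOL.refl inj] by blast
  have "graph_matrix V E ?m \<pi>"
    by unfold_locales (use fin sym irr inj comm pi in \<open>simp_all\<close>)
  then show ?thesis by blast
qed

section \<open>The spectrum of a join\<close>

lemma iso_imp_bij: "f \<in> iso G H \<Longrightarrow> bij_betw f (carrier G) (carrier H)"
  by (simp add: iso_def)

text \<open>Automorphisms of the factors combine into one of the product. For a product in general
  only this inclusion is available, because an automorphism may mix the factors.\<close>

lemma set_prod_spec_R:
  assumes fin: "finite J" and G: "\<And>t. t \<in> J \<Longrightarrow> group (G t)"
  shows "set_prod J (\<lambda>t. spec_R (G t)) \<subseteq> spec_R (product_group J G)"
proof
  fix n assume "n \<in> set_prod J (\<lambda>t. spec_R (G t))"
  then obtain f where f: "n = (\<Prod>t\<in>J. f t)" "\<forall>t\<in>J. f t \<in> spec_R (G t)" by (auto simp: set_prod_def)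
  then have "\<forall>t\<in>J. \<exists>\<phi>\<in>iso (G t) (G t). f t = reidemeister (G t) \<phi>" using spec_R_iso[OF G] by blast
  then obtain \<phi> where phi: "\<And>t. t \<in> J \<Longrightarrow> \<phi> t \<in> iso (G t) (G t) \<and> f t = reidemeister (G t) (\<phi> t)" by metis
  define \<Phi> where "\<Phi> g = (\<lambda>t\<in>J. \<phi> t (g t))" for g
  have grp: "group (product_group J G)" using G by simp
  have arb: "g t = undefined" if "g \<in> carrier (product_group J G)" "t \<notin> J" for g t
    using that unfolding carrier_product_group by (rule PiE_arb)
  have mem: "g t \<in> carrier (G t)" if "g \<in> carrier (product_group J G)" "t \<in> J" for g t
    using that unfolding carrier_product_group by (rule PiE_mem)
  have hom: "\<phi> t \<in> hom (G t) (G t)" and bij: "bij_betw (\<phi> t) (carrier (G t)) (carrier (G t))" if "t \<in> J" for t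
    using phi[OF that] by (auto simp: iso_def)
  have Phi_hom: "\<Phi> \<in> hom (product_group J G) (product_group J G)"
  proof (rule homI)
    fix g g' assume g: "g \<in> carrier (product_group J G)" "g' \<in> carrier (product_group J G)"
    have "\<phi> t (g t \<otimes>\<^bsub>G t\<^esub> g' t) = \<phi> t (g t) \<otimes>\<^bsub>G t\<^esub> \<phi> t (g' t)" if "t \<in> J" for t
      by (rule hom_mult[OF hom[OF that]]) (use g that mem in auto)
    then show "\<Phi> (g \<otimes>\<^bsub>product_group J G\<^esub> g') = \<Phi> g \<otimes>\<^bsub>product_group J G\<^esub> \<Phi> g'"
      unfolding \<Phi>_def mult_product_group by (intro restrict_ext) simp
  next
    fix g assume "g \<in> carrier (product_group J G)"
    then show "\<Phi> g \<in> carrier (product_group J G)"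
      unfolding \<Phi>_def carrier_product_group restrict_PiE_iff
      using hom_in_carrier[OF hom] mem by blast
  qed
  have "bij_betw \<Phi> (carrier (product_group J G)) (carrier (product_group J G))"
  proof (rule bij_betw_byWitness[where f' = "\<lambda>g. \<lambda>t\<in>J. inv_into (carrier (G t)) (\<phi> t) (g t)"])
    show "\<forall>g\<in>carrier (product_group J G). (\<lambda>t\<in>J. inv_into (carrier (G t)) (\<phi> t) (\<Phi> g t)) = g"
    proof (intro ballI ext)
      fix g t assume g: "g \<in> carrier (product_group J G)"
      show "(\<lambda>t\<in>J. inv_into (carrier (G t)) (\<phi> t) (\<Phi> g t)) t = g t"
      proof (cases "t \<in> J")
        case True
        then have "g t \<in> carrier (G t)" using mem[OF g] by blast
        then show ?thesis using True bij[OF True] by (simp add: \<Phi>_def bij_betw_def)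
      qed (use arb[OF g] in simp)
    qed
    show "\<forall>g\<in>carrier (product_group J G). \<Phi> (\<lambda>t\<in>J. inv_into (carrier (G t)) (\<phi> t) (g t)) = g"
    proof (intro ballI ext)
      fix g t assume g: "g \<in> carrier (product_group J G)"
      show "\<Phi> (\<lambda>t\<in>J. inv_into (carrier (G t)) (\<phi> t) (g t)) t = g t"
      proof (cases "t \<in> J")
        case True
        then have "g t \<in> carrier (G t)" using mem[OF g] by blast
        then show ?thesis using True bij[OF True] by (simp add: \<Phi>_def bij_betw_def f_inv_into_f)
      qed (use arb[OF g] in \<open>simp add: \<Phi>_def\<close>)
    qed
    show "\<Phi> ` carrier (product_group J G) \<subseteq> carrier (product_group J G)"
      using hom_in_carrier[OF Phi_hom] by blast
    show "(\<lambda>g. \<lambda>t\<in>J. inv_into (carrier (G t)) (\<phi> t) (g t)) ` carrier (product_group J G) \<subseteq> carrier (product_group J G)"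
    proof (rule image_subsetI)
      fix g assume g: "g \<in> carrier (product_group J G)"
      have "inv_into (carrier (G t)) (\<phi> t) (g t) \<in> carrier (G t)" if t: "t \<in> J" for t
      proof (rule inv_into_into)
        show "g t \<in> \<phi> t ` carrier (G t)" using mem[OF g t] bij[OF t] by (simp add: bij_betw_def)
      qed
      then show "(\<lambda>t\<in>J. inv_into (carrier (G t)) (\<phi> t) (g t)) \<in> carrier (product_group J G)"
        by (simp only: carrier_product_group restrict_PiE_iff) blast
    qed
  qed
  then have iso: "\<Phi> \<in> iso (product_group J G) (product_group J G)" using Phi_hom by (simp add: iso_def)
  have "reidemeister (product_group J G) \<Phi> = (\<Prod>t\<in>J. reidemeister (G t) (\<phi> t))"
  proof (rule reidemeister_product[where r = "\<lambda>t g. g t", OF fin grp G Phi_hom hom])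
    fix t assume t: "t \<in> J"
    show "(\<lambda>g. g t) \<in> hom (product_group J G) (G t)"
      using t mem by (intro homI) simp_all
    show "\<Phi> g t = \<phi> t (g t)" for g using t by (simp add: \<Phi>_def)
  next
    have "(\<lambda>t\<in>J. g t) = g" if "g \<in> (\<Pi>\<^sub>E t\<in>J. carrier (G t))" for g using that by (rule PiE_restrict)
    then show "bij_betw (\<lambda>g. \<lambda>t\<in>J. g t) (carrier (product_group J G)) (\<Pi>\<^sub>E t\<in>J. carrier (G t))"
      unfolding carrier_product_group by (subst bij_betw_cong[where g = id]) (simp_all add: bij_betw_id)
  qed
  then show "n \<in> spec_R (product_group J G)"
    unfolding spec_R_iso[OF grp] using iso f(1) phi by (intro image_eqI[of _ _ \<Phi>]) simp_all
qed

context nil_blocks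
begin

lemma spec_R_nil_subset:
  assumes blocked: "\<And>h. h \<in> iso (model V E) (model V E) \<Longrightarrow> blocked h"
  shows "spec_R (model V E) \<subseteq> set_times (spec_R (Zf F)) (set_prod J (\<lambda>t. spec_R (model (Q t) E)))"
proof
  fix n assume "n \<in> spec_R (model V E)"
  then obtain h where h: "h \<in> iso (model V E) (model V E)" "n = reidemeister (model V E) h"
    unfolding spec_R_iso[OF model_group] by blast
  let ?k = "inv_into (carrier (model V E)) h"
  have k: "?k \<in> iso (model V E) (model V E)" using group.iso_set_sym[OF model_group h(1)] .
  note bij = iso_imp_bij[OF h(1)]
  have kh: "?k (h g) = g" "h (?k g) = g" if "g \<in> carrier (model V E)" for g
    using bij that by (auto simp: bij_betw_def f_inv_into_f)
  note iso = blocked_iso[OF blocked[OF h(1)] blocked[OF k] kh]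
  have "reidemeister (Zf F) (ab_map h) \<in> spec_R (Zf F)"
    unfolding spec_R_iso[OF group_Zf] using iso(1) by blast
  moreover have "\<forall>t\<in>J. reidemeister (model (Q t) E) (blk t h) \<in> spec_R (model (Q t) E)"
    unfolding spec_R_iso[OF model_group] using iso(2) by blast
  ultimately show "n \<in> set_times (spec_R (Zf F)) (set_prod J (\<lambda>t. spec_R (model (Q t) E)))"
    unfolding h(2) reidemeister_blocks[OF blocked[OF h(1)]] set_times_def set_prod_def by blast
qed

text \<open>\<open>F\<close> is treated as one further part of the join, indexed by
  \<open>None\<close>; it spans a complete graph, so its model is free abelian.\<close>

lemma spec_R_nil_supset:
  "set_times (spec_R (Zf F)) (set_prod J (\<lambda>t. spec_R (model (Q t) E))) \<subseteq> spec_R (model V E)"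
proof -
  let ?J = "insert None (Some ` J)"
  let ?Q = "case_option F Q"
  have "(\<Union>t\<in>?J. ?Q t) = V" using UnQ FV by auto
  moreover have "?Q t \<inter> ?Q u = {}" if "t \<in> ?J" "u \<in> ?J" "t \<noteq> u" for t u
  proof (cases t; cases u)
    fix a b assume "t = Some a" "u = Some b"
    then show ?thesis using that disj[of a b] by auto
  next
    fix a assume "t = Some a" "u = None"
    then show ?thesis using that QW[of a] by auto
  next
    fix a assume "t = None" "u = Some a"
    then show ?thesis using that QW[of a] by auto
  qed (use that in auto)
  moreover have "E x y" if "t \<in> ?J" "u \<in> ?J" "t \<noteq> u" "x \<in> ?Q t" "y \<in> ?Q u" for t u x y
  proof (cases t; cases u)
    fix a b assume "t = Some a" "u = Some b"
    then show ?thesis using that adj[of a b] by auto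
  next
    fix a assume "t = Some a" "u = None"
    then show ?thesis using that QW[of a] full[of y x] by auto
  next
    fix a assume "t = None" "u = Some a"
    then show ?thesis using that QW[of a] full[of x y] by auto
  qed (use that in auto)
  ultimately have "model V E \<cong> product_group ?J (\<lambda>t. model (?Q t) E)"
    by (rule model_join)
  then have eq: "spec_R (model V E) = spec_R (product_group ?J (\<lambda>t. model (?Q t) E))"
    by (intro spec_R_cong) simp_all
  have "nonedges F E = {}" using full FV by (auto simp: nonedges_def)
  then have F: "spec_R (model F E) = spec_R (Zf F)"
    by (intro spec_R_cong model_complete) simp_all
  have "set_times (spec_R (Zf F)) (set_prod J (\<lambda>t. spec_R (model (Q t) E)))
      \<subseteq> set_prod ?J (\<lambda>t. spec_R (model (?Q t) E))"
  proof
    fix n assume "n \<in> set_times (spec_R (Zf F)) (set_prod J (\<lambda>t. spec_R (model (Q t) E)))"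
    then obtain m f where n: "n = m * (\<Prod>t\<in>J. f t)" "m \<in> spec_R (Zf F)"
      "\<forall>t\<in>J. f t \<in> spec_R (model (Q t) E)"
      unfolding set_times_def set_prod_def by blast
    have "n = (\<Prod>t\<in>?J. case_option m f t)"
      using n(1) finJ by (simp add: prod.reindex)
    moreover have "\<forall>t\<in>?J. case_option m f t \<in> spec_R (model (?Q t) E)"
      using n F by auto
    ultimately show "n \<in> set_prod ?J (\<lambda>t. spec_R (model (?Q t) E))"
      unfolding set_prod_def by blast
  qed
  also have "\<dots> \<subseteq> spec_R (model V E)"
    unfolding eq by (rule set_prod_spec_R) (use finJ in simp_all)
  finally show ?thesis .
qed

end

section \<open>Isomorphism types of the join factors\<close>

lemma equiv_graph_iso:
  "equiv I {(i, j). i \<in> I \<and> j \<in> I \<and> graph_iso E (P i) (P j)}"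
proof (rule equivI)
  let ?r = "{(i, j). i \<in> I \<and> j \<in> I \<and> graph_iso E (P i) (P j)}"
  show "?r \<subseteq> I \<times> I" by auto
  show "refl_on I ?r" unfolding refl_on_def graph_iso_def by (auto intro!: exI[of _ id])
  show "sym ?r"
  proof (rule symI)
    fix i j assume ij: "(i, j) \<in> ?r"
    then obtain f where f: "bij_betw f (P i) (P j)" "\<forall>u\<in>P i. \<forall>v\<in>P i. E u v \<longleftrightarrow> E (f u) (f v)"
      by (auto simp: graph_iso_def)
    let ?g = "inv_into (P i) f"
    have "bij_betw ?g (P j) (P i)" using f(1) by (rule bij_betw_inv_into)
    moreover have "\<forall>u\<in>P j. \<forall>v\<in>P j. E u v \<longleftrightarrow> E (?g u) (?g v)"
    proof (intro ballI)
      fix u v assume "u \<in> P j" "v \<in> P j"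
      then have "u \<in> f ` P i" "v \<in> f ` P i" using f(1) by (auto simp: bij_betw_def)
      then have "?g u \<in> P i" "?g v \<in> P i" "f (?g u) = u" "f (?g v) = v"
        by (simp_all add: inv_into_into f_inv_into_f)
      then show "E u v \<longleftrightarrow> E (?g u) (?g v)" using f(2) by metis
    qed
    ultimately show "(j, i) \<in> ?r" using ij by (auto simp: graph_iso_def)
  qed
  show "trans ?r"
  proof (rule transI)
    fix i j k assume ij: "(i, j) \<in> ?r" and jk: "(j, k) \<in> ?r"
    obtain f where f: "bij_betw f (P i) (P j)" "\<forall>u\<in>P i. \<forall>v\<in>P i. E u v \<longleftrightarrow> E (f u) (f v)"
      using ij by (auto simp: graph_iso_def)
    obtain g where g: "bij_betw g (P j) (P k)" "\<forall>u\<in>P j. \<forall>v\<in>P j. E u v \<longleftrightarrow> E (g u) (g v)"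
      using jk by (auto simp: graph_iso_def)
    have "bij_betw (g \<circ> f) (P i) (P k)" using f(1) g(1) by (rule bij_betw_trans)
    moreover have "\<forall>u\<in>P i. \<forall>v\<in>P i. E u v \<longleftrightarrow> E ((g \<circ> f) u) ((g \<circ> f) v)"
      using f g bij_betwE[OF f(1)] by simp
    ultimately show "(i, k) \<in> ?r" using ij jk unfolding graph_iso_def by blast
  qed
qed

locale join_setup =
  fixes V F :: "'v::linorder set" and E :: "'v \<Rightarrow> 'v \<Rightarrow> bool" and I :: "'i set" and P :: "'i \<Rightarrow> 'v set"
  assumes finV: "finite V" and sym: "E u v \<longleftrightarrow> E v u" and irr: "\<not> E v v" and finI: "finite I"
    and F_def: "F = {v \<in> V. \<forall>u\<in>V. u \<noteq> v \<longrightarrow> E v u}"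
    and UnP: "(\<Union>i\<in>I. P i) = V - F"
    and disjP: "i \<in> I \<Longrightarrow> j \<in> I \<Longrightarrow> i \<noteq> j \<Longrightarrow> P i \<inter> P j = {}"
    and adjP: "i \<in> I \<Longrightarrow> j \<in> I \<Longrightarrow> i \<noteq> j \<Longrightarrow> u \<in> P i \<Longrightarrow> w \<in> P j \<Longrightarrow> E u w"
    and neP: "i \<in> I \<Longrightarrow> P i \<noteq> {}"
    and irred: "i \<in> I \<Longrightarrow> \<not> join_decomposable E (P i)"
begin

abbreviation "types \<equiv> iso_types E I P"
definition tset :: "'i set \<Rightarrow> 'v set" where "tset T = (\<Union>i\<in>T. P i)"

lemma types_Union: "(\<Union>T\<in>types. T) = I"
  using Union_quotient[OF equiv_graph_iso[of I E P]] by (simp add: iso_types_def)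

lemma types_disj: "T \<in> types \<Longrightarrow> T' \<in> types \<Longrightarrow> T \<noteq> T' \<Longrightarrow> T \<inter> T' = {}"
  using quotient_disj[OF equiv_graph_iso[of I E P], of T T'] by (auto simp: iso_types_def)

lemma types_iso: "T \<in> types \<Longrightarrow> i \<in> T \<Longrightarrow> j \<in> I \<Longrightarrow> graph_iso E (P i) (P j) \<Longrightarrow> j \<in> T"
  using in_quotient_imp_closed[OF equiv_graph_iso[of I E P], of T i j] types_Union
  by (auto simp: iso_types_def)

lemma finite_types: "finite types"
  unfolding iso_types_def using finI by (intro finite_quotient) auto

lemma types_sub: "T \<in> types \<Longrightarrow> T \<subseteq> I" using types_Union by blast

lemma FV: "F \<subseteq> V" by (auto simp: F_def)

sublocale nil_blocks V F E types tset
proof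
  show "(\<Union>T\<in>types. tset T) = V - F"
  proof -
    have "(\<Union>T\<in>types. tset T) = (\<Union>i\<in>(\<Union>T\<in>types. T). P i)" by (auto simp: tset_def)
    then show ?thesis by (simp only: types_Union UnP)
  qed
  show "tset T \<inter> tset T' = {}" if "T \<in> types" "T' \<in> types" "T \<noteq> T'" for T T'
    using types_sub[OF that(1)] types_sub[OF that(2)] types_disj[OF that] disjP unfolding tset_def by blast
  show "E x y" if "T \<in> types" "T' \<in> types" "T \<noteq> T'" "x \<in> tset T" "y \<in> tset T'" for T T' x y
    using types_sub[OF that(1)] types_sub[OF that(2)] types_disj[OF that(1-3)] that(4,5) adjP unfolding tset_def by blast
  show "E v u \<and> E u v" if "v \<in> F" "u \<in> V" "u \<noteq> v" for u v
    using that sym by (auto simp: F_def)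
qed (rule finV finite_types FV)+

text \<open>As a graph automorphism \<open>\<pi>\<close> preserves \<open>F\<close> and permutes the
  factors within their types. If the image of \<open>v\<close> had an entry at a vertex
  \<open>b\<close> outside \<open>F\<close> and outside the type of \<open>v\<close>, then
  domination of \<open>\<pi> v\<close> by \<open>b\<close> would place all of \<open>V - F\<close>
  in the star of \<open>b\<close>, and \<open>b\<close> would be full. The same contradiction
  excludes entries from \<open>F\<close> to \<open>V - F\<close>.\<close>

lemma all_blocked:
  assumes h: "h \<in> iso (model V E) (model V E)"
  shows "blocked h"
proof -
  let ?m = "\<lambda>b v. ab_map h (unit_vec v) b"
  obtain \<pi> where "graph_matrix V E ?m \<pi>" using iso_matrix[OF finV sym irr h] by blast
  then interpret g: graph_matrix V E ?m \<pi> .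
  have pi: "bij_betw \<pi> V V" by (rule g.pi)
  have piV: "\<pi> ` V = V" and inj: "inj_on \<pi> V" using pi by (auto simp: bij_betw_def)
  have F_iff: "\<pi> v \<in> F \<longleftrightarrow> v \<in> F" if v: "v \<in> V" for v
  proof -
    have "\<pi> v \<in> F \<longleftrightarrow> (\<forall>u\<in>\<pi> ` V. u \<noteq> \<pi> v \<longrightarrow> E (\<pi> v) u)" using g.pi_in[OF v] by (simp add: F_def piV)
    also have "\<dots> \<longleftrightarrow> (\<forall>w\<in>V. \<pi> w \<noteq> \<pi> v \<longrightarrow> E (\<pi> v) (\<pi> w))" by blast
    also have "\<dots> \<longleftrightarrow> (\<forall>w\<in>V. w \<noteq> v \<longrightarrow> E v w)"
      using g.pi_edge_iff[OF v] inj v by (auto simp: inj_on_def)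
    finally show ?thesis using v by (simp add: F_def)
  qed
  \<comment> \<open>Vertices of \<open>F\<close> are adjacent to \<open>b\<close> anyway, so
    covering \<open>V - F\<close> suffices for \<open>b\<close> to be full.\<close>
  have inF: "b \<in> F" if b: "b \<in> V" and st: "\<And>u. u \<in> V - F \<Longrightarrow> u \<in> g.star b" for b
  proof -
    have "E b u" if u: "u \<in> V" "u \<noteq> b" for u
    proof (cases "u \<in> F")
      case True
      then have "E u b" using b u by (simp add: F_def)
      then show ?thesis using sym by blast
    next
      case False
      then have "u \<in> g.star b" using st u by blast
      then show ?thesis using u by (simp add: g.star_def)
    qed
    then show ?thesis using b by (simp add: F_def)
  qed
  have PW: "P i \<subseteq> V - F" if "i \<in> I" for i using UnP that by blast
  have ex: "\<exists>j\<in>I. \<pi> ` P i \<subseteq> P j" if i: "i \<in> I" for i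
  proof -
    have W: "\<pi> v \<in> (\<Union>i\<in>I. P i)" if "v \<in> P i" for v
      using PW[OF i] that F_iff g.pi_in UnP by blast
    obtain v0 where v0: "v0 \<in> P i" using neP[OF i] by blast
    obtain j where j: "j \<in> I" "\<pi> v0 \<in> P j" using W[OF v0] by blast
    show ?thesis
    proof (rule ccontr)
      assume "\<not> ?thesis"
      then have ns: "\<not> \<pi> ` P i \<subseteq> P j" using j by blast
      \<comment> \<open>If \<open>\<pi>\<close> spread \<open>P i\<close> over several factors, the
        vertices landing in \<open>P j\<close> and the remaining ones would split \<open>P i\<close>
        as a join, because \<open>\<pi>\<close> reflects edges.\<close>
      let ?A = "{v \<in> P i. \<pi> v \<in> P j}" and ?B = "{v \<in> P i. \<pi> v \<notin> P j}"
      have "E a b" if ab: "a \<in> ?A" "b \<in> ?B" for a b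
      proof -
        have V: "a \<in> V" "b \<in> V" using PW[OF i] ab by blast+
        obtain j' where j': "j' \<in> I" "\<pi> b \<in> P j'" using W[of b] ab by blast
        have "E (\<pi> a) (\<pi> b)"
          by (rule adjP[OF j(1) j'(1)]) (use ab j' in auto)
        then show ?thesis using g.pi_edge_iff[OF V] by blast
      qed
      then have "\<forall>a\<in>?A. \<forall>b\<in>?B. E a b" by blast
      moreover have "?A \<noteq> {}" "?B \<noteq> {}" "?A \<inter> ?B = {}" "?A \<union> ?B = P i" using v0 j ns by blast+
      ultimately have "join_decomposable E (P i)"
        unfolding join_decomposable_def by (intro exI[of _ ?A] exI[of _ ?B] conjI)
      then show False using irred[OF i] by blast
    qed
  qed
  then obtain s where s: "\<And>i. i \<in> I \<Longrightarrow> s i \<in> I \<and> \<pi> ` P i \<subseteq> P (s i)" by metis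
  have s_eq: "s i = j" if "i \<in> I" "j \<in> I" "v \<in> P i" "\<pi> v \<in> P j" for i j v
  proof (rule ccontr)
    assume "s i \<noteq> j"
    then have "P (s i) \<inter> P j = {}" using s[OF that(1)] that(2) by (intro disjP) auto
    moreover have "\<pi> v \<in> P (s i)" using s[OF that(1)] that(3) by blast
    ultimately show False using that(4) by blast
  qed
  have cover: "\<exists>i\<in>I. \<exists>v\<in>P i. w = \<pi> v" if "w \<in> V - F" for w
  proof -
    have "w \<in> \<pi> ` V" using piV that by blast
    then obtain v where v: "v \<in> V" "w = \<pi> v" by blast
    then have "v \<in> V - F" using that F_iff[OF v(1)] by blast
    then show ?thesis using v UnP by blast
  qed
  \<comment> \<open>Surjectivity on the finite set \<open>I\<close> makes \<open>s\<close>
    injective, so only \<open>P i\<close> reaches \<open>P (s i)\<close> and \<open>\<pi>\<close>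
    maps one onto the other.\<close>
  have "I \<subseteq> s ` I"
  proof
    fix j assume j: "j \<in> I"
    obtain w where w: "w \<in> P j" using neP[OF j] by blast
    then have "w \<in> V - F" using PW[OF j] by blast
    then obtain i v where "i \<in> I" "v \<in> P i" "w = \<pi> v" using cover by blast
    then show "j \<in> s ` I" using s_eq[OF _ j] w by blast
  qed
   then have s_inj: "inj_on s I" by (rule finite_surj_inj[OF finI])
  have iso: "graph_iso E (P i) (P (s i))" if i: "i \<in> I" for i
  proof -
    have si: "s i \<in> I" "\<pi> ` P i \<subseteq> P (s i)" using s[OF i] by blast+
    have "P (s i) \<subseteq> \<pi> ` P i"
    proof
      fix w assume w: "w \<in> P (s i)"
      then obtain i' v where v: "i' \<in> I" "v \<in> P i'" "w = \<pi> v" using cover PW[OF si(1)] by blast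
      then have "s i' = s i" using s_eq[OF v(1) si(1) v(2)] w by blast
      then have "i' = i" using s_inj v(1) i by (auto dest: inj_onD)
      then show "w \<in> \<pi> ` P i" using v by blast
    qed
    moreover have PiV: "P i \<subseteq> V" using PW[OF i] by blast
    ultimately have "bij_betw \<pi> (P i) (P (s i))"
      using si(2) inj_on_subset[OF inj PiV] by (auto simp: bij_betw_def)
    moreover have "\<forall>u\<in>P i. \<forall>v\<in>P i. E u v \<longleftrightarrow> E (\<pi> u) (\<pi> v)" using g.pi_edge_iff PiV by blast
    ultimately show ?thesis unfolding graph_iso_def by blast
  qed
  show ?thesis
    unfolding blocked_def
  proof (intro conjI ballI)
    show "h \<in> hom (model V E) (model V E)" using h by (simp add: iso_def)
  next
    fix v b assume v: "v \<in> F" and b: "b \<in> V - F"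
    show "?m b v = 0"
    proof (rule ccontr)
      assume n: "?m b v \<noteq> 0"
      have vV: "v \<in> V" and bV: "b \<in> V" using v b FV by auto
      have piF: "\<pi> v \<in> F" using F_iff[OF vV] v by blast
      have d: "g.link (\<pi> v) \<subseteq> g.star b" using g.dominates[OF vV bV n] .
      have "u \<in> g.star b" if u: "u \<in> V - F" for u
      proof -
        have "u \<in> V" "u \<noteq> \<pi> v" using u piF by auto
        then have "u \<in> g.link (\<pi> v)" using full[OF piF] by (simp add: g.link_def)
        then show ?thesis using d by blast
      qed
      from inF[OF bV this] show False using b by blast
    qed
  next
    fix T v b assume T: "T \<in> types" and v: "v \<in> tset T" and b: "b \<in> V - F - tset T"
    show "?m b v = 0"
    proof (rule ccontr)
      assume n: "?m b v \<noteq> 0"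
      obtain i where i: "i \<in> T" "v \<in> P i" using v by (auto simp: tset_def)
      have iI: "i \<in> I" using types_sub[OF T] i by blast
      have vV: "v \<in> V" and bV: "b \<in> V" using PW[OF iI] i b by auto
      have d: "g.link (\<pi> v) \<subseteq> g.star b" using g.dominates[OF vV bV n] .
      have sT: "s i \<in> T" using types_iso[OF T i(1) _ iso[OF iI]] s[OF iI] by blast
      have sI: "s i \<in> I" and piv: "\<pi> v \<in> P (s i)" using s[OF iI] i by blast+
      obtain l where l: "l \<in> I" "b \<in> P l" using b UnP by blast
      have "l \<noteq> s i" using l b sT by (auto simp: tset_def)
      \<comment> \<open>In the factor of \<open>b\<close>, a vertex \<open>u\<close> is adjacent to
        \<open>\<pi> v\<close>, which lies in a different factor, and domination passes this on to
        \<open>b\<close>; in any other factor, \<open>u\<close> is adjacent to \<open>b\<close> by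
        the join itself.\<close>
      have "u \<in> g.star b" if u: "u \<in> V - F" for u
      proof -
        obtain l' where l': "l' \<in> I" "u \<in> P l'" using u UnP by blast
        show ?thesis
        proof (cases "l' = l")
          case True
          then have "E (\<pi> v) u" using adjP[OF sI l(1) _ piv] l' \<open>l \<noteq> s i\<close> by blast
          then have "u \<in> g.link (\<pi> v)" using u by (simp add: g.link_def)
          then show ?thesis using d by blast
        next
          case False
          then have "E b u" using adjP[OF l(1) l'(1) _ l(2) l'(2)] by blast
          then show ?thesis using u by (simp add: g.star_def)
        qed
      qed
      from inF[OF bV this] show False using b by blast
    qed
  qed
qed

lemma spec_R_tset:
  assumes T: "T \<in> types"
  shows "spec_R (product_group T (\<lambda>i. graph_group (P i) E)) = spec_R (model (tset T) E)"
proof -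
  have finP: "finite (P i)" if "i \<in> T" for i
  proof (rule finite_subset[OF _ finV])
    show "P i \<subseteq> V" using types_sub[OF T] that UnP by blast
  qed
  have g: "group (graph_group (P i) E)" for i unfolding graph_group_def by (rule pres_group_group)
  have "product_group T (\<lambda>i. graph_group (P i) E) \<cong> product_group T (\<lambda>i. model (P i) E)"
    by (rule iso_product_groupI) (use graph_group_iso[OF finP sym] g in simp_all)
  moreover have "model (tset T) E \<cong> product_group T (\<lambda>i. model (P i) E)"
  proof (rule model_join)
    show "(\<Union>i\<in>T. P i) = tset T" by (simp add: tset_def)
    show "P i \<inter> P j = {}" if "i \<in> T" "j \<in> T" "i \<noteq> j" for i j
      by (rule disjP) (use types_sub[OF T] that in auto)
    show "E x y" if "i \<in> T" "j \<in> T" "i \<noteq> j" "x \<in> P i" "y \<in> P j" for i j x y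
      by (rule adjP[OF _ _ that(3-5)]) (use types_sub[OF T] that in auto)
  qed
  ultimately show ?thesis
    using spec_R_cong[of "product_group T (\<lambda>i. graph_group (P i) E)" "product_group T (\<lambda>i. model (P i) E)"]
      spec_R_cong[of "model (tset T) E" "product_group T (\<lambda>i. model (P i) E)"] g by simp
qed

lemma spec_R_graph_group:
  "spec_R (graph_group V E) = set_times (spec_R (Zpow (card F)))
    (set_prod types (\<lambda>T. spec_R (product_group T (\<lambda>i. graph_group (P i) E))))"
proof -
  have "spec_R (graph_group V E) = spec_R (model V E)"
    using graph_group_iso[OF finV sym] pres_group_group
    by (intro spec_R_cong) (simp_all add: graph_group_def)
  also have "\<dots> = set_times (spec_R (Zf F)) (set_prod types (\<lambda>t. spec_R (model (tset t) E)))"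
    using spec_R_nil_subset[OF all_blocked] spec_R_nil_supset by blast
  also have "spec_R (Zf F) = spec_R (Zpow (card F))"
  proof -
    have "finite F" using finV FV finite_subset by blast
    then obtain f where "bij_betw f F {..<card F}"
      using ex_bij_betw_finite_nat by (metis atLeast0LessThan)
    then show ?thesis unfolding Zpow_eq_Zf by (intro spec_R_cong Zf_iso) simp_all
  qed
  also have "set_prod types (\<lambda>t. spec_R (model (tset t) E))
      = set_prod types (\<lambda>T. spec_R (product_group T (\<lambda>i. graph_group (P i) E)))"
    unfolding set_prod_def using spec_R_tset by simp
  finally show ?thesis .
qed

end

theorem theorem5p12:
  fixes V :: "'v::linorder set" and E :: "'v \<Rightarrow> 'v \<Rightarrow> bool"
    and I :: "nat set" and P :: "nat \<Rightarrow> 'v set"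
  assumes graph: "simple_graph V E"
    and Vfull: "Vfull = {v \<in> V. degree V E v = card V - 1}"
    and I_def: "I = {1..k}"
    and decomp: "is_join_decomp E (V - Vfull) I P"
    and nonempty: "\<forall>i\<in>I. P i \<noteq> {}"
    and irred: "\<forall>i\<in>I. \<not> join_decomposable E (P i)"
  shows "spec_R (graph_group V E) =
    set_times (spec_R (Zpow (card Vfull)))
      (set_prod (iso_types E I P) (\<lambda>T. spec_R (product_group T (\<lambda>i. graph_group (P i) E))))"
proof -
  have fin: "finite V" and sym: "\<And>u v. E u v \<longleftrightarrow> E v u" and irr: "\<And>v. \<not> E v v"
    using graph by (auto simp: simple_graph_def)
  \<comment> \<open>Since \<open>v\<close> lies in \<open>V\<close>, the natural number
    \<open>card V - 1\<close> is the size of \<open>V - {v}\<close>, without truncation.\<close>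
  have "degree V E v = card V - 1 \<longleftrightarrow> (\<forall>u\<in>V. u \<noteq> v \<longrightarrow> E v u)" if v: "v \<in> V" for v
  proof -
    have sub: "{w \<in> V. E v w} \<subseteq> V - {v}" using irr by blast
    have "card {w \<in> V. E v w} = card (V - {v}) \<longleftrightarrow> {w \<in> V. E v w} = V - {v}"
      using card_subset_eq[OF finite_Diff[OF fin] sub] by metis
    also have "\<dots> \<longleftrightarrow> (\<forall>u\<in>V. u \<noteq> v \<longrightarrow> E v u)" using irr by auto
    finally show ?thesis using fin v by (simp add: degree_def)
  qed
  then have full: "Vfull = {v \<in> V. \<forall>u\<in>V. u \<noteq> v \<longrightarrow> E v u}" unfolding Vfull by blast
  interpret join_setup V Vfull E I P
  proof
    show "(\<Union>i\<in>I. P i) = V - Vfull" using decomp by (simp add: is_join_decomp_def)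
    show "P i \<inter> P j = {}" if "i \<in> I" "j \<in> I" "i \<noteq> j" for i j
      using decomp that unfolding is_join_decomp_def by blast
    show "E u w" if "i \<in> I" "j \<in> I" "i \<noteq> j" "u \<in> P i" "w \<in> P j" for i j u w
      using decomp that unfolding is_join_decomp_def by blast
    show "finite I" by (simp add: I_def)
    show "E u v \<longleftrightarrow> E v u" for u v by (rule sym)
  qed (use fin irr full nonempty irred in auto)
  show ?thesis by (rule spec_R_graph_group)
qed

end
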